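(* Let $(Q,\lambda,J)$ be a contact triad with contact distribution $\xi=\ker\lambda$, Reeb vector field $X_\lambda$, projection $\pi:TQ\to\xi$ and triad metric $\langle\cdot,\cdot\rangle$. For any $c\in\mathbb{R}$ there exists a unique affine connection $\nabla$ on $Q$ (with torsion $T$) satisfying all of the following: \begin{itemize} \item[(1)] $\nabla^\pi:=\pi\nabla|_\xi$ is a Hermitian connection of the Hermitian bundle $\xi\to Q$ with Hermitian structure $(d\lambda,J)$; \item[(2)] $\pi T(JY,Y)=0$ for all $Y$ tangent to $\xi$; \item[(3)] $T(X_\lambda,Y)=0$ for all $Y\in TQ$; \item[(4)] $\nabla_{X_\lambda}X_\lambda=0$, and $\nabla_YX_\lambda\in\xi$ for $Y\in\xi$; \item[(5;$c$)] $\nabla_{JY}X_\lambda+J\nabla_YX_\lambda=c\,Y$ for all $Y\in\xi$; \item[(6)] $\langle\nabla_YX_\lambda,Z\rangle+\langle X_\lambda,\nabla_YZ\rangle=0$ for all $Y,Z\in\xi$. \end{itemize}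
   Context: $Q$ is a smooth manifold of dimension $2n+1$ with contact form $\lambda$ (i.e. $\lambda\wedge(d\lambda)^n$ is nowhere zero) and $\xi=\ker\lambda$. The Reeb vector field $X_\lambda$ is the unique vector field with $\lambda(X_\lambda)=1$ and $d\lambda(X_\lambda,\cdot)=0$; then $TQ=\mathbb{R}\{X_\lambda\}\oplus\xi$ and $\pi:TQ\to\xi$ is the corresponding projection. A contact triad $(Q,\lambda,J)$ consists of such data with an endomorphism $J:\xi\to\xi$, $J^2=-\mathrm{id}_\xi$, compatible with $d\lambda$: $d\lambda(JY,JZ)=d\lambda(Y,Z)$ for $Y,Z\in\xi$ and $d\lambda(Y,JY)>0$ for $0\ne Y\in\xi$. $J$ is extended to $TQ$ by $JX_\lambda=0$. The triad metric is $\langle h,k\rangle=\lambda(h)\lambda(k)+d\lambda(\pi h,J\pi k)$. The convention is $d\lambda(X,Y)=X(\lambda(Y))-Y(\lambda(X))-\lambda([X,Y])$, and $T(X,Y)=\nabla_XY-\nabla_YX-[X,Y]$. For a section $Y$ of $\xi$ and $X\in TQ$, $\nabla^\pi_XY=\pi(\nabla_XY)$; it is Hermitian if $\nabla^\pi_X(JY)=J\nabla^\pi_XY$ and $X\langle Y,Z\rangle=\langle\nabla^\pi_XY,Z\rangle+\langle Y,\nabla^\pi_XZ\rangle$ for all vector fields $X$ on $Q$ and sections $Y,Z$ of $\xi$. *)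

theory Defs
  imports "HOL-Analysis.Analysis" "HOL-Library.Function_Algebras"
begin

subsection \<open>Smooth maps and smooth manifolds\<close>

primrec Ck_on :: "nat \<Rightarrow> 'a::real_normed_vector set \<Rightarrow> ('a \<Rightarrow> 'b::real_normed_vector) \<Rightarrow> bool" where
  "Ck_on 0 S f \<longleftrightarrow> continuous_on S f"
| "Ck_on (Suc k) S f \<longleftrightarrow> (\<forall>x\<in>S. f differentiable (at x)) \<and>
     (\<forall>v. Ck_on k S (\<lambda>x. frechet_derivative f (at x) v))"

text \<open>Only used for open \<open>S\<close>.\<close>

definition smooth_on :: "'a::real_normed_vector set \<Rightarrow> ('a \<Rightarrow> 'b::real_normed_vector) \<Rightarrow> bool" where
  "smooth_on S f \<longleftrightarrow> (\<forall>k. Ck_on k S f)"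

text \<open>The manifold is the whole type \<open>'q\<close> with its (Hausdorff, second countable) topology. A chart is
  a domain together with a coordinate map, of which only the values on the domain matter. The atlas
  need not be maximal.\<close>

type_synonym ('q, 'e) chart = "'q set \<times> ('q \<Rightarrow> 'e)"

definition smooth_atlas ::
    "('q::{t2_space,second_countable_topology}, 'e::euclidean_space) chart set \<Rightarrow> bool" where
  "smooth_atlas A \<longleftrightarrow>
     (\<Union>(U, \<phi>)\<in>A. U) = UNIV \<and>
     (\<forall>(U, \<phi>)\<in>A. open U \<and> open (\<phi> ` U) \<and> (\<exists>\<psi>. homeomorphism U (\<phi> ` U) \<phi> \<psi>)) \<and>
     (\<forall>(U, \<phi>)\<in>A. \<forall>(V, \<psi>)\<in>A. smooth_on (\<phi> ` (U \<inter> V)) (\<psi> \<circ> inv_into U \<phi>))"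

definition smooth_funs :: "('q, 'e::euclidean_space) chart set \<Rightarrow> ('q \<Rightarrow> real) set" where
  "smooth_funs A = {f. \<forall>(U, \<phi>)\<in>A. smooth_on (\<phi> ` U) (f \<circ> inv_into U \<phi>)}"

subsection \<open>Tangent vectors and vector fields\<close>

text \<open>Tangent vectors at \<open>p\<close> are the derivations at \<open>p\<close> of the algebra of smooth functions on the
  manifold. They are normalised to vanish on non-smooth functions, so that equality of functionals
  is equality of tangent vectors. The vector space operations, on tangent vectors and on vector
  fields, are the pointwise ones.\<close>

type_synonym 'q tvec = "('q \<Rightarrow> real) \<Rightarrow> real"
type_synonym 'q vfield = "'q \<Rightarrow> 'q tvec"

definition tangent_space :: "('q, 'e::euclidean_space) chart set \<Rightarrow> 'q \<Rightarrow> 'q tvec set" where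
  "tangent_space A p = {v.
     (\<forall>f. f \<notin> smooth_funs A \<longrightarrow> v f = 0) \<and>
     (\<forall>f\<in>smooth_funs A. \<forall>g\<in>smooth_funs A. v (\<lambda>q. f q + g q) = v f + v g) \<and>
     (\<forall>a. \<forall>f\<in>smooth_funs A. v (\<lambda>q. a * f q) = a * v f) \<and>
     (\<forall>f\<in>smooth_funs A. \<forall>g\<in>smooth_funs A. v (\<lambda>q. f q * g q) = f p * v g + g p * v f)}"

text \<open>The derivative \<open>X(f)\<close> of a function along a vector field.\<close>

definition vderiv :: "'q vfield \<Rightarrow> ('q \<Rightarrow> real) \<Rightarrow> 'q \<Rightarrow> real" where
  "vderiv X f = (\<lambda>p. X p f)"

text \<open>Smooth vector fields.\<close>

definition vfields :: "('q, 'e::euclidean_space) chart set \<Rightarrow> 'q vfield set" where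
  "vfields A = {X. (\<forall>p. X p \<in> tangent_space A p) \<and> (\<forall>f\<in>smooth_funs A. vderiv X f \<in> smooth_funs A)}"

definition fscale :: "('q \<Rightarrow> real) \<Rightarrow> 'q vfield \<Rightarrow> 'q vfield" where
  "fscale f X = (\<lambda>p h. f p * X p h)"

definition lie_bracket :: "'q vfield \<Rightarrow> 'q vfield \<Rightarrow> 'q vfield" where
  "lie_bracket X Y = (\<lambda>p f. X p (vderiv Y f) - Y p (vderiv X f))"

subsection \<open>Differential forms\<close>

definition one_form ::
    "('q, 'e::euclidean_space) chart set \<Rightarrow> ('q \<Rightarrow> 'q tvec \<Rightarrow> real) \<Rightarrow> bool" where
  "one_form A lam \<longleftrightarrow>
     (\<forall>p. \<forall>u\<in>tangent_space A p. \<forall>v\<in>tangent_space A p. lam p (u + v) = lam p u + lam p v) \<and>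
     (\<forall>p a. \<forall>u\<in>tangent_space A p. lam p (\<lambda>f. a * u f) = a * lam p u) \<and>
     (\<forall>X\<in>vfields A. (\<lambda>p. lam p (X p)) \<in> smooth_funs A)"

definition form_app :: "('q \<Rightarrow> 'q tvec \<Rightarrow> real) \<Rightarrow> 'q vfield \<Rightarrow> 'q \<Rightarrow> real" where
  "form_app lam X = (\<lambda>p. lam p (X p))"

text \<open>Exterior derivative of a 1-form, evaluated on two vector fields.\<close>

definition ext_deriv :: "('q \<Rightarrow> 'q tvec \<Rightarrow> real) \<Rightarrow> 'q vfield \<Rightarrow> 'q vfield \<Rightarrow> 'q \<Rightarrow> real" where
  "ext_deriv lam X Y = (\<lambda>p. vderiv X (form_app lam Y) p - vderiv Y (form_app lam X) p
                            - form_app lam (lie_bracket X Y) p)"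

text \<open>A \<open>k\<close>-form is given here by its values on sequences of vector fields, of which it only uses the
  first \<open>k\<close>; the degrees \<open>k\<close> and \<open>l\<close> are explicit arguments of the wedge product.\<close>

type_synonym 'q mform = "(nat \<Rightarrow> 'q vfield) \<Rightarrow> 'q \<Rightarrow> real"

definition wedge :: "nat \<Rightarrow> nat \<Rightarrow> 'q mform \<Rightarrow> 'q mform \<Rightarrow> 'q mform" where
  "wedge k l \<alpha> \<beta> = (\<lambda>X p. (1 / (fact k * fact l)) *
     (\<Sum>\<sigma> | \<sigma> permutes {..<k + l}.
        of_int (sign \<sigma>) * \<alpha> (\<lambda>i. X (\<sigma> i)) p * \<beta> (\<lambda>i. X (\<sigma> (k + i))) p))"

primrec wedge_power2 :: "'q mform \<Rightarrow> nat \<Rightarrow> 'q mform" where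
  "wedge_power2 \<omega> 0 = (\<lambda>X p. 1)"
| "wedge_power2 \<omega> (Suc n) = wedge 2 (2 * n) \<omega> (wedge_power2 \<omega> n)"

subsection \<open>Contact triads\<close>

text \<open>A form is nonzero at \<open>p\<close> if it is nonzero at \<open>p\<close> on some vector fields, every tangent vector at
  \<open>p\<close> being the value of a vector field.\<close>

definition contact_form ::
    "nat \<Rightarrow> ('q, 'e::euclidean_space) chart set \<Rightarrow> ('q \<Rightarrow> 'q tvec \<Rightarrow> real) \<Rightarrow> bool" where
  "contact_form n A lam \<longleftrightarrow> one_form A lam \<and>
     (\<forall>p. \<exists>X. (\<forall>i. X i \<in> vfields A) \<and>
        wedge 1 (2 * n) (\<lambda>X. form_app lam (X 0))
          (wedge_power2 (\<lambda>X. ext_deriv lam (X 0) (X 1)) n) X p \<noteq> 0)"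

definition contact_space ::
    "('q, 'e::euclidean_space) chart set \<Rightarrow> ('q \<Rightarrow> 'q tvec \<Rightarrow> real) \<Rightarrow> 'q \<Rightarrow> 'q tvec set" where
  "contact_space A lam p = {v \<in> tangent_space A p. lam p v = 0}"

text \<open>Smooth sections of the contact distribution.\<close>

definition contact_sections ::
    "('q, 'e::euclidean_space) chart set \<Rightarrow> ('q \<Rightarrow> 'q tvec \<Rightarrow> real) \<Rightarrow> 'q vfield set" where
  "contact_sections A lam = {Y \<in> vfields A. \<forall>p. Y p \<in> contact_space A lam p}"

definition endo_app :: "('q \<Rightarrow> 'q tvec \<Rightarrow> 'q tvec) \<Rightarrow> 'q vfield \<Rightarrow> 'q vfield" where
  "endo_app J Y = (\<lambda>p. J p (Y p))"

text \<open>\<open>J p\<close> is only constrained on the contact hyperplane at \<open>p\<close>.\<close>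

definition contact_almost_complex ::
    "('q, 'e::euclidean_space) chart set \<Rightarrow> ('q \<Rightarrow> 'q tvec \<Rightarrow> real) \<Rightarrow>
     ('q \<Rightarrow> 'q tvec \<Rightarrow> 'q tvec) \<Rightarrow> bool" where
  "contact_almost_complex A lam J \<longleftrightarrow>
     (\<forall>p. \<forall>u\<in>contact_space A lam p. J p u \<in> contact_space A lam p) \<and>
     (\<forall>p. \<forall>u\<in>contact_space A lam p. \<forall>v\<in>contact_space A lam p. J p (u + v) = J p u + J p v) \<and>
     (\<forall>p a. \<forall>u\<in>contact_space A lam p. J p (\<lambda>f. a * u f) = (\<lambda>f. a * J p u f)) \<and>
     (\<forall>Y\<in>contact_sections A lam. endo_app J Y \<in> vfields A) \<and>
     (\<forall>p. \<forall>u\<in>contact_space A lam p. J p (J p u) = - u)"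

definition contact_triad ::
    "nat \<Rightarrow> ('q::{t2_space,second_countable_topology}, 'e::euclidean_space) chart set \<Rightarrow>
     ('q \<Rightarrow> 'q tvec \<Rightarrow> real) \<Rightarrow> ('q \<Rightarrow> 'q tvec \<Rightarrow> 'q tvec) \<Rightarrow> bool" where
  "contact_triad n A lam J \<longleftrightarrow>
     smooth_atlas A \<and> DIM('e) = 2 * n + 1 \<and>
     contact_form n A lam \<and> contact_almost_complex A lam J \<and>
     (\<forall>Y\<in>contact_sections A lam. \<forall>Z\<in>contact_sections A lam.
        ext_deriv lam (endo_app J Y) (endo_app J Z) = ext_deriv lam Y Z) \<and>
     (\<forall>Y\<in>contact_sections A lam. \<forall>p. Y p \<noteq> 0 \<longrightarrow> ext_deriv lam Y (endo_app J Y) p > 0)"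

definition reeb ::
    "('q, 'e::euclidean_space) chart set \<Rightarrow> ('q \<Rightarrow> 'q tvec \<Rightarrow> real) \<Rightarrow> 'q vfield" where
  "reeb A lam = (THE R. R \<in> vfields A \<and> (\<forall>p. form_app lam R p = 1) \<and>
     (\<forall>Y\<in>vfields A. \<forall>p. ext_deriv lam R Y p = 0))"

definition contact_proj ::
    "('q, 'e::euclidean_space) chart set \<Rightarrow> ('q \<Rightarrow> 'q tvec \<Rightarrow> real) \<Rightarrow> 'q vfield \<Rightarrow> 'q vfield" where
  "contact_proj A lam X = X - fscale (form_app lam X) (reeb A lam)"

text \<open>The extension of \<open>J\<close> to the tangent bundle that annihilates the Reeb field.\<close>

definition J_ext ::
    "('q, 'e::euclidean_space) chart set \<Rightarrow> ('q \<Rightarrow> 'q tvec \<Rightarrow> real) \<Rightarrow>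
     ('q \<Rightarrow> 'q tvec \<Rightarrow> 'q tvec) \<Rightarrow> 'q vfield \<Rightarrow> 'q vfield" where
  "J_ext A lam J X = endo_app J (contact_proj A lam X)"

definition triad_metric ::
    "('q, 'e::euclidean_space) chart set \<Rightarrow> ('q \<Rightarrow> 'q tvec \<Rightarrow> real) \<Rightarrow>
     ('q \<Rightarrow> 'q tvec \<Rightarrow> 'q tvec) \<Rightarrow> 'q vfield \<Rightarrow> 'q vfield \<Rightarrow> 'q \<Rightarrow> real" where
  "triad_metric A lam J h k = (\<lambda>p. form_app lam h p * form_app lam k p
     + ext_deriv lam (contact_proj A lam h) (J_ext A lam J (contact_proj A lam k)) p)"

subsection \<open>Affine connections\<close>

text \<open>Connections are extensional, i.e. arbitrary but fixed on arguments that are not smooth vector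
  fields, so that equality of connections is equality on smooth vector fields.\<close>

type_synonym 'q conn = "'q vfield \<Rightarrow> 'q vfield \<Rightarrow> 'q vfield"

definition affine_connection :: "('q, 'e::euclidean_space) chart set \<Rightarrow> 'q conn \<Rightarrow> bool" where
  "affine_connection A D \<longleftrightarrow>
     D \<in> vfields A \<rightarrow>\<^sub>E (vfields A \<rightarrow>\<^sub>E vfields A) \<and>
     (\<forall>X\<in>vfields A. \<forall>X'\<in>vfields A. \<forall>Y\<in>vfields A. D (X + X') Y = D X Y + D X' Y) \<and>
     (\<forall>f\<in>smooth_funs A. \<forall>X\<in>vfields A. \<forall>Y\<in>vfields A. D (fscale f X) Y = fscale f (D X Y)) \<and>
     (\<forall>X\<in>vfields A. \<forall>Y\<in>vfields A. \<forall>Y'\<in>vfields A. D X (Y + Y') = D X Y + D X Y') \<and>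
     (\<forall>f\<in>smooth_funs A. \<forall>X\<in>vfields A. \<forall>Y\<in>vfields A.
        D X (fscale f Y) = fscale f (D X Y) + fscale (vderiv X f) Y)"

definition torsion :: "'q conn \<Rightarrow> 'q vfield \<Rightarrow> 'q vfield \<Rightarrow> 'q vfield" where
  "torsion D X Y = D X Y - D Y X - lie_bracket X Y"

definition proj_conn ::
    "('q, 'e::euclidean_space) chart set \<Rightarrow> ('q \<Rightarrow> 'q tvec \<Rightarrow> real) \<Rightarrow> 'q conn \<Rightarrow> 'q conn" where
  "proj_conn A lam D X Y = contact_proj A lam (D X Y)"

definition hermitian_conn ::
    "('q, 'e::euclidean_space) chart set \<Rightarrow> ('q \<Rightarrow> 'q tvec \<Rightarrow> real) \<Rightarrow>
     ('q \<Rightarrow> 'q tvec \<Rightarrow> 'q tvec) \<Rightarrow> 'q conn \<Rightarrow> bool" where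
  "hermitian_conn A lam J P \<longleftrightarrow>
     (\<forall>X\<in>vfields A. \<forall>Y\<in>contact_sections A lam. P X (J_ext A lam J Y) = J_ext A lam J (P X Y)) \<and>
     (\<forall>X\<in>vfields A. \<forall>Y\<in>contact_sections A lam. \<forall>Z\<in>contact_sections A lam.
        vderiv X (triad_metric A lam J Y Z)
          = triad_metric A lam J (P X Y) Z + triad_metric A lam J Y (P X Z))"

end

theory Submission
  imports Defs "HOL-Real_Asymp.Real_Asymp"
begin

text \<open>
  Write \<open>\<xi>\<close> for the contact distribution, \<open>R\<close> for the Reeb field, \<open>g(X,Z) = d\<lambda>(X, JZ)\<close> for the metric on
  \<open>\<xi>\<close> and \<open>\<pi>\<close> for the projection to \<open>\<xi>\<close>. Since every field is \<open>\<pi>X + \<lambda>(X)R\<close>, a connection is determined by its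
  values on pairs of contact sections, on pairs with one entry \<open>R\<close>, and on \<open>(R,R)\<close>, and the conditions fix
  each of these values separately.

  Consider first pairs involving \<open>R\<close>. For \<open>Y\<close> in \<open>\<xi>\<close> put \<open>S Y = \<nabla>\<^sub>Y R\<close>. As the torsion vanishes on \<open>R\<close>,
  \<open>\<nabla>\<^sub>R Y = S Y + [R,Y]\<close>, so the Hermitian condition says how \<open>S\<close> fails to commute with \<open>J\<close>, namely by the Lie
  derivative of \<open>J\<close> along \<open>R\<close>, while the condition with \<open>c\<close> says how it fails to anticommute. Adding the two
  relations leaves the only candidate \<open>S Y = -(cJY + [R,Y] + J[R,JY])/2\<close>. It is compatible with the metric
  because \<open>d\<lambda>\<close> is invariant under \<open>R\<close>; the term with \<open>c\<close> is skew and does not disturb this. The metric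
  condition for \<open>R\<close> and \<open>\<xi>\<close> then prescribes the Reeb component \<open>\<lambda>(\<nabla>\<^sub>Y Z) = -g(S Y, Z)\<close>.

  For the existence of the values on pairs of contact sections, let \<open>N\<close> be the Levi-Civita-like operation on
  \<open>\<xi>\<close> given by the Koszul formula with projected brackets. Its complex-linear part \<open>(N(X,Y) - J N(X,JY))/2\<close> is
  Hermitian. Its torsion has no component of type (1,1): evaluated on \<open>(JY,Y)\<close> this amounts to a single identity
  between Koszul expressions (\<open>koszul_form_closed\<close>), which is the closedness of \<open>d\<lambda>\<close> on the triple \<open>(Y,JY,Z)\<close>.

  For their uniqueness, consider the difference \<open>B\<close> of two solutions. It is biadditive, commutes with \<open>J\<close> in its second
  entry, is skew for \<open>g\<close>, and satisfies \<open>B(JY)Y = B(Y)JY\<close>. Polarizing the last identity, the expression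
  \<open>B(JY)Z - J B(Y)Z\<close> is antisymmetric, complex linear in \<open>Z\<close> and complex antilinear in \<open>Y\<close>, hence zero; so \<open>B(JY) = J B(Y)\<close>
  is at the same time skew and symmetric, hence zero (\<open>hermitian_difference_zero\<close>).

  All of this is algebra over the ring of smooth functions, apart from two existence
  statements: the Reeb field, and a contact section representing a given function-linear functional with respect
  to \<open>g\<close> (\<open>riesz\<close>). Both are solved near each point and glued by uniqueness. The local solution needs local
  frames, that is, that a derivation is determined by its values on coordinate functions (Hadamard's lemma), bump
  functions, and smooth solvability of a linear system with positive definite matrix (\<open>gram_system_local\<close>, by
  Schur complements). That \<open>\<lambda>\<close> has no zeros is read off from the contact condition, and the nondegeneracy
  of \<open>d\<lambda>\<close> on \<open>\<xi>\<close> from the positivity of \<open>g\<close>.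
\<close>

section \<open>Pointwise operations on vector fields\<close>

lemma sum_pointwise: "(\<Sum>i\<in>I. f i) x = (\<Sum>i\<in>I. f i x)"
  by (induction I rule: infinite_finite_induct) auto

lemma fscale_pointwise: "fscale h X p f = h p * X p f"
  by (simp add: fscale_def)

lemma fscale_0_left [simp]: "fscale 0 X = 0" "fscale (\<lambda>_. 0) X = 0"
  and fscale_0_right [simp]: "fscale h 0 = 0"
  and fscale_1 [simp]: "fscale 1 X = X"
  by (auto simp: fun_eq_iff fscale_pointwise)

lemma fscale_add_left: "fscale (h + k) X = fscale h X + fscale k X"
  and fscale_add_right: "fscale h (X + Y) = fscale h X + fscale h Y"
  and fscale_diff_left: "fscale (h - k) X = fscale h X - fscale k X"
  and fscale_diff_right: "fscale h (X - Y) = fscale h X - fscale h Y"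
  and fscale_uminus_right: "fscale h (- X) = - fscale h X"
  and fscale_fscale: "fscale h (fscale k X) = fscale (h * k) X"
  by (auto simp: fun_eq_iff fscale_pointwise algebra_simps)

lemma fscale_minus1: "fscale (\<lambda>_. -1) X = - X"
  by (auto simp: fscale_def fun_eq_iff)

section \<open>Calculus of \<open>C\<^sup>k\<close> functions\<close>

lemma Ck_on_cong:
  assumes "open S" "\<And>x. x \<in> S \<Longrightarrow> f x = g x"
  shows "Ck_on k S f \<longleftrightarrow> Ck_on k S g"
  using assms(2)
proof (induction k arbitrary: f g)
  case 0
  then show ?case by (auto intro: continuous_on_cong[THEN iffD1])
next
  case (Suc k)
  have d: "(f has_derivative D) (at x) \<longleftrightarrow> (g has_derivative D) (at x)" if "x \<in> S" for D x
    using has_derivative_transform_within_open[OF _ assms(1) that] Suc.prems by metis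
  have e: "frechet_derivative f (at x) = frechet_derivative g (at x)" if "x \<in> S" for x
    unfolding frechet_derivative_def using d[OF that] by simp
  have "Ck_on k S (\<lambda>x. frechet_derivative f (at x) v) = Ck_on k S (\<lambda>x. frechet_derivative g (at x) v)" for v
    by (rule Suc.IH) (simp add: e)
  then show ?case using d by (simp add: differentiable_def)
qed

lemma Ck_on_subset: "Ck_on k S f \<Longrightarrow> T \<subseteq> S \<Longrightarrow> Ck_on k T f"
  by (induction k arbitrary: f) (auto intro: continuous_on_subset)

lemma Ck_on_Suc_imp: "Ck_on (Suc k) S f \<Longrightarrow> Ck_on k S f"
proof (induction k arbitrary: f)
  case 0
  then show ?case
    by (auto intro!: continuous_at_imp_continuous_on differentiable_imp_continuous_within)
next
  case (Suc k)
  have "Ck_on k S (\<lambda>x. frechet_derivative f (at x) v)" for v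
    using Suc.IH Suc.prems by (metis Ck_on.simps(2))
  then show ?case using Suc.prems by simp
qed

lemma Ck_on_local:
  assumes "\<And>x. x \<in> S \<Longrightarrow> \<exists>T. open T \<and> x \<in> T \<and> Ck_on k T f"
  shows "Ck_on k S f"
  using assms
proof (induction k arbitrary: f)
  case 0
  then have "isCont f x" if "x \<in> S" for x
    using that by (metis Ck_on.simps(1) continuous_on_eq_continuous_at)
  then show ?case by (auto intro: continuous_at_imp_continuous_on)
next
  case (Suc k)
  have "Ck_on k S (\<lambda>x. frechet_derivative f (at x) v)" for v
    by (rule Suc.IH) (use Suc.prems in \<open>fastforce\<close>)
  moreover have "f differentiable (at x)" if "x \<in> S" for x
    using Suc.prems[OF that] by auto
  ultimately show ?case by simp
qed

lemma Ck_on_SucI: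
  assumes "open S" "\<And>x. x \<in> S \<Longrightarrow> (f has_derivative f' x) (at x)" "\<And>v. Ck_on k S (\<lambda>x. f' x v)"
  shows "Ck_on (Suc k) S f"
proof -
  have "Ck_on k S (\<lambda>x. frechet_derivative f (at x) v)" for v
    using assms(3)[of v] by (rule Ck_on_cong[OF assms(1), THEN iffD1, rotated])
      (use frechet_derivative_at[OF assms(2)] in metis)
  then show ?thesis using assms(2) by (auto simp: differentiable_def)
qed

lemma Ck_on_SucD:
  assumes "Ck_on (Suc k) S f" "x \<in> S"
  shows "(f has_derivative frechet_derivative f (at x)) (at x)"
  using assms frechet_derivative_works by auto

lemma Ck_on_const: "Ck_on k S (\<lambda>x. c)"
  by (induction k arbitrary: c) auto

lemma Ck_on_bounded_linear: "open S \<Longrightarrow> bounded_linear f \<Longrightarrow> Ck_on k S f"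
proof (cases k)
  case (Suc j)
  assume "open S" "bounded_linear f"
  then show ?thesis unfolding Suc
    by (intro Ck_on_SucI[where f'="\<lambda>_. f"])
       (auto simp: bounded_linear_imp_has_derivative Ck_on_const)
qed (auto simp: linear_continuous_on)

lemma Ck_on_bounded_linear_compose:
  assumes "open S" "bounded_linear h"
  shows "Ck_on k S f \<Longrightarrow> Ck_on k S (\<lambda>x. h (f x))"
proof (induction k arbitrary: f)
  case 0
  then show ?case
    using assms(2) by (auto intro: bounded_linear.continuous_on)
next
  case (Suc k)
  show ?case
    using Suc.prems Suc.IH
    by (intro Ck_on_SucI[where f'="\<lambda>x v. h (frechet_derivative f (at x) v)"] assms
        bounded_linear.has_derivative[OF assms(2)] Ck_on_SucD[OF Suc.prems]) auto
qed

lemma Ck_on_add: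
  assumes "open S"
  shows "Ck_on k S f \<Longrightarrow> Ck_on k S g \<Longrightarrow> Ck_on k S (\<lambda>x. f x + g x)"
proof (induction k arbitrary: f g)
  case 0
  then show ?case by (auto intro: continuous_intros)
next
  case (Suc k)
  show ?case
    using Suc.prems Suc.IH
    by (intro Ck_on_SucI[where f'="\<lambda>x v. frechet_derivative f (at x) v + frechet_derivative g (at x) v"]
        assms has_derivative_add Ck_on_SucD[OF Suc.prems(1)] Ck_on_SucD[OF Suc.prems(2)]) auto
qed

lemma Ck_on_sum:
  assumes "open S" "\<And>i. i \<in> I \<Longrightarrow> Ck_on k S (f i)"
  shows "Ck_on k S (\<lambda>x. \<Sum>i\<in>I. f i x)"
  using assms(2)
  by (induction I rule: infinite_finite_induct) (auto intro: Ck_on_const Ck_on_add[OF assms(1)])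

lemma Ck_on_mult:
  fixes f g :: "'a::real_normed_vector \<Rightarrow> real"
  assumes "open S"
  shows "Ck_on k S f \<Longrightarrow> Ck_on k S g \<Longrightarrow> Ck_on k S (\<lambda>x. f x * g x)"
proof (induction k arbitrary: f g)
  case 0
  then show ?case by (auto intro: continuous_intros)
next
  case (Suc k)
  have fg: "Ck_on k S f" "Ck_on k S g" using Suc.prems Ck_on_Suc_imp by blast+
  show ?case
    using Suc.prems Suc.IH fg
    by (intro Ck_on_SucI[where f'="\<lambda>x v. f x * frechet_derivative g (at x) v + frechet_derivative f (at x) v * g x"]
        assms has_derivative_mult Ck_on_SucD[OF Suc.prems(1)] Ck_on_SucD[OF Suc.prems(2)] Ck_on_add) auto
qed

text \<open>Differentiating \<open>g \<circ> f\<close> in direction \<open>v\<close> evaluates the derivative of \<open>g\<close> in a direction that moves with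
  the point. Expanding that direction in the standard basis leaves products of functions to which the
  induction applies.\<close>

lemma Ck_on_compose:
  fixes f :: "'a::real_normed_vector \<Rightarrow> 'e::euclidean_space" and g :: "'e \<Rightarrow> real"
  assumes "open S" "open T" "f ` S \<subseteq> T"
  shows "Ck_on k S f \<Longrightarrow> Ck_on k T g \<Longrightarrow> Ck_on k S (\<lambda>x. g (f x))"
proof (induction k arbitrary: g)
  case 0
  then show ?case using assms(3) by (auto intro: continuous_on_compose2)
next
  case (Suc k)
  have f: "Ck_on k S f" using Suc.prems Ck_on_Suc_imp by blast
  let ?f' = "\<lambda>x v. \<Sum>b\<in>Basis. (frechet_derivative f (at x) v \<bullet> b) * frechet_derivative g (at (f x)) b"
  have "((\<lambda>x. g (f x)) has_derivative ?f' x) (at x)" if x: "x \<in> S" for x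
  proof -
    have gd: "(g has_derivative frechet_derivative g (at (f x))) (at (f x))"
      using Ck_on_SucD[OF Suc.prems(2)] x assms(3) by blast
    have "frechet_derivative g (at (f x)) w = (\<Sum>b\<in>Basis. (w \<bullet> b) * frechet_derivative g (at (f x)) b)" for w
    proof -
      have lin: "linear (frechet_derivative g (at (f x)))"
        using gd has_derivative_linear by blast
      have "frechet_derivative g (at (f x)) w
          = frechet_derivative g (at (f x)) (\<Sum>b\<in>Basis. (w \<bullet> b) *\<^sub>R b)"
        by (simp add: euclidean_representation)
      also have "\<dots> = (\<Sum>b\<in>Basis. (w \<bullet> b) * frechet_derivative g (at (f x)) b)"
        using lin by (simp add: linear_sum linear_cmul)
      finally show ?thesis .
    qed
    then show ?thesis
      using has_derivative_compose[OF Ck_on_SucD[OF Suc.prems(1) x] gd] by (metis (no_types, lifting) ext)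
  qed
  moreover have "Ck_on k S (\<lambda>x. ?f' x v)" for v
  proof (intro Ck_on_sum Ck_on_mult assms(1))
    fix b :: 'e
    show "Ck_on k S (\<lambda>x. frechet_derivative f (at x) v \<bullet> b)"
      using Suc.prems by (intro Ck_on_bounded_linear_compose[OF assms(1) bounded_linear_inner_left]) auto
    show "Ck_on k S (\<lambda>x. frechet_derivative g (at (f x)) b)"
      using Suc.prems by (intro Suc.IH f) auto
  qed
  ultimately show ?case by (intro Ck_on_SucI[OF assms(1)])
qed

lemma Ck_on_inverse:
  fixes f :: "'a::real_normed_vector \<Rightarrow> real"
  assumes "open S" "\<And>x. x \<in> S \<Longrightarrow> f x \<noteq> 0"
  shows "Ck_on k S f \<Longrightarrow> Ck_on k S (\<lambda>x. inverse (f x))"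
proof (induction k)
  case 0
  then show ?case using assms(2) by (auto intro: continuous_intros)
next
  case (Suc k)
  have i: "Ck_on k S (\<lambda>x. inverse (f x))" using Suc Ck_on_Suc_imp by blast
  show ?case
  proof (rule Ck_on_SucI[OF assms(1)])
    show "((\<lambda>x. inverse (f x)) has_derivative
        (\<lambda>v. - 1 * (inverse (f x) * frechet_derivative f (at x) v * inverse (f x)))) (at x)" if "x \<in> S" for x
      using Deriv.has_derivative_inverse[OF assms(2)[OF that] Ck_on_SucD[OF Suc.prems that]] by simp
    show "Ck_on k S (\<lambda>x. - 1 * (inverse (f x) * frechet_derivative f (at x) v * inverse (f x)))" for v
      using Suc.prems by (intro Ck_on_mult assms(1) i Ck_on_const) auto
  qed
qed

lemma smooth_on_mono: "smooth_on S f \<Longrightarrow> S' \<subseteq> S \<Longrightarrow> smooth_on S' f"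
  by (auto simp: smooth_on_def intro: Ck_on_subset)

subsection \<open>A flat function and bump functions\<close>

text \<open>Dividing \<open>exp (-1/t)\<close> by all powers of \<open>t\<close> gives a family closed under differentiation, so that
  smoothness of the whole family follows by one induction.\<close>

definition flat :: "nat \<Rightarrow> real \<Rightarrow> real" where
  "flat n t = (if t > 0 then exp (- 1 / t) / t ^ n else 0)"

lemma flat_has_derivative:
  "(flat n has_real_derivative (flat (n + 2) t - real n * flat (n + 1) t)) (at t)"
proof -
  consider "t > 0" | "t < 0" | "t = 0" by linarith
  then show ?thesis
  proof cases
    case 1
    have "((\<lambda>t. exp (- 1 / t) / t ^ n) has_real_derivative (flat (n + 2) t - real n * flat (n + 1) t)) (at t)"
      using 1 by (auto intro!: derivative_eq_intros simp: flat_def, cases n) (auto simp: field_simps power2_eq_square)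
    then show ?thesis
      by (rule has_field_derivative_transform_within_open[where S="{0<..}"]) (use 1 in \<open>auto simp: flat_def\<close>)
  next
    case 2
    have "((\<lambda>t. 0) has_real_derivative (flat (n + 2) t - real n * flat (n + 1) t)) (at t)"
      using 2 by (auto simp: flat_def)
    then show ?thesis
      by (rule has_field_derivative_transform_within_open[where S="{..<0}"]) (use 2 in \<open>auto simp: flat_def\<close>)
  next
    case 3
    have "((\<lambda>h. exp (- 1 / h) / h ^ Suc n) \<longlongrightarrow> (0::real)) (at_right 0)"
      by real_asymp
    then have r: "((\<lambda>h. (flat n (0 + h) - flat n 0) / h) \<longlongrightarrow> 0) (at_right 0)"
      by (rule Lim_transform_eventually)
         (auto simp: flat_def eventually_at_right_field field_simps intro!: exI[of _ 1])
    have l: "((\<lambda>h. (flat n (0 + h) - flat n 0) / h) \<longlongrightarrow> 0) (at_left 0)"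
      by (rule Lim_transform_eventually[OF tendsto_const])
         (auto simp: flat_def eventually_at_left_field intro!: exI[of _ "-1"])
    show ?thesis unfolding 3 DERIV_def
      using filterlim_split_at[OF l r] by (simp add: flat_def)
  qed
qed

lemma Ck_on_flat: "Ck_on k UNIV (flat n)"
proof (induction k arbitrary: n)
  case 0
  show ?case
    by (auto intro!: continuous_at_imp_continuous_on DERIV_isCont[OF flat_has_derivative])
next
  case (Suc k)
  show ?case
  proof (rule Ck_on_SucI[OF open_UNIV])
    show "(flat n has_derivative (\<lambda>v. (flat (n + 2) t + (- real n) * flat (n + 1) t) * v)) (at t)" for t
      using flat_has_derivative[of n t] by (simp add: has_field_derivative_def)
    show "Ck_on k UNIV (\<lambda>t. (flat (n + 2) t + (- real n) * flat (n + 1) t) * v)" for v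
      using Suc.IH by (intro Ck_on_mult Ck_on_add Ck_on_const) auto
  qed
qed

text \<open>The quotient \<open>a / (a + b)\<close> with \<open>a\<close> vanishing exactly outside the large ball and \<open>b\<close> vanishing exactly
  on the small one; the denominator has no zero because the two sets are disjoint.\<close>

lemma ex_smooth_bump:
  fixes a :: "'e::euclidean_space"
  assumes "r > 0"
  obtains \<rho> where "smooth_on UNIV \<rho>" "\<And>x. x \<in> cball a (r / 2) \<Longrightarrow> \<rho> x = (1::real)"
    "\<And>x. x \<notin> ball a r \<Longrightarrow> \<rho> x = 0"
proof -
  define s :: "'e \<Rightarrow> real" where "s x = r\<^sup>2 + (-1) * ((x - a) \<bullet> (x - a))" for x
  define u :: "'e \<Rightarrow> real" where "u x = ((x - a) \<bullet> (x - a)) + (- (r / 2)\<^sup>2)" for x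
  define \<rho> where "\<rho> x = flat 0 (s x) * inverse (flat 0 (s x) + flat 0 (u x))" for x
  have sq: "Ck_on k UNIV (\<lambda>x. (x - a) \<bullet> (x - a))" for k
  proof -
    have "(\<lambda>x. (x - a) \<bullet> (x - a)) = (\<lambda>x. \<Sum>b\<in>Basis. ((x \<bullet> b) + (- (a \<bullet> b))) * ((x \<bullet> b) + (- (a \<bullet> b))))"
      by (subst euclidean_inner) (simp add: inner_diff_left)
    moreover have "Ck_on k UNIV (\<lambda>x. x \<bullet> b)" for b :: 'e
      by (intro Ck_on_bounded_linear open_UNIV bounded_linear_inner_left)
    ultimately show ?thesis
      by (simp only:) (intro Ck_on_sum Ck_on_mult Ck_on_add Ck_on_const open_UNIV)
  qed
  have s: "Ck_on k UNIV s" and u: "Ck_on k UNIV u" for k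
    unfolding s_def u_def by (intro Ck_on_add Ck_on_mult Ck_on_const sq open_UNIV)+
  have fs: "Ck_on k UNIV (\<lambda>x. flat 0 (s x))" "Ck_on k UNIV (\<lambda>x. flat 0 (u x))" for k
    using Ck_on_compose[OF open_UNIV open_UNIV _ s Ck_on_flat] Ck_on_compose[OF open_UNIV open_UNIV _ u Ck_on_flat]
    by auto
  have nn: "flat 0 t \<ge> 0" for t by (simp add: flat_def)
  have pp: "flat 0 t > 0 \<longleftrightarrow> t > 0" for t by (simp add: flat_def)
  have ss: "(x - a) \<bullet> (x - a) = (dist a x)\<^sup>2" for x
    by (metis dist_commute dist_norm power2_norm_eq_inner)
  have pos: "flat 0 (s x) + flat 0 (u x) > 0" for x
  proof -
    have "s x + u x > 0" using assms by (simp add: s_def u_def power2_eq_square field_simps)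
    then have "s x > 0 \<or> u x > 0" by linarith
    then show ?thesis using nn[of "s x"] nn[of "u x"] pp by (metis add_nonneg_pos add_pos_nonneg)
  qed
  have "smooth_on UNIV \<rho>"
    unfolding smooth_on_def \<rho>_def using pos
    by (intro allI Ck_on_mult Ck_on_inverse Ck_on_add fs) (auto simp: less_imp_neq[THEN not_sym])
  moreover have "\<rho> x = 1" if "x \<in> cball a (r / 2)" for x
  proof -
    have "(dist a x)\<^sup>2 \<le> (r / 2)\<^sup>2" using that by (intro power_mono) auto
    then have "u x \<le> 0" by (simp add: u_def ss)
    then have "flat 0 (u x) = 0" by (simp add: flat_def)
    then show ?thesis using pos[of x] by (simp add: \<rho>_def)
  qed
  moreover have "\<rho> x = 0" if "x \<notin> ball a r" for x
  proof -
    have "r\<^sup>2 \<le> (dist a x)\<^sup>2" using that assms by (intro power_mono) auto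
    then have "s x \<le> 0" by (simp add: s_def ss)
    then show ?thesis by (simp add: \<rho>_def flat_def)
  qed
  ultimately show ?thesis using that by blast
qed

subsection \<open>Hadamard's lemma\<close>

text \<open>Smooth dependence of the coefficient functions in Hadamard's lemma. Differentiation under the integral
  produces one more factor \<open>t\<close>, which is why the statement carries the weight \<open>t ^ m\<close>.\<close>

lemma Ck_on_radial_integral:
  fixes f :: "'e::euclidean_space \<Rightarrow> real"
  assumes "r > 0"
  shows "Ck_on k (ball a r) f \<Longrightarrow>
    Ck_on k (ball a r) (\<lambda>x. integral {0..1} (\<lambda>t. t ^ m * f (a + t *\<^sub>R (x - a))))"
proof (induction k arbitrary: f m)
  have in_ball: "a + t *\<^sub>R (x - a) \<in> ball a r" if "x \<in> ball a r" "t \<in> {0..1}" for x t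
  proof -
    have "norm (t *\<^sub>R (x - a)) \<le> norm (x - a)" using that by (auto simp: mult_left_le_one_le)
    then show ?thesis using that by (simp add: dist_norm norm_minus_commute)
  qed
  have cont: "continuous_on (ball a r \<times> cbox 0 1) (\<lambda>(x, t::real). t ^ m * f (a + t *\<^sub>R (x - a)))"
    if "continuous_on (ball a r) f" for f :: "'e \<Rightarrow> real" and m
  proof -
    have "continuous_on (ball a r \<times> cbox 0 1) (\<lambda>(x, t::real). a + t *\<^sub>R (x - a))"
      by (auto simp: split_beta intro!: continuous_intros)
    moreover have "(\<lambda>(x, t::real). a + t *\<^sub>R (x - a)) ` (ball a r \<times> cbox 0 1) \<subseteq> ball a r"
      using in_ball by fastforce
    ultimately have "continuous_on (ball a r \<times> cbox 0 1) (\<lambda>z. f (case z of (x, t::real) \<Rightarrow> a + t *\<^sub>R (x - a)))"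
      using continuous_on_compose2[OF that] by blast
    then show ?thesis by (auto simp: split_beta intro!: continuous_intros)
  qed
  {
    case 0
    then have "continuous_on (ball a r) (\<lambda>x. integral (cbox 0 1) (\<lambda>t::real. t ^ m * f (a + t *\<^sub>R (x - a))))"
      by (intro integral_continuous_on_param cont) auto
    then show ?case by simp
  next
    case (Suc k)
    let ?D = "\<lambda>x. frechet_derivative f (at x)"
    define F where "F x t = (\<Sum>b\<in>Basis. (t ^ Suc m * ?D (a + t *\<^sub>R (x - a)) b) *\<^sub>R blinfun_inner_left b)"
      for x :: 'e and t :: real
    have F: "blinfun_apply (F x t) v = t ^ Suc m * ?D (a + t *\<^sub>R (x - a)) v"
      if "x \<in> ball a r" "t \<in> {0..1}" for x t v
    proof -
      have "linear (?D (a + t *\<^sub>R (x - a)))"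
        using Ck_on_SucD[OF Suc.prems in_ball[OF that]] has_derivative_linear by blast
      then have "?D (a + t *\<^sub>R (x - a)) (\<Sum>b\<in>Basis. (v \<bullet> b) *\<^sub>R b)
          = (\<Sum>b\<in>Basis. (v \<bullet> b) * ?D (a + t *\<^sub>R (x - a)) b)"
        by (simp add: linear_sum linear_cmul)
      then have "?D (a + t *\<^sub>R (x - a)) v = (\<Sum>b\<in>Basis. (v \<bullet> b) * ?D (a + t *\<^sub>R (x - a)) b)"
        by (simp add: euclidean_representation)
      then show ?thesis
        by (simp add: F_def blinfun.sum_left blinfun.scaleR_left sum_distrib_left mult_ac)
    qed
    have ck: "Ck_on k (ball a r) (\<lambda>x. ?D x v)" for v using Suc.prems by simp
    have contD: "continuous_on (ball a r) (\<lambda>x. ?D x v)" for v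
      using ck[of v] by (cases k) (auto intro!: continuous_at_imp_continuous_on differentiable_imp_continuous_within)
    have "continuous_on (ball a r \<times> cbox 0 1) (\<lambda>z. F (fst z) (snd z))"
      unfolding F_def using cont[OF contD, of "Suc m"]
      by (intro continuous_on_sum continuous_on_scaleR continuous_on_const) (simp add: split_beta)
    then have contF: "continuous_on (ball a r \<times> cbox 0 1) (\<lambda>(x, t). F x t)"
      by (simp add: split_beta)
    have contf: "continuous_on (ball a r) f" using Suc.prems Ck_on_Suc_imp
      by (auto intro!: continuous_at_imp_continuous_on differentiable_imp_continuous_within)
    have slice: "continuous_on (cbox 0 1) (\<lambda>t. h x t)" if "continuous_on (ball a r \<times> cbox 0 1) (\<lambda>(x, t). h x t)"
      and "x \<in> ball a r" for h :: "'e \<Rightarrow> real \<Rightarrow> 'z::real_normed_vector" and x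
      using that by (auto intro!: continuous_on_compose2[OF that(1), where f="\<lambda>t. (x, t)", simplified] continuous_intros)
    show ?case
    proof (rule Ck_on_SucI)
      fix x assume x: "x \<in> ball a r"
      have "((\<lambda>x. integral (cbox 0 1) (\<lambda>t. t ^ m * f (a + t *\<^sub>R (x - a)))) has_derivative
          integral (cbox 0 1) (F x)) (at x within ball a r)"
      proof (rule leibniz_rule[OF _ _ contF x convex_ball])
        fix y t assume y: "y \<in> ball a r" and t: "t \<in> cbox (0::real) 1"
        have "((\<lambda>x. f (a + t *\<^sub>R (x - a))) has_derivative (\<lambda>v. ?D (a + t *\<^sub>R (y - a)) (t *\<^sub>R v))) (at y within ball a r)"
          using y t in_ball by (intro has_derivative_compose[OF _ Ck_on_SucD[OF Suc.prems]])
            (auto intro!: derivative_eq_intros)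
        moreover have "?D (a + t *\<^sub>R (y - a)) (t *\<^sub>R v) = t * ?D (a + t *\<^sub>R (y - a)) v" for v
          using Ck_on_SucD[OF Suc.prems in_ball[OF y]] t has_derivative_linear linear_cmul by fastforce
        ultimately have "((\<lambda>x. f (a + t *\<^sub>R (x - a))) has_derivative (\<lambda>v. t * ?D (a + t *\<^sub>R (y - a)) v)) (at y within ball a r)"
          by simp
        then have "((\<lambda>x. t ^ m * f (a + t *\<^sub>R (x - a))) has_derivative
            (\<lambda>v. t ^ m * (t * ?D (a + t *\<^sub>R (y - a)) v))) (at y within ball a r)"
          by (rule has_derivative_mult_right)
        then show "((\<lambda>x. t ^ m * f (a + t *\<^sub>R (x - a))) has_derivative blinfun_apply (F y t)) (at y within ball a r)"
          using F[OF y, of t] t by (simp add: mult_ac fun_eq_iff)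
             (metis (no_types, lifting) ext)
      next
        show "(\<lambda>t. t ^ m * f (a + t *\<^sub>R (y - a))) integrable_on cbox 0 1" if "y \<in> ball a r" for y
          by (intro integrable_continuous slice[OF cont[OF contf] that])
      qed
      moreover have "blinfun_apply (integral (cbox 0 1) (F x)) v
          = integral {0..1} (\<lambda>t. t ^ Suc m * ?D (a + t *\<^sub>R (x - a)) v)" for v
      proof -
        have "F x integrable_on cbox 0 1"
          by (intro integrable_continuous slice[OF contF x])
        then have "blinfun_apply (integral (cbox 0 1) (F x)) v = integral (cbox 0 1) (\<lambda>t. blinfun_apply (F x t) v)"
          by (rule blinfun_apply_integral)
        also have "\<dots> = integral (cbox 0 1) (\<lambda>t. t ^ Suc m * ?D (a + t *\<^sub>R (x - a)) v)"
          by (intro integral_cong F x) auto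
        finally show ?thesis by simp
      qed
      then have "blinfun_apply (integral (cbox 0 1) (F x))
          = (\<lambda>v. integral {0..1} (\<lambda>t. t ^ Suc m * ?D (a + t *\<^sub>R (x - a)) v))" by blast
      ultimately show "((\<lambda>x. integral {0..1} (\<lambda>t. t ^ m * f (a + t *\<^sub>R (x - a)))) has_derivative
          (\<lambda>v. integral {0..1} (\<lambda>t. t ^ Suc m * ?D (a + t *\<^sub>R (x - a)) v))) (at x)"
        using x by (simp add: at_within_open[OF x])
    next
      show "Ck_on k (ball a r) (\<lambda>x. integral {0..1} (\<lambda>t. t ^ Suc m * ?D (a + t *\<^sub>R (x - a)) v))" for v
        by (rule Suc.IH[OF ck])
    qed simp
  }
qed

text \<open>Integrating the derivative of \<open>f\<close> along the segment from \<open>a\<close> to \<open>x\<close>.\<close>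

lemma hadamard_lemma:
  fixes f :: "'e::euclidean_space \<Rightarrow> real"
  assumes "r > 0" and f: "smooth_on (ball a r) f"
  obtains g where "\<And>b. smooth_on (ball a r) (g b)" "\<And>b. g b a = frechet_derivative f (at a) b"
    "\<And>x. x \<in> ball a r \<Longrightarrow> f x = f a + (\<Sum>b\<in>Basis. ((x - a) \<bullet> b) * g b x)"
proof -
  let ?D = "\<lambda>x. frechet_derivative f (at x)"
  define g where "g b x = integral {0..1} (\<lambda>t. t ^ 0 * ?D (a + t *\<^sub>R (x - a)) b)" for b x
  have fS: "Ck_on (Suc k) (ball a r) f" for k using f by (auto simp: smooth_on_def)
  have 1: "smooth_on (ball a r) (g b)" for b
    unfolding smooth_on_def g_def using fS by (intro allI Ck_on_radial_integral assms(1)) auto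
  have 2: "g b a = ?D a b" for b by (simp add: g_def)
  have 3: "f x = f a + (\<Sum>b\<in>Basis. ((x - a) \<bullet> b) * g b x)" if x: "x \<in> ball a r" for x
  proof -
    have inb: "a + t *\<^sub>R (x - a) \<in> ball a r" if "t \<in> {0..1}" for t
    proof -
      have "norm (t *\<^sub>R (x - a)) \<le> norm (x - a)" using that by (auto simp: mult_left_le_one_le)
      then show ?thesis using x by (simp add: dist_norm norm_minus_commute)
    qed
    have exp: "?D y (x - a) = (\<Sum>b\<in>Basis. ((x - a) \<bullet> b) * ?D y b)" if "y \<in> ball a r" for y
    proof -
      have "linear (?D y)" using Ck_on_SucD[OF fS that] has_derivative_linear by blast
      then have "?D y (\<Sum>b\<in>Basis. ((x - a) \<bullet> b) *\<^sub>R b) = (\<Sum>b\<in>Basis. ((x - a) \<bullet> b) * ?D y b)"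
        by (simp add: linear_sum linear_cmul)
      then show ?thesis by (simp add: euclidean_representation)
    qed
    have "((\<lambda>t. ?D (a + t *\<^sub>R (x - a)) (x - a)) has_integral
        f (a + 1 *\<^sub>R (x - a)) - f (a + 0 *\<^sub>R (x - a))) {0..1}"
    proof (rule fundamental_theorem_of_calculus)
      fix t :: real assume t: "t \<in> {0..1}"
      have "((\<lambda>t. f (a + t *\<^sub>R (x - a))) has_derivative (\<lambda>s. ?D (a + t *\<^sub>R (x - a)) (s *\<^sub>R (x - a)))) (at t within {0..1})"
        using t inb by (intro has_derivative_compose[OF _ Ck_on_SucD[OF fS]]) (auto intro!: derivative_eq_intros)
      moreover have "?D (a + t *\<^sub>R (x - a)) (s *\<^sub>R (x - a)) = s *\<^sub>R ?D (a + t *\<^sub>R (x - a)) (x - a)" for s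
        using Ck_on_SucD[OF fS inb[OF t]] has_derivative_linear linear_cmul by blast
      ultimately show "((\<lambda>t. f (a + t *\<^sub>R (x - a))) has_vector_derivative ?D (a + t *\<^sub>R (x - a)) (x - a)) (at t within {0..1})"
        by (simp add: has_vector_derivative_def)
    qed simp
    then have "integral {0..1} (\<lambda>t. ?D (a + t *\<^sub>R (x - a)) (x - a)) = f x - f a"
      by (simp add: integral_unique)
    moreover have "integral {0..1} (\<lambda>t. ?D (a + t *\<^sub>R (x - a)) (x - a)) = (\<Sum>b\<in>Basis. ((x - a) \<bullet> b) * g b x)"
    proof -
      have int: "(\<lambda>t. ?D (a + t *\<^sub>R (x - a)) b) integrable_on {0..1}" for b
      proof (rule integrable_continuous_interval)
        have "Ck_on 0 (ball a r) (\<lambda>y. ?D y b)" using fS[of 0] by simp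
        then have "continuous_on (ball a r) (\<lambda>y. ?D y b)" by simp
        then show "continuous_on {0..1} (\<lambda>t. ?D (a + t *\<^sub>R (x - a)) b)"
          by (rule continuous_on_compose2) (use inb in \<open>auto intro!: continuous_intros\<close>)
      qed
      have "integral {0..1} (\<lambda>t. ?D (a + t *\<^sub>R (x - a)) (x - a))
          = integral {0..1} (\<lambda>t. \<Sum>b\<in>Basis. ((x - a) \<bullet> b) * ?D (a + t *\<^sub>R (x - a)) b)"
        by (intro integral_cong exp inb)
      also have "\<dots> = (\<Sum>b\<in>Basis. integral {0..1} (\<lambda>t. ((x - a) \<bullet> b) * ?D (a + t *\<^sub>R (x - a)) b))"
        by (intro integral_sum integrable_on_mult_right int) auto
      finally show ?thesis by (simp add: g_def)
    qed
    ultimately show ?thesis by simp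
  qed
  show ?thesis using that[OF 1 2 3] .
qed

section \<open>Smooth functions and vector fields on a manifold\<close>

locale smooth_manifold =
  fixes A :: "('q::{t2_space,second_countable_topology}, 'e::euclidean_space) chart set"
  assumes atlas: "smooth_atlas A"
begin

abbreviation F :: "('q \<Rightarrow> real) set" where "F \<equiv> smooth_funs A"
abbreviation T :: "'q \<Rightarrow> 'q tvec set" where "T \<equiv> tangent_space A"
abbreviation V :: "'q vfield set" where "V \<equiv> vfields A"

subsection \<open>Charts\<close>

lemma ex_chart: obtains U \<phi> where "(U, \<phi>) \<in> A" "p \<in> U"
proof -
  have "p \<in> (\<Union>(U, \<phi>)\<in>A. U)" using atlas by (simp add: smooth_atlas_def)
  then show ?thesis using that by auto
qed

lemma
  assumes "(U, \<phi>) \<in> A"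
  shows chart_open: "open U" and chart_image_open: "open (\<phi> ` U)"
    and chart_inj: "inj_on \<phi> U" and chart_continuous: "continuous_on U \<phi>"
    and chart_inv_continuous: "continuous_on (\<phi> ` U) (inv_into U \<phi>)"
proof -
  from assms atlas obtain \<psi> where *: "open U" "open (\<phi> ` U)" and h: "homeomorphism U (\<phi> ` U) \<phi> \<psi>"
    unfolding smooth_atlas_def by blast
  then show "open U" "open (\<phi> ` U)" by auto
  show i: "inj_on \<phi> U" by (metis h homeomorphism_apply1 inj_onI)
  show "continuous_on U \<phi>" using h homeomorphism_cont1 by blast
  have "inv_into U \<phi> y = \<psi> y" if "y \<in> \<phi> ` U" for y
    using that h i homeomorphism_apply1 by fastforce
  then show "continuous_on (\<phi> ` U) (inv_into U \<phi>)"
    using h homeomorphism_cont2 continuous_on_cong by metis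
qed

lemma chart_transition:
  "(U, \<phi>) \<in> A \<Longrightarrow> (W, \<psi>) \<in> A \<Longrightarrow> smooth_on (\<phi> ` (U \<inter> W)) (\<psi> \<circ> inv_into U \<phi>)"
  using atlas unfolding smooth_atlas_def by fastforce

lemma chart_image_open_subset:
  assumes "(U, \<phi>) \<in> A" "open W" "W \<subseteq> U"
  shows "open (\<phi> ` W)"
proof -
  have "\<phi> ` W = inv_into U \<phi> -` W \<inter> \<phi> ` U"
    using assms chart_inj[OF assms(1)] by (auto simp: subset_iff) 
  then show ?thesis
    using assms chart_inv_continuous chart_image_open by (metis continuous_on_open_vimage)
qed

lemma chart_vimage_open:
  assumes "(U, \<phi>) \<in> A" "open S" shows "open {q \<in> U. \<phi> q \<in> S}"
proof -
  have "{q \<in> U. \<phi> q \<in> S} = \<phi> -` S \<inter> U" by auto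
  then show ?thesis using assms chart_continuous chart_open by (metis continuous_on_open_vimage)
qed

subsection \<open>The algebra of smooth functions\<close>

lemma smooth_funs_iff: "f \<in> F \<longleftrightarrow> (\<forall>U \<phi>. (U, \<phi>) \<in> A \<longrightarrow> smooth_on (\<phi> ` U) (f \<circ> inv_into U \<phi>))"
  by (auto simp: smooth_funs_def)

lemma smooth_fun_chart:
  "f \<in> F \<Longrightarrow> (U, \<phi>) \<in> A \<Longrightarrow> Ck_on k (\<phi> ` U) (f \<circ> inv_into U \<phi>)"
  by (auto simp: smooth_funs_iff smooth_on_def)

lemma smooth_funI: 
  "(\<And>U \<phi> k. (U, \<phi>) \<in> A \<Longrightarrow> Ck_on k (\<phi> ` U) (\<lambda>x. f (inv_into U \<phi> x))) \<Longrightarrow> f \<in> F"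
  by (auto simp: smooth_funs_iff smooth_on_def o_def)

lemma smooth_const [simp, intro]: "(\<lambda>_. c) \<in> F"
  by (rule smooth_funI) (rule Ck_on_const)

lemma smooth_0 [simp, intro]: "0 \<in> F" and smooth_1 [simp, intro]: "1 \<in> F"
  by (simp_all add: zero_fun_def one_fun_def)

lemma smooth_add [simp, intro]: "f \<in> F \<Longrightarrow> g \<in> F \<Longrightarrow> f + g \<in> F"
  by (rule smooth_funI) (auto intro!: Ck_on_add dest: smooth_fun_chart simp: chart_image_open o_def)

lemma smooth_mult [simp, intro]: "f \<in> F \<Longrightarrow> g \<in> F \<Longrightarrow> f * g \<in> F"
  by (rule smooth_funI) (auto intro!: Ck_on_mult dest: smooth_fun_chart simp: chart_image_open o_def)

lemma smooth_uminus [simp, intro]: "f \<in> F \<Longrightarrow> - f \<in> F"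
  using smooth_mult[of "\<lambda>_. -1" f] by (simp add: times_fun_def fun_Compl_def)

lemma smooth_diff [simp, intro]: "f \<in> F \<Longrightarrow> g \<in> F \<Longrightarrow> f - g \<in> F"
  using smooth_add[of f "- g"] by simp

lemma smooth_sum [intro]: "(\<And>i. i \<in> I \<Longrightarrow> f i \<in> F) \<Longrightarrow> (\<Sum>i\<in>I. f i) \<in> F"
  by (induction I rule: infinite_finite_induct) auto

lemma smooth_inverse: "f \<in> F \<Longrightarrow> (\<And>q. f q \<noteq> 0) \<Longrightarrow> (\<lambda>q. inverse (f q)) \<in> F"
  by (rule smooth_funI) (auto intro!: Ck_on_inverse dest: smooth_fun_chart simp: chart_image_open o_def)

lemma smooth_local:
  assumes "\<And>p. \<exists>g\<in>F. \<exists>W. open W \<and> p \<in> W \<and> (\<forall>q\<in>W. f q = g q)"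
  shows "f \<in> F"
proof (rule smooth_funI, rule Ck_on_local)
  fix U \<phi> k x assume c: "(U, \<phi>) \<in> A" and "x \<in> \<phi> ` U"
  then obtain p where p: "p \<in> U" "x = \<phi> p" by blast
  obtain g W where g: "g \<in> F" "open W" "p \<in> W" "\<And>q. q \<in> W \<Longrightarrow> f q = g q" using assms by metis
  let ?S = "\<phi> ` (U \<inter> W)"
  have o: "open ?S" using chart_image_open_subset[OF c] chart_open[OF c] g by blast
  have "Ck_on k ?S (g \<circ> inv_into U \<phi>)"
    using smooth_fun_chart[OF g(1) c] by (rule Ck_on_subset) auto
  then have "Ck_on k ?S (\<lambda>x. f (inv_into U \<phi> x))"
    by (rule Ck_on_cong[OF o, THEN iffD1, rotated]) (use g chart_inj[OF c] in auto)
  then show "\<exists>S. open S \<and> x \<in> S \<and> Ck_on k S (\<lambda>x. f (inv_into U \<phi> x))"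
    using o p g by blast
qed

lemma smooth_continuous: assumes "f \<in> F" shows "continuous_on UNIV f"
proof (rule continuous_at_imp_continuous_on, rule ballI)
  fix p
  obtain U \<phi> where c: "(U, \<phi>) \<in> A" "p \<in> U" using ex_chart .
  have "continuous_on (\<phi> ` U) (f \<circ> inv_into U \<phi>)"
    using smooth_fun_chart[OF assms c(1), of 0] by simp
  then have "continuous_on U ((f \<circ> inv_into U \<phi>) \<circ> \<phi>)"
    using chart_continuous[OF c(1)] continuous_on_compose by blast
  then have "continuous_on U f"
    by (rule continuous_on_cong[THEN iffD1, rotated 2]) (auto simp: chart_inj[OF c(1)])
  then show "isCont f p" using c chart_open[OF c(1)] by (simp add: continuous_on_eq_continuous_at)
qed

lemma smooth_nonzero_open: "f \<in> F \<Longrightarrow> open {q. f q \<noteq> 0}"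
  using smooth_continuous[of f] open_Collect_neq[of f "\<lambda>_. 0"] by simp

text \<open>Extension by zero is smooth because the preimage of the compact set \<open>K\<close> is closed in the Hausdorff
  space, so that its complement is an open set on which the extension vanishes.\<close>

lemma smooth_chart_extension:
  fixes g :: "'e \<Rightarrow> real"
  assumes c: "(U, \<phi>) \<in> A" and K: "compact K" "K \<subseteq> \<phi> ` U"
    and g: "smooth_on (\<phi> ` U) g" and g0: "\<And>x. x \<in> \<phi> ` U - K \<Longrightarrow> g x = 0"
  shows "(\<lambda>q. if q \<in> U then g (\<phi> q) else 0) \<in> F" (is "?f \<in> F")
proof (rule smooth_funI, rule Ck_on_local)
  fix W \<psi> k x assume d: "(W, \<psi>) \<in> A" and "x \<in> \<psi> ` W"
  then obtain q where q: "q \<in> W" "x = \<psi> q" by blast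
  show "\<exists>S. open S \<and> x \<in> S \<and> Ck_on k S (\<lambda>x. ?f (inv_into W \<psi> x))"
  proof (cases "q \<in> U")
    case True
    let ?S = "\<psi> ` (W \<inter> U)"
    have o: "open ?S" using chart_image_open_subset[OF d] chart_open[OF c] chart_open[OF d] by blast
    have "Ck_on k ?S (\<lambda>x. g (\<phi> (inv_into W \<psi> x)))"
    proof (rule Ck_on_compose[OF o chart_image_open[OF c]])
      show "Ck_on k ?S (\<lambda>x. \<phi> (inv_into W \<psi> x))"
        using chart_transition[OF d c] by (simp add: smooth_on_def o_def)
      show "(\<lambda>x. \<phi> (inv_into W \<psi> x)) ` ?S \<subseteq> \<phi> ` U"
        using chart_inj[OF d] by auto
    qed (use g in \<open>simp add: smooth_on_def\<close>)
    then have "Ck_on k ?S (\<lambda>x. ?f (inv_into W \<psi> x))"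
      by (rule Ck_on_cong[OF o, THEN iffD1, rotated]) (use chart_inj[OF d] in auto)
    moreover have "x \<in> ?S" using q True by blast
    ultimately show ?thesis using o by blast
  next
    case False
    let ?L = "inv_into U \<phi> ` K"
    have "compact ?L" using chart_inv_continuous[OF c] K continuous_on_subset compact_continuous_image by blast
    then have cl: "closed ?L" by (rule compact_imp_closed)
    have LU: "?L \<subseteq> U" using K by (auto intro: inv_into_into)
    have z: "?f q' = 0" if "q' \<notin> ?L" for q'
    proof (cases "q' \<in> U")
      case True
      then have "inv_into U \<phi> (\<phi> q') = q'" using chart_inj[OF c] by simp
      then have "\<phi> q' \<notin> K" using that by (metis imageI)
      then show ?thesis using True g0[of "\<phi> q'"] by simp
    qed simp
    let ?S = "\<psi> ` (W - ?L)"
    have o: "open ?S" using chart_image_open_subset[OF d] chart_open[OF d] cl by blast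
    have "Ck_on k ?S (\<lambda>x. 0::real)" by (rule Ck_on_const)
    then have "Ck_on k ?S (\<lambda>x. ?f (inv_into W \<psi> x))"
      by (rule Ck_on_cong[OF o, THEN iffD1, rotated]) (use z in \<open>metis (no_types, lifting) DiffD1 DiffD2 chart_inj[OF d] imageE inv_into_f_f\<close>)
    moreover have "x \<in> ?S" using q LU False by blast
    ultimately show ?thesis using o by blast
  qed
qed

lemma ex_chart_bump:
  assumes c: "(U, \<phi>) \<in> A" and "p \<in> U" "open W" "p \<in> W"
  obtains \<rho> r where "r > 0" "smooth_on UNIV \<rho>" "cball (\<phi> p) r \<subseteq> \<phi> ` (U \<inter> W)"
    "\<And>x. x \<in> cball (\<phi> p) (r / 2) \<Longrightarrow> \<rho> x = (1::real)" "\<And>x. x \<notin> ball (\<phi> p) r \<Longrightarrow> \<rho> x = 0"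
proof -
  have "open (\<phi> ` (U \<inter> W))" using chart_image_open_subset[OF c] chart_open[OF c] assms by blast
  then obtain r where r: "r > 0" "cball (\<phi> p) r \<subseteq> \<phi> ` (U \<inter> W)"
    using assms open_contains_cball[of "\<phi> ` (U \<inter> W)"] by blast
  obtain \<rho> :: "'e \<Rightarrow> real" where "smooth_on UNIV \<rho>" "\<And>x. x \<in> cball (\<phi> p) (r / 2) \<Longrightarrow> \<rho> x = (1::real)"
    "\<And>x. x \<notin> ball (\<phi> p) r \<Longrightarrow> \<rho> x = 0" using ex_smooth_bump[OF r(1)] by blast
  with r that show ?thesis by blast
qed

lemma ex_bump:
  assumes "open W" "p \<in> W"
  obtains \<rho> W' where "\<rho> \<in> F" "open W'" "p \<in> W'" "W' \<subseteq> W" "\<And>q. q \<in> W' \<Longrightarrow> \<rho> q = 1"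
    "\<And>q. q \<notin> W \<Longrightarrow> \<rho> q = 0"
proof -
  obtain U \<phi> where c: "(U, \<phi>) \<in> A" "p \<in> U" using ex_chart .
  obtain r \<rho> where r: "r > 0" "smooth_on UNIV \<rho>" "cball (\<phi> p) r \<subseteq> \<phi> ` (U \<inter> W)"
    "\<And>x. x \<in> cball (\<phi> p) (r / 2) \<Longrightarrow> \<rho> x = (1::real)" "\<And>x. x \<notin> ball (\<phi> p) r \<Longrightarrow> \<rho> x = 0"
    by (rule ex_chart_bump[OF c assms]) (rule that)
  let ?f = "\<lambda>q. if q \<in> U then \<rho> (\<phi> q) else 0"
  let ?W = "{q \<in> U. \<phi> q \<in> ball (\<phi> p) (r / 2)}"
  have inW: "q \<in> W" if "q \<in> U" "\<phi> q \<in> cball (\<phi> p) r" for q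
  proof -
    have "\<phi> q \<in> \<phi> ` (U \<inter> W)" using that r(3) by blast
    then obtain q' where "q' \<in> U \<inter> W" "\<phi> q = \<phi> q'" by blast
    then show ?thesis using that chart_inj[OF c(1)] by (auto dest: inj_onD)
  qed
  have "?f \<in> F"
    using r by (intro smooth_chart_extension[OF c(1) compact_cball, of "\<phi> p" r])
      (auto intro: smooth_on_mono)
  moreover have "open ?W" by (rule chart_vimage_open[OF c(1) open_ball])
  moreover have "p \<in> ?W" using c r by auto
  moreover have "?W \<subseteq> W" using r(1) by (auto intro!: inW)
  moreover have "?f q = 1" if "q \<in> ?W" for q using that r by auto
  moreover have "?f q = 0" if "q \<notin> W" for q
  proof (cases "q \<in> U")
    case True
    then have "\<phi> q \<notin> ball (\<phi> p) r" using inW[OF True] that by auto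
    then show ?thesis using r(5) by simp
  qed simp
  ultimately show ?thesis using that by blast
qed

text \<open>With \<open>\<rho>\<close> a bump function at \<open>p\<close> supported where \<open>f \<noteq> 0\<close>, the function \<open>f / (f\<^sup>2 + (1 - \<rho>)\<^sup>2)\<close> is
  globally smooth and equals \<open>1 / f\<close> where \<open>\<rho> = 1\<close>.\<close>

lemma ex_local_reciprocal:
  assumes f: "f \<in> F" and "f p \<noteq> 0"
  obtains h W where "h \<in> F" "open W" "p \<in> W" "\<And>q. q \<in> W \<Longrightarrow> h q * f q = 1"
proof -
  have o: "open {q. f q \<noteq> 0}" "p \<in> {q. f q \<noteq> 0}" using smooth_nonzero_open[OF f] assms(2) by simp_all
  obtain \<rho> W where \<rho>: "\<rho> \<in> F" "open W" "p \<in> W" "W \<subseteq> {q. f q \<noteq> 0}" "\<And>q. q \<in> W \<Longrightarrow> \<rho> q = 1"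
    "\<And>q. q \<notin> {q. f q \<noteq> 0} \<Longrightarrow> \<rho> q = 0"
    by (rule ex_bump[OF o]) (rule that)
  define d where "d = f * f + (1 - \<rho>) * (1 - \<rho>)"
  have d: "d q \<noteq> 0" for q
  proof -
    have "f q \<noteq> 0 \<or> 1 - \<rho> q \<noteq> 0" using \<rho>(6)[of q] by auto
    then show ?thesis by (simp add: d_def sum_squares_eq_zero_iff)
  qed
  have "d \<in> F" using f \<rho> by (simp add: d_def)
  then have "f * (\<lambda>q. inverse (d q)) \<in> F" using f d smooth_inverse by blast
  moreover have "(f * (\<lambda>q. inverse (d q))) q * f q = 1" if "q \<in> W" for q
    using that \<rho> by (auto simp: d_def field_simps)
  ultimately show ?thesis using that \<rho> by blast
qed

subsection \<open>Tangent vectors\<close>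

lemma
  assumes v: "v \<in> T p"
  shows tangent_nonsmooth: "f \<notin> F \<Longrightarrow> v f = 0"
    and tangent_add: "f \<in> F \<Longrightarrow> g \<in> F \<Longrightarrow> v (f + g) = v f + v g"
    and tangent_mult: "f \<in> F \<Longrightarrow> g \<in> F \<Longrightarrow> v (f * g) = f p * v g + g p * v f"
    and tangent_scale: "f \<in> F \<Longrightarrow> v (\<lambda>q. a * f q) = a * v f"
  using v by (auto simp: tangent_space_def plus_fun_def times_fun_def)

lemma
  assumes v: "v \<in> T p"
  shows tangent_const: "v (\<lambda>_. a) = 0" and tangent_0: "v 0 = 0" and tangent_1: "v 1 = 0"
    and tangent_uminus: "f \<in> F \<Longrightarrow> v (- f) = - v f"
    and tangent_diff: "f \<in> F \<Longrightarrow> g \<in> F \<Longrightarrow> v (f - g) = v f - v g"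
proof -
  show 1: "v 1 = 0" using tangent_mult[OF v smooth_1 smooth_1] by simp
  show c: "v (\<lambda>_. a) = 0" for a using tangent_scale[OF v smooth_1, of a] 1 by (simp add: one_fun_def)
  show "v 0 = 0" using c[of 0] by (simp add: zero_fun_def)
  show m: "v (- f) = - v f" if "f \<in> F" for f
    using tangent_scale[OF v that, of "-1"] by (simp add: fun_Compl_def)
  show "v (f - g) = v f - v g" if "f \<in> F" "g \<in> F"
    using tangent_add[OF v that(1), of "- g"] m that by simp
qed

lemma tangent_sum:
  assumes "v \<in> T p" "\<And>i. i \<in> I \<Longrightarrow> f i \<in> F"
  shows "v (\<Sum>i\<in>I. f i) = (\<Sum>i\<in>I. v (f i))"
  using assms(2) 
proof (induction I rule: infinite_finite_induct)
  case (insert i I)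
  then have "v (f i + sum f I) = v (f i) + (\<Sum>i\<in>I. v (f i))"
    using tangent_add[OF assms(1), of "f i" "sum f I"] smooth_sum[of I f] by simp
  then show ?case by (simp only: sum.insert[OF insert.hyps])
qed (simp_all add: tangent_0[OF assms(1)])

lemma tangent_space_add: "u \<in> T p \<Longrightarrow> v \<in> T p \<Longrightarrow> u + v \<in> T p"
  by (auto simp: tangent_space_def algebra_simps)

lemma tangent_space_scale: "v \<in> T p \<Longrightarrow> (\<lambda>f. a * v f) \<in> T p"
  by (auto simp: tangent_space_def algebra_simps)

lemma tangent_space_0: "0 \<in> T p"
  by (auto simp: tangent_space_def)

text \<open>The value of a derivation on \<open>f\<close> is found by expanding \<open>f\<close> around the point with Hadamard's
  lemma and applying the Leibniz rule; a bump function makes all factors globally defined.\<close>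

lemma tangent_chart_representation:
  assumes c: "(U, \<phi>) \<in> A" and p: "p \<in> U" and v: "v \<in> T p"
  obtains w :: "'e \<Rightarrow> real" where
    "\<And>f. f \<in> F \<Longrightarrow> v f = (\<Sum>b\<in>Basis. w b * frechet_derivative (f \<circ> inv_into U \<phi>) (at (\<phi> p)) b)"
proof -
  let ?a = "\<phi> p"
  have "?a \<in> \<phi> ` U" using p by blast
  then obtain R where R: "R > 0" "ball ?a R \<subseteq> \<phi> ` U"
    using chart_image_open[OF c] open_contains_ball by blast
  \<comment> \<open>the bump function is supported in a smaller ball, since Hadamard's coefficients are smooth only on
    \<open>ball ?a R\<close>\<close>
  let ?W = "{q \<in> U. \<phi> q \<in> ball ?a R}"
  have W: "open ?W" "p \<in> ?W" using chart_vimage_open[OF c open_ball] p R by auto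
  obtain r \<rho> where r: "r > 0" "smooth_on UNIV \<rho>" "cball ?a r \<subseteq> \<phi> ` (U \<inter> ?W)"
    "\<And>x. x \<in> cball ?a (r / 2) \<Longrightarrow> \<rho> x = (1::real)" "\<And>x. x \<notin> ball ?a r \<Longrightarrow> \<rho> x = 0"
    by (rule ex_chart_bump[OF c p W]) (rule that)
  have rR: "cball ?a r \<subseteq> ball ?a R" using r(3) by fastforce
  have \<rho>a: "\<rho> ?a = 1" using r by simp
  define ext where "ext g q = (if q \<in> U then \<rho> (\<phi> q) * g (\<phi> q) else 0)" for g q
  have ext: "ext g \<in> F" if g: "smooth_on (ball ?a R) g" for g
    unfolding ext_def
  proof (rule smooth_chart_extension[OF c compact_cball, of ?a r])
    show "cball ?a r \<subseteq> \<phi> ` U" using rR R by blast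
    show "smooth_on (\<phi> ` U) (\<lambda>x. \<rho> x * g x)"
      unfolding smooth_on_def
    proof (intro allI Ck_on_local)
      fix k x
      show "\<exists>S. open S \<and> x \<in> S \<and> Ck_on k S (\<lambda>x. \<rho> x * g x)"
      proof (cases "x \<in> ball ?a R")
        case True
        have "Ck_on k (ball ?a R) (\<lambda>x. \<rho> x * g x)"
          using g r(2) by (intro Ck_on_mult) (auto simp: smooth_on_def intro: Ck_on_subset)
        then show ?thesis using True by blast
      next
        case False
        have "Ck_on k (- cball ?a r) (\<lambda>x. 0::real)" by (rule Ck_on_const)
        then have "Ck_on k (- cball ?a r) (\<lambda>x. \<rho> x * g x)"
          by (rule Ck_on_cong[THEN iffD1, rotated 2]) (use r(5) in \<open>auto simp: open_Compl\<close>)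
        moreover have "x \<in> - cball ?a r" using False rR by blast
        ultimately show ?thesis using open_Compl[OF closed_cball] by blast
      qed
    qed
  qed (use r(5) in auto)
  define X where "X b = ext (\<lambda>x. (x - ?a) \<bullet> b)" for b
  have X: "X b \<in> F" for b
    unfolding X_def
  proof (rule ext)
    have "smooth_on (ball ?a R) (\<lambda>x. x \<bullet> b + (- (?a \<bullet> b)))"
      unfolding smooth_on_def
      by (intro allI Ck_on_add open_ball Ck_on_const Ck_on_bounded_linear bounded_linear_inner_left)
    then show "smooth_on (ball ?a R) (\<lambda>x. (x - ?a) \<bullet> b)" by (simp add: inner_diff_left)
  qed
  have "v f = (\<Sum>b\<in>Basis. v (X b) * frechet_derivative (f \<circ> inv_into U \<phi>) (at ?a) b)" if f: "f \<in> F" for f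
  proof -
    let ?f = "f \<circ> inv_into U \<phi>"
    have fR: "smooth_on (ball ?a R) ?f"
      using smooth_fun_chart[OF f c] R by (auto simp: smooth_on_def intro: Ck_on_subset)
    obtain g where g: "\<And>b. smooth_on (ball ?a R) (g b)" "\<And>b. g b ?a = frechet_derivative ?f (at ?a) b"
      "\<And>x. x \<in> ball ?a R \<Longrightarrow> ?f x = ?f ?a + (\<Sum>b\<in>Basis. ((x - ?a) \<bullet> b) * g b x)"
      by (rule hadamard_lemma[OF R(1) fR]) (rule that)
    let ?P = "ext (\<lambda>_. 1)"
    have P: "?P \<in> F" by (intro ext) (simp add: smooth_on_def Ck_on_const)
    have G: "ext (g b) \<in> F" for b by (intro ext g)
    have inv: "inv_into U \<phi> (\<phi> q) = q" if "q \<in> U" for q using chart_inj[OF c] that by simp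
    \<comment> \<open>both sides carry the square of the bump function, one factor for each function on the right\<close>
    have eq: "(?P * ?P) * (f - (\<lambda>_. f p)) = (\<Sum>b\<in>Basis. X b * ext (g b))"
    proof
      fix q
      show "((?P * ?P) * (f - (\<lambda>_. f p))) q = (\<Sum>b\<in>Basis. X b * ext (g b)) q"
      proof (cases "q \<in> U \<and> \<phi> q \<in> ball ?a R")
        case True
        then have "f q = f p + (\<Sum>b\<in>Basis. ((\<phi> q - ?a) \<bullet> b) * g b (\<phi> q))"
          using g(3)[of "\<phi> q"] inv p by simp
        then show ?thesis using True
          by (simp add: sum_pointwise ext_def X_def sum_distrib_left mult_ac)
      next
        case False
        then have "ext h q = 0" for h using r(5)[of "\<phi> q"] rR by (force simp: ext_def)
        then show ?thesis by (simp add: sum_pointwise X_def)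
      qed
    qed
    have "v ((?P * ?P) * (f - (\<lambda>_. f p))) = v f"
      using P f p \<rho>a by (simp add: tangent_mult[OF v] tangent_diff[OF v] tangent_const[OF v] ext_def)
    moreover have "v (\<Sum>b\<in>Basis. X b * ext (g b)) = (\<Sum>b\<in>Basis. v (X b) * g b ?a)"
    proof -
      have "X b p = 0" for b by (simp add: X_def ext_def)
      then show ?thesis using p \<rho>a
        by (subst tangent_sum[OF v]) (auto simp: X G tangent_mult[OF v] ext_def mult.commute intro!: sum.cong)
    qed
    ultimately show ?thesis using eq g(2) by simp
  qed
  then show ?thesis by (rule that)
qed

text \<open>Coordinate fields and coordinate functions, both cut off by a bump function. The expansion of \<open>v\<close> holds
  at all points near \<open>p\<close> with the same functions \<open>x b\<close>, although the representation of derivations is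
  obtained separately at each point: its coefficients are recovered by evaluating on \<open>x b\<close>.\<close>

lemma ex_local_frame:
  obtains W :: "'q set" and E :: "'e \<Rightarrow> 'q vfield" and x :: "'e \<Rightarrow> 'q \<Rightarrow> real"
  where "open W" "p \<in> W" "\<And>b. E b \<in> V" "\<And>b. x b \<in> F"
    "\<And>q b c. q \<in> W \<Longrightarrow> b \<in> Basis \<Longrightarrow> c \<in> Basis \<Longrightarrow> E b q (x c) = (if b = c then 1 else 0)"
    "\<And>q v f. q \<in> W \<Longrightarrow> v \<in> T q \<Longrightarrow> v f = (\<Sum>b\<in>Basis. v (x b) * E b q f)"
proof -
  obtain U \<phi> where c: "(U, \<phi>) \<in> A" "p \<in> U" using ex_chart .
  obtain r \<rho> where r: "r > 0" "smooth_on UNIV \<rho>" "cball (\<phi> p) r \<subseteq> \<phi> ` (U \<inter> UNIV)"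
    "\<And>x. x \<in> cball (\<phi> p) (r / 2) \<Longrightarrow> \<rho> x = (1::real)" "\<And>x. x \<notin> ball (\<phi> p) r \<Longrightarrow> \<rho> x = 0"
    by (rule ex_chart_bump[OF c open_UNIV UNIV_I]) (rule that)
  let ?D = "\<lambda>f q. frechet_derivative (f \<circ> inv_into U \<phi>) (at (\<phi> q))"
  have inv: "inv_into U \<phi> (\<phi> q) = q" if "q \<in> U" for q using chart_inj[OF c(1)] that by simp
  define W where "W = {q \<in> U. \<phi> q \<in> ball (\<phi> p) (r / 2)}"
  have W: "open W" "p \<in> W" unfolding W_def using chart_vimage_open[OF c(1) open_ball, of "\<phi> p" "r / 2"] c r(1) by simp_all
  define x where "x b q = (if q \<in> U then \<rho> (\<phi> q) * (\<phi> q \<bullet> b) else 0)" for b q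
  define E where "E b q f = (if q \<in> U \<and> f \<in> F then \<rho> (\<phi> q) * ?D f q b else 0)" for b q f
  have ext: "(\<lambda>q. if q \<in> U then \<rho> (\<phi> q) * g (\<phi> q) else 0) \<in> F"
    if "smooth_on (\<phi> ` U) g" for g
  proof (rule smooth_chart_extension[OF c(1) compact_cball, of "\<phi> p" r])
    show "smooth_on (\<phi> ` U) (\<lambda>x. \<rho> x * g x)"
      using r(2) that chart_image_open[OF c(1)]
      by (auto simp: smooth_on_def intro!: Ck_on_mult intro: Ck_on_subset)
  qed (use r in auto)
  have x: "x b \<in> F" for b
    unfolding x_def
    by (rule ext) (auto simp: smooth_on_def intro!: Ck_on_bounded_linear chart_image_open[OF c(1)] bounded_linear_inner_left)
  have fD: "((f \<circ> inv_into U \<phi>) has_derivative ?D f q) (at (\<phi> q))" if "f \<in> F" "q \<in> U" for f q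
    by (rule Ck_on_SucD[OF smooth_fun_chart[OF that(1) c(1), of "Suc 0"]]) (use that in auto)
  have D_add: "?D (f + g) q b = ?D f q b + ?D g q b" if "f \<in> F" "g \<in> F" "q \<in> U" for f g q b
    using frechet_derivative_at[OF has_derivative_add[OF fD[OF that(1,3)] fD[OF that(2,3)]]]
    by (simp add: o_def plus_fun_def) metis
  have D_scale: "?D (\<lambda>q. a * f q) q b = a * ?D f q b" if "f \<in> F" "q \<in> U" for f q a b
    using frechet_derivative_at[OF has_derivative_mult_right[OF fD[OF that], of a]]
    by (simp add: o_def) metis
  have D_mult: "?D (f * g) q b = f q * ?D g q b + g q * ?D f q b" if "f \<in> F" "g \<in> F" "q \<in> U" for f g q b
  proof -
    have "((f * g \<circ> inv_into U \<phi>) has_derivative (\<lambda>h. f q * ?D g q h + ?D f q h * g q)) (at (\<phi> q))"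
      using has_derivative_mult[OF fD[OF that(1,3)] fD[OF that(2,3)]] inv[OF that(3)]
      by (simp add: o_def times_fun_def)
    from frechet_derivative_at[OF this, THEN fun_cong, of b] show ?thesis by (metis mult.commute)
  qed
  have ET: "E b q \<in> T q" for b q
    unfolding tangent_space_def mem_Collect_eq
  proof (intro conjI allI ballI impI)
    show "E b q f = 0" if "f \<notin> F" for f using that by (simp add: E_def)
    fix f assume f: "f \<in> F"
    have "(\<lambda>q. a * f q) \<in> F" for a using smooth_mult[OF smooth_const f, of a] by (simp add: times_fun_def)
    then show "E b q (\<lambda>q. a * f q) = a * E b q f" for a
      using f D_scale[OF f, of q a b] by (simp add: E_def)
    fix g assume g: "g \<in> F"
    show "E b q (\<lambda>q. f q + g q) = E b q f + E b q g"
      using f g D_add[OF f g, of q b] unfolding plus_fun_def[of f g, symmetric]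
      by (simp add: E_def algebra_simps)
    show "E b q (\<lambda>q. f q * g q) = f q * E b q g + g q * E b q f"
      using f g D_mult[OF f g, of q b] unfolding times_fun_def[of f g, symmetric]
      by (simp add: E_def algebra_simps)
  qed
  have "vderiv (E b) f \<in> F" if f: "f \<in> F" for f b
  proof -
    have "smooth_on (\<phi> ` U) (\<lambda>y. frechet_derivative (f \<circ> inv_into U \<phi>) (at y) b)"
      using smooth_fun_chart[OF f c(1), of "Suc _"] by (simp add: smooth_on_def)
    from ext[OF this] show ?thesis using f by (simp add: vderiv_def E_def)
  qed
  then have E: "E b \<in> V" for b using ET by (simp add: vfields_def)
  have Dx: "?D (x d) q b = b \<bullet> d" if "q \<in> W" for q b d
  proof -
    have q: "q \<in> U" "\<phi> q \<in> ball (\<phi> p) (r / 2)" using that by (auto simp: W_def)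
    have "((\<lambda>y. y \<bullet> d) has_derivative (\<lambda>v. v \<bullet> d)) (at (\<phi> q))"
      by (auto intro!: derivative_eq_intros)
    then have "((x d \<circ> inv_into U \<phi>) has_derivative (\<lambda>v. v \<bullet> d)) (at (\<phi> q))"
    proof (rule has_derivative_transform_within_open)
      show "open (ball (\<phi> p) (r / 2))" "\<phi> q \<in> ball (\<phi> p) (r / 2)" using q by auto
      fix y assume y: "y \<in> ball (\<phi> p) (r / 2)"
      then have "y \<in> \<phi> ` U" using r by auto
      then show "y \<bullet> d = (x d \<circ> inv_into U \<phi>) y" using y r(4)[of y] inv by (auto simp: x_def)
    qed
    then show ?thesis using frechet_derivative_at by metis
  qed
  show ?thesis
  proof (rule that[OF W E x])
    fix q :: 'q and b d :: 'e assume q: "q \<in> W" and b: "b \<in> Basis" "d \<in> (Basis :: 'e set)"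
    then have "\<rho> (\<phi> q) = 1" "q \<in> U" using r(4) by (auto simp: W_def)
    then show "E b q (x d) = (if b = d then 1 else 0)"
      using Dx[OF q, of d b] x b by (simp add: E_def inner_Basis)
  next
    fix q v f assume q: "q \<in> W" and v: "v \<in> T q"
    have \<rho>: "\<rho> (\<phi> q) = 1" "q \<in> U" using r(4) q by (auto simp: W_def)
    obtain w where w: "\<And>f. f \<in> F \<Longrightarrow> v f = (\<Sum>b\<in>Basis. w b * ?D f q b)"
      using tangent_chart_representation[OF c(1) \<rho>(2) v] by metis
    have "v (x d) = w d" if d: "d \<in> Basis" for d
    proof -
      have "v (x d) = (\<Sum>b\<in>Basis. if b = d then w b else 0)"
        unfolding w[OF x] by (rule sum.cong) (use Dx[OF q] d in \<open>auto simp: inner_Basis\<close>)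
      then show ?thesis using d by simp
    qed
    then show "v f = (\<Sum>b\<in>Basis. v (x b) * E b q f)"
      using w[of f] \<rho> tangent_nonsmooth[OF v, of f] by (cases "f \<in> F") (auto simp: E_def intro!: sum.cong)
  qed
qed

subsection \<open>The module of vector fields\<close>

lemma vfieldI: "(\<And>p. X p \<in> T p) \<Longrightarrow> (\<And>f. f \<in> F \<Longrightarrow> vderiv X f \<in> F) \<Longrightarrow> X \<in> V"
  by (auto simp: vfields_def)

lemma vfield_tangent: "X \<in> V \<Longrightarrow> X p \<in> T p"
  by (auto simp: vfields_def)

lemma vderiv_nonsmooth: "X \<in> V \<Longrightarrow> f \<notin> F \<Longrightarrow> vderiv X f = 0"
  by (rule ext) (simp add: vderiv_def tangent_nonsmooth[OF vfield_tangent])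

lemma vderiv_smooth [simp, intro]: "X \<in> V \<Longrightarrow> vderiv X f \<in> F"
  by (cases "f \<in> F") (simp_all add: vderiv_nonsmooth, simp add: vfields_def)

lemma vderiv_add_field: "vderiv (X + Y) f = vderiv X f + vderiv Y f"
  and vderiv_fscale: "vderiv (fscale h X) f = h * vderiv X f"
  and vderiv_0_field: "vderiv 0 f = 0"
  by (auto simp: vderiv_def fscale_def)

lemma
  assumes "X \<in> V"
  shows vderiv_add: "f \<in> F \<Longrightarrow> g \<in> F \<Longrightarrow> vderiv X (f + g) = vderiv X f + vderiv X g"
    and vderiv_mult: "f \<in> F \<Longrightarrow> g \<in> F \<Longrightarrow> vderiv X (f * g) = f * vderiv X g + g * vderiv X f"
    and vderiv_diff: "f \<in> F \<Longrightarrow> g \<in> F \<Longrightarrow> vderiv X (f - g) = vderiv X f - vderiv X g"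
    and vderiv_uminus: "f \<in> F \<Longrightarrow> vderiv X (- f) = - vderiv X f"
    and vderiv_const: "vderiv X (\<lambda>_. a) = 0"
    and vderiv_0: "vderiv X 0 = 0" and vderiv_1: "vderiv X 1 = 0"
  using tangent_add[OF vfield_tangent[OF assms]] tangent_mult[OF vfield_tangent[OF assms]]
    tangent_diff[OF vfield_tangent[OF assms]] tangent_uminus[OF vfield_tangent[OF assms]]
    tangent_const[OF vfield_tangent[OF assms]] tangent_0[OF vfield_tangent[OF assms]]
    tangent_1[OF vfield_tangent[OF assms]]
  by (simp_all add: vderiv_def fun_eq_iff)

lemma vfields_add [simp, intro]: "X \<in> V \<Longrightarrow> Y \<in> V \<Longrightarrow> X + Y \<in> V"
  by (rule vfieldI) (auto simp: vderiv_add_field intro: tangent_space_add vfield_tangent)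

lemma vfields_fscale [simp, intro]: "h \<in> F \<Longrightarrow> X \<in> V \<Longrightarrow> fscale h X \<in> V"
proof (rule vfieldI)
  show "fscale h X p \<in> T p" if "X \<in> V" for p
    unfolding fscale_def by (rule tangent_space_scale[OF vfield_tangent[OF that]])
qed (simp_all add: vderiv_fscale)

lemma vfields_0 [simp, intro]: "0 \<in> V"
  by (rule vfieldI) (auto simp: vderiv_0_field tangent_space_0)

lemma vfields_uminus [simp, intro]: "X \<in> V \<Longrightarrow> - X \<in> V"
  using vfields_fscale[of "\<lambda>_. -1" X] by (simp add: fscale_minus1)

lemma vfields_diff [simp, intro]: "X \<in> V \<Longrightarrow> Y \<in> V \<Longrightarrow> X - Y \<in> V"
  using vfields_add[of X "- Y"] by simp

lemma vfield_local:
  assumes "\<And>p. \<exists>Y\<in>V. \<exists>W. open W \<and> p \<in> W \<and> (\<forall>q\<in>W. X q = Y q)"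
  shows "X \<in> V"
proof (rule vfieldI)
  show "X p \<in> T p" for p using assms[of p] vfield_tangent by metis
  fix f assume "f \<in> F"
  show "vderiv X f \<in> F"
  proof (rule smooth_local)
    fix p
    obtain Y W where "Y \<in> V" "open W" "p \<in> W" "\<forall>q\<in>W. X q = Y q" using assms by metis
    then show "\<exists>g\<in>F. \<exists>W. open W \<and> p \<in> W \<and> (\<forall>q\<in>W. vderiv X f q = g q)"
      by (intro bexI[of _ "vderiv Y f"] exI[of _ W]) (simp_all, simp add: vderiv_def)
  qed
qed

subsection \<open>The Lie bracket\<close>

lemma lie_bracket_vderiv:
  "vderiv (lie_bracket X Y) f = vderiv X (vderiv Y f) - vderiv Y (vderiv X f)"
  by (auto simp: vderiv_def lie_bracket_def)

lemma lie_bracket_vfield [simp, intro]: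
  assumes X: "X \<in> V" and Y: "Y \<in> V" shows "lie_bracket X Y \<in> V"
proof (rule vfieldI)
  fix p
  have e: "lie_bracket X Y p f = X p (vderiv Y f) - Y p (vderiv X f)" for f
    by (simp add: lie_bracket_def)
  have n: "vderiv Z f = 0" if "Z \<in> V" "f \<notin> F" for Z f
    using that by (rule vderiv_nonsmooth)
  have s: "vderiv Z (\<lambda>q. a * f q) = (\<lambda>q. a * vderiv Z f q)" if "Z \<in> V" "f \<in> F" for Z a f
    unfolding vderiv_def using tangent_scale[OF vfield_tangent[OF that(1)] that(2)] by blast
  note XT = vfield_tangent[OF X, of p] and YT = vfield_tangent[OF Y, of p]
  have XY: "X p f = vderiv X f p" "Y p f = vderiv Y f p" for f by (simp_all add: vderiv_def)
  show "lie_bracket X Y p \<in> T p"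
    unfolding tangent_space_def mem_Collect_eq
  proof (intro conjI allI ballI impI)
    show "lie_bracket X Y p f = 0" if "f \<notin> F" for f
      using that X Y by (simp add: e n tangent_0[OF XT] tangent_0[OF YT])
    fix f assume f: "f \<in> F"
    show "lie_bracket X Y p (\<lambda>q. a * f q) = a * lie_bracket X Y p f" for a
      using f X Y by (simp add: e s tangent_scale[OF XT] tangent_scale[OF YT] algebra_simps)
    fix g assume g: "g \<in> F"
    show "lie_bracket X Y p (\<lambda>q. f q + g q) = lie_bracket X Y p f + lie_bracket X Y p g"
      using f g X Y unfolding plus_fun_def[of f g, symmetric]
      by (simp add: e vderiv_add tangent_add[OF XT] tangent_add[OF YT])
    show "lie_bracket X Y p (\<lambda>q. f q * g q) = f p * lie_bracket X Y p g + g p * lie_bracket X Y p f"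
      using f g X Y unfolding times_fun_def[of f g, symmetric]
      by (simp add: e vderiv_mult tangent_add[OF XT] tangent_add[OF YT] tangent_mult[OF XT] tangent_mult[OF YT])
         (simp add: XY algebra_simps)
  qed
next
  show "vderiv (lie_bracket X Y) f \<in> F" if "f \<in> F" for f
    using X Y by (simp add: lie_bracket_vderiv)
qed

lemma lie_bracket_commute: "lie_bracket Y X = - lie_bracket X Y"
  by (auto simp: lie_bracket_def fun_eq_iff)

lemma lie_bracket_self [simp]: "lie_bracket X X = 0"
  by (auto simp: lie_bracket_def fun_eq_iff)

lemma lie_bracket_add_right:
  assumes "X \<in> V" "Y \<in> V" "Z \<in> V"
  shows "lie_bracket X (Y + Z) = lie_bracket X Y + lie_bracket X Z"
proof -
  have "lie_bracket X (Y + Z) p f = (lie_bracket X Y + lie_bracket X Z) p f" for p f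
    using tangent_add[OF vfield_tangent[OF assms(1)], of "vderiv Y f" "vderiv Z f" p] assms
    by (simp add: lie_bracket_def vderiv_add_field)
  then show ?thesis by blast
qed

lemma lie_bracket_fscale_right:
  assumes "X \<in> V" "Y \<in> V" "h \<in> F"
  shows "lie_bracket X (fscale h Y) = fscale h (lie_bracket X Y) + fscale (vderiv X h) Y"
proof -
  have "lie_bracket X (fscale h Y) p f = (fscale h (lie_bracket X Y) + fscale (vderiv X h) Y) p f" for p f
    using tangent_mult[OF vfield_tangent[OF assms(1)], of h "vderiv Y f" p] assms
    by (simp add: lie_bracket_def vderiv_fscale fscale_pointwise algebra_simps) (simp add: vderiv_def)
  then show ?thesis by blast
qed

lemma lie_bracket_add_left:
  "X \<in> V \<Longrightarrow> Y \<in> V \<Longrightarrow> Z \<in> V \<Longrightarrow> lie_bracket (X + Y) Z = lie_bracket X Z + lie_bracket Y Z"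
  using lie_bracket_add_right[of Z X Y]
  by (simp add: lie_bracket_commute[of "X + Y" Z] lie_bracket_commute[of X Z] lie_bracket_commute[of Y Z])

lemma lie_bracket_fscale_left:
  "X \<in> V \<Longrightarrow> Y \<in> V \<Longrightarrow> h \<in> F \<Longrightarrow>
    lie_bracket (fscale h X) Y = fscale h (lie_bracket X Y) - fscale (vderiv Y h) X"
  using lie_bracket_fscale_right[of Y X h]
  by (simp add: lie_bracket_commute[of "fscale h X" Y] lie_bracket_commute[of X Y] fscale_uminus_right)

text \<open>Each double bracket is a sum of four words in the derivations \<open>X, Y, Z\<close>, and the twelve words cancel in pairs.\<close>

lemma lie_bracket_jacobi:
  assumes "X \<in> V" "Y \<in> V" "Z \<in> V"
  shows "lie_bracket (lie_bracket X Y) Z + lie_bracket (lie_bracket Y Z) X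
    + lie_bracket (lie_bracket Z X) Y = 0"
proof -
  have e: "lie_bracket (lie_bracket X Y) Z p f = vderiv X (vderiv Y (vderiv Z f)) p
      - vderiv Y (vderiv X (vderiv Z f)) p - vderiv Z (vderiv X (vderiv Y f)) p
      + vderiv Z (vderiv Y (vderiv X f)) p"
    if "X \<in> V" "Y \<in> V" "Z \<in> V" for X Y Z p f
  proof -
    have "lie_bracket (lie_bracket X Y) Z p f = vderiv (lie_bracket (lie_bracket X Y) Z) f p"
      by (simp add: vderiv_def)
    also have "\<dots> = vderiv X (vderiv Y (vderiv Z f)) p - vderiv Y (vderiv X (vderiv Z f)) p
        - vderiv Z (vderiv X (vderiv Y f)) p + vderiv Z (vderiv Y (vderiv X f)) p"
      using that by (simp add: lie_bracket_vderiv vderiv_diff)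
    finally show ?thesis .
  qed
  show ?thesis using assms by (simp add: fun_eq_iff e)
qed

subsection \<open>Linear functionals, gluing and local linear systems\<close>

definition flinear :: "'q vfield set \<Rightarrow> ('q vfield \<Rightarrow> 'q \<Rightarrow> real) \<Rightarrow> bool" where
  "flinear M \<alpha> \<longleftrightarrow> (\<forall>X\<in>M. \<forall>Y\<in>M. \<alpha> (X + Y) = \<alpha> X + \<alpha> Y) \<and>
     (\<forall>h\<in>F. \<forall>X\<in>M. \<alpha> (fscale h X) = h * \<alpha> X) \<and> (\<forall>X\<in>M. \<alpha> X \<in> F)"

lemma flinearI:
  assumes "\<And>X Y. X \<in> M \<Longrightarrow> Y \<in> M \<Longrightarrow> \<alpha> (X + Y) = \<alpha> X + \<alpha> Y"
    "\<And>h X. h \<in> F \<Longrightarrow> X \<in> M \<Longrightarrow> \<alpha> (fscale h X) = h * \<alpha> X" "\<And>X. X \<in> M \<Longrightarrow> \<alpha> X \<in> F"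
  shows "flinear M \<alpha>"
  using assms by (simp add: flinear_def)

lemma
  assumes "flinear M \<alpha>"
  shows flinear_add: "X \<in> M \<Longrightarrow> Y \<in> M \<Longrightarrow> \<alpha> (X + Y) = \<alpha> X + \<alpha> Y"
    and flinear_scale: "h \<in> F \<Longrightarrow> X \<in> M \<Longrightarrow> \<alpha> (fscale h X) = h * \<alpha> X"
    and flinear_smooth: "X \<in> M \<Longrightarrow> \<alpha> X \<in> F"
  using assms by (simp_all add: flinear_def)

lemma flinear_0: "flinear M \<alpha> \<Longrightarrow> 0 \<in> M \<Longrightarrow> \<alpha> 0 = 0"
  using flinear_scale[of M \<alpha> 0 0] by simp

definition submodule :: "'q vfield set \<Rightarrow> bool" where
  "submodule M \<longleftrightarrow> 0 \<in> M \<and> (\<forall>X\<in>M. \<forall>Y\<in>M. X + Y \<in> M) \<and> (\<forall>h\<in>F. \<forall>X\<in>M. fscale h X \<in> M)"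

lemma submodule_vfields: "submodule V"
  by (auto simp: submodule_def)

lemma flinear_combination:
  assumes M: "submodule M" "\<And>i. i \<in> I \<Longrightarrow> e i \<in> M" "\<And>i. i \<in> I \<Longrightarrow> h i \<in> F"
  shows "(\<Sum>i\<in>I. fscale (h i) (e i)) \<in> M"
    and "flinear M \<alpha> \<Longrightarrow> \<alpha> (\<Sum>i\<in>I. fscale (h i) (e i)) = (\<Sum>i\<in>I. h i * \<alpha> (e i))"
proof -
  have "(\<Sum>i\<in>I. fscale (h i) (e i)) \<in> M \<and>
    (flinear M \<alpha> \<longrightarrow> \<alpha> (\<Sum>i\<in>I. fscale (h i) (e i)) = (\<Sum>i\<in>I. h i * \<alpha> (e i)))"
    using M(2,3)
  proof (induction I rule: infinite_finite_induct)
    case (insert i I)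
    have s: "(\<Sum>i\<in>insert i I. fscale (h i) (e i)) = fscale (h i) (e i) + (\<Sum>i\<in>I. fscale (h i) (e i))"
      "(\<Sum>i\<in>insert i I. h i * \<alpha> (e i)) = h i * \<alpha> (e i) + (\<Sum>i\<in>I. h i * \<alpha> (e i))"
      by (rule sum.insert[OF insert.hyps])+
    let ?s = "\<Sum>i\<in>I. fscale (h i) (e i)"
    have IH: "?s \<in> M" "flinear M \<alpha> \<Longrightarrow> \<alpha> ?s = (\<Sum>i\<in>I. h i * \<alpha> (e i))"
      using insert.IH insert.prems by blast+
    have i: "h i \<in> F" "e i \<in> M" using insert.prems by blast+
    then have fe: "fscale (h i) (e i) \<in> M" using M(1) unfolding submodule_def by blast
    have "fscale (h i) (e i) + ?s \<in> M" using M(1) fe IH(1) unfolding submodule_def by blast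
    moreover have "\<alpha> (fscale (h i) (e i) + ?s) = h i * \<alpha> (e i) + (\<Sum>i\<in>I. h i * \<alpha> (e i))"
      if "flinear M \<alpha>"
      unfolding flinear_add[OF that fe IH(1)] flinear_scale[OF that i] IH(2)[OF that] ..
    ultimately show ?case unfolding s by blast
  qed (use M(1) in \<open>auto simp: submodule_def flinear_0\<close>)
  then show "(\<Sum>i\<in>I. fscale (h i) (e i)) \<in> M"
    and "flinear M \<alpha> \<Longrightarrow> \<alpha> (\<Sum>i\<in>I. fscale (h i) (e i)) = (\<Sum>i\<in>I. h i * \<alpha> (e i))" by auto
qed

text \<open>Multiplication by a bump function supported where the two fields agree makes them equal.\<close>

lemma flinear_local:
  assumes "flinear M \<alpha>" "X \<in> M" "Y \<in> M" "open W" "p \<in> W" "\<And>q. q \<in> W \<Longrightarrow> X q = Y q"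
  shows "\<alpha> X p = \<alpha> Y p"
proof -
  obtain \<rho> W' where \<rho>: "\<rho> \<in> F" "open W'" "p \<in> W'" "W' \<subseteq> W" "\<And>q. q \<in> W' \<Longrightarrow> \<rho> q = 1"
    "\<And>q. q \<notin> W \<Longrightarrow> \<rho> q = 0"
    by (rule ex_bump[OF assms(4,5)]) (rule that)
  have "fscale \<rho> X = fscale \<rho> Y"
    using assms(6) \<rho>(6) unfolding fscale_def by (metis mult_zero_left)
  then have "\<rho> * \<alpha> X = \<rho> * \<alpha> Y"
    using assms \<rho> by (metis flinear_scale)
  then have "(\<rho> * \<alpha> X) p = (\<rho> * \<alpha> Y) p" by simp
  then show ?thesis using \<rho> by simp
qed

text \<open>Local solutions of a problem with unique solutions fit together; the glued field agrees near every point
  with one of them, so that it inherits all local properties.\<close>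

lemma vfield_glue:
  assumes ex: "\<And>p. \<exists>X\<in>V. \<exists>W. open W \<and> p \<in> W \<and> P X W"
    and unique: "\<And>X X' W W' q. X \<in> V \<Longrightarrow> X' \<in> V \<Longrightarrow> open W \<Longrightarrow> open W' \<Longrightarrow> P X W \<Longrightarrow> P X' W' \<Longrightarrow>
      q \<in> W \<Longrightarrow> q \<in> W' \<Longrightarrow> X q = X' q"
  obtains R where "R \<in> V"
    "\<And>p. \<exists>X\<in>V. \<exists>W. open W \<and> p \<in> W \<and> P X W \<and> (\<forall>q\<in>W. R q = X q)"
proof -
  obtain X W where XW: "\<And>p. X p \<in> V \<and> open (W p) \<and> p \<in> W p \<and> P (X p) (W p)"
    using ex by metis
  define R where "R q = X q q" for q
  have R: "R q = X p q" if "q \<in> W p" for p q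
    unfolding R_def using XW that by (intro unique[of "X q" "X p" "W q" "W p"]) auto
  have "R \<in> V"
    by (rule vfield_local) (use XW R in blast)
  moreover have "\<exists>X\<in>V. \<exists>W. open W \<and> p \<in> W \<and> P X W \<and> (\<forall>q\<in>W. R q = X q)" for p
    using XW R by blast
  ultimately show ?thesis by (rule that)
qed

text \<open>Smooth solutions exist near \<open>p\<close> because Gaussian elimination can be carried out with smooth
  coefficients. The induction eliminates one index \<open>k\<close> at a time: \<open>b\<close> solves the smaller system with the
  \<open>k\<close>-th column as right-hand side, and the Schur complement \<open>d\<close> is positive at \<open>p\<close>, being the value of the
  quadratic form at the vector with entries \<open>-b\<close> and \<open>1\<close>. The neighbourhood does not depend on
  the right-hand side, because the induction step solves the smaller system with two of them.\<close>

lemma gram_system_local: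
  fixes G :: "'i \<Rightarrow> 'i \<Rightarrow> 'q \<Rightarrow> real"
  assumes "finite S" "\<And>i j. i \<in> S \<Longrightarrow> j \<in> S \<Longrightarrow> G i j \<in> F"
    "\<And>i j. i \<in> S \<Longrightarrow> j \<in> S \<Longrightarrow> G i j = G j i"
    "\<And>a. \<exists>i\<in>S. a i \<noteq> 0 \<Longrightarrow> (\<Sum>i\<in>S. \<Sum>j\<in>S. a i * a j * G i j p) > 0"
  shows "\<exists>W. open W \<and> p \<in> W \<and> (\<forall>\<beta>. (\<forall>i\<in>S. \<beta> i \<in> F) \<longrightarrow>
    (\<exists>a. (\<forall>i\<in>S. a i \<in> F) \<and> (\<forall>q\<in>W. \<forall>i\<in>S. (\<Sum>j\<in>S. a j q * G j i q) = \<beta> i q)))"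
  using assms
proof (induction S)
  case empty
  show ?case by (rule exI[of _ UNIV]) auto
next
  case (insert k S)
  have pos: "(\<Sum>i\<in>S. \<Sum>j\<in>S. a i * a j * G i j p) > 0" if "\<exists>i\<in>S. a i \<noteq> 0" for a
  proof -
    let ?a = "a(k := 0)"
    have *: "(\<Sum>j\<in>insert k S. ?a i * ?a j * G i j p) = (\<Sum>j\<in>S. ?a i * a j * G i j p)" for i
    proof -
      have "(\<Sum>j\<in>S. ?a i * ?a j * G i j p) = (\<Sum>j\<in>S. ?a i * a j * G i j p)"
        using insert.hyps(2) by (intro sum.cong) auto
      then show ?thesis unfolding sum.insert[OF insert.hyps] by simp
    qed
    have **: "(\<Sum>i\<in>S. \<Sum>j\<in>S. ?a i * a j * G i j p) = (\<Sum>i\<in>S. \<Sum>j\<in>S. a i * a j * G i j p)"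
      using insert.hyps(2) by (intro sum.cong) auto
    have "0 < (\<Sum>i\<in>insert k S. \<Sum>j\<in>insert k S. ?a i * ?a j * G i j p)"
      using that insert.hyps by (intro insert.prems(3)) auto
    also have "\<dots> = (\<Sum>i\<in>S. \<Sum>j\<in>S. a i * a j * G i j p)"
      unfolding * sum.insert[OF insert.hyps] ** by simp
    finally show ?thesis .
  qed
  then obtain W where W: "open W" "p \<in> W"
    "\<And>\<beta>. (\<And>i. i \<in> S \<Longrightarrow> \<beta> i \<in> F) \<Longrightarrow>
      \<exists>a. (\<forall>i\<in>S. a i \<in> F) \<and> (\<forall>q\<in>W. \<forall>i\<in>S. (\<Sum>j\<in>S. a j q * G j i q) = \<beta> i q)"
    using insert.IH insert.prems(1,2) by (smt (verit) insertCI)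
  have "\<exists>b. (\<forall>i\<in>S. b i \<in> F) \<and> (\<forall>q\<in>W. \<forall>i\<in>S. (\<Sum>j\<in>S. b j q * G j i q) = G k i q)"
    by (rule W(3)) (use insert.prems(1) in blast)
  then obtain b where "\<forall>i\<in>S. b i \<in> F" "\<forall>q\<in>W. \<forall>i\<in>S. (\<Sum>j\<in>S. b j q * G j i q) = G k i q"
    by (elim exE conjE) (rule that)
  note b = this[rule_format]
  define d where "d = G k k - (\<Sum>j\<in>S. b j * G j k)"
  have d: "d \<in> F" unfolding d_def using b insert.prems(1) by (auto intro!: smooth_sum)
  have "d p > 0"
  proof -
    \<comment> \<open>the rows \<open>i \<noteq> k\<close> of the quadratic form vanish at this vector by the choice of \<open>b\<close>\<close>
    let ?a = "\<lambda>i. if i = k then 1 else - b i p"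
    have row: "(\<Sum>j\<in>insert k S. ?a i * ?a j * G i j p) = ?a i * (G i k p - (\<Sum>j\<in>S. b j p * G j i p))"
      if "i \<in> insert k S" for i
    proof -
      have "(\<Sum>j\<in>S. ?a i * ?a j * G i j p) = (\<Sum>j\<in>S. ?a i * (- (b j p * G j i p)))"
        using insert.hyps(2) insert.prems(2)[of i] that by (intro sum.cong) auto
      then show ?thesis
        using insert.hyps by (simp add: sum_distrib_left sum_negf algebra_simps)
    qed
    have "0 < (\<Sum>i\<in>insert k S. \<Sum>j\<in>insert k S. ?a i * ?a j * G i j p)"
      by (intro insert.prems(3)) auto
    also have "\<dots> = (\<Sum>i\<in>insert k S. ?a i * (G i k p - (\<Sum>j\<in>S. b j p * G j i p)))"
      by (intro sum.cong row) auto
    also have "\<dots> = (G k k p - (\<Sum>j\<in>S. b j p * G j k p))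
        + (\<Sum>i\<in>S. ?a i * (G i k p - (\<Sum>j\<in>S. b j p * G j i p)))"
      using insert.hyps by simp
    also have "(\<Sum>i\<in>S. ?a i * (G i k p - (\<Sum>j\<in>S. b j p * G j i p))) = 0"
      using b(2)[OF W(2)] insert.prems(2)[of _ k] by (intro sum.neutral) auto
    finally show ?thesis by (simp add: d_def sum_pointwise)
  qed
  then obtain h W' where h: "h \<in> F" "open W'" "p \<in> W'" "\<And>q. q \<in> W' \<Longrightarrow> h q * d q = 1"
    using ex_local_reciprocal[OF d, of p] by (metis less_irrefl)
  show ?case
  proof (intro exI[of _ "W \<inter> W'"] conjI allI impI)
    show "open (W \<inter> W')" "p \<in> W \<inter> W'" using W h by auto
    fix \<beta> assume \<beta>: "\<forall>i\<in>insert k S. \<beta> i \<in> F"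
    have "\<exists>a. (\<forall>i\<in>S. a i \<in> F) \<and> (\<forall>q\<in>W. \<forall>i\<in>S. (\<Sum>j\<in>S. a j q * G j i q) = \<beta> i q)"
      by (rule W(3)) (use \<beta> in blast)
    then obtain a where "\<forall>i\<in>S. a i \<in> F" "\<forall>q\<in>W. \<forall>i\<in>S. (\<Sum>j\<in>S. a j q * G j i q) = \<beta> i q"
      by (elim exE conjE) (rule that)
    note a = this[rule_format]
    define t where "t = h * (\<beta> k - (\<Sum>j\<in>S. a j * G j k))"
    have t: "t \<in> F" unfolding t_def using a h \<beta> insert.prems(1) by (auto intro!: smooth_mult smooth_diff smooth_sum)
    define a' where "a' i = (if i = k then t else a i - t * b i)" for i
    have split: "(\<Sum>j\<in>insert k S. a' j q * G j i q)
        = t q * G k i q + ((\<Sum>j\<in>S. a j q * G j i q) - t q * (\<Sum>j\<in>S. b j q * G j i q))" for i q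
    proof -
      have "(\<Sum>j\<in>S. a' j q * G j i q) = (\<Sum>j\<in>S. a j q * G j i q - t q * (b j q * G j i q))"
        using insert.hyps(2) by (intro sum.cong) (auto simp: a'_def algebra_simps)
      then show ?thesis
        using insert.hyps by (simp add: a'_def sum_subtractf sum_distrib_left)
    qed
    show "\<exists>a. (\<forall>i\<in>insert k S. a i \<in> F) \<and>
      (\<forall>q\<in>W \<inter> W'. \<forall>i\<in>insert k S. (\<Sum>j\<in>insert k S. a j q * G j i q) = \<beta> i q)"
    proof (intro exI[of _ a'] conjI ballI)
      show "a' i \<in> F" if "i \<in> insert k S" for i
        using that a b t by (auto simp: a'_def)
      fix q i assume q: "q \<in> W \<inter> W'" and i: "i \<in> insert k S"
      show "(\<Sum>j\<in>insert k S. a' j q * G j i q) = \<beta> i q"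
      proof (cases "i = k")
        case True
        have "t q * d q = \<beta> k q - (\<Sum>j\<in>S. a j q * G j k q)"
          using h(4)[of q] q by (simp add: t_def sum_pointwise mult_ac)
        then show ?thesis
          unfolding split True by (simp add: d_def sum_pointwise algebra_simps)
      next
        case False
        then show ?thesis unfolding split using a(2)[of q i] b(2)[of q i] q i by simp
      qed
    qed
  qed
qed

end

section \<open>One-forms and their exterior derivative\<close>

locale one_form_manifold = smooth_manifold A
  for A :: "('q::{t2_space,second_countable_topology}, 'e::euclidean_space) chart set" +
  fixes lam :: "'q \<Rightarrow> 'q tvec \<Rightarrow> real"
  assumes one_form: "one_form A lam"
begin

abbreviation \<Lambda> :: "'q vfield \<Rightarrow> 'q \<Rightarrow> real" where "\<Lambda> \<equiv> form_app lam"
abbreviation \<omega> :: "'q vfield \<Rightarrow> 'q vfield \<Rightarrow> 'q \<Rightarrow> real" where "\<omega> \<equiv> ext_deriv lam"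
abbreviation \<Xi> :: "'q vfield set" where "\<Xi> \<equiv> contact_sections A lam"

lemma form_smooth [simp, intro]: "X \<in> V \<Longrightarrow> \<Lambda> X \<in> F"
  using one_form by (auto simp: one_form_def form_app_def)

lemma form_add: "X \<in> V \<Longrightarrow> Y \<in> V \<Longrightarrow> \<Lambda> (X + Y) = \<Lambda> X + \<Lambda> Y"
  using one_form by (auto simp: one_form_def form_app_def fun_eq_iff vfield_tangent)

lemma form_fscale: "X \<in> V \<Longrightarrow> \<Lambda> (fscale h X) = h * \<Lambda> X"
  using one_form by (auto simp: one_form_def form_app_def fscale_def fun_eq_iff vfield_tangent)

lemma form_0 [simp]: "\<Lambda> 0 = 0"
  using form_fscale[of 0 0] by simp

lemma form_uminus: "X \<in> V \<Longrightarrow> \<Lambda> (- X) = - \<Lambda> X"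
  using form_fscale[of X "\<lambda>_. -1"] by (simp add: fscale_minus1 times_fun_def fun_Compl_def)

lemma form_diff: "X \<in> V \<Longrightarrow> Y \<in> V \<Longrightarrow> \<Lambda> (X - Y) = \<Lambda> X - \<Lambda> Y"
  using form_add[of X "- Y"] by (simp add: form_uminus)

lemma form_flinear: "flinear V \<Lambda>"
  by (rule flinearI) (auto simp: form_add form_fscale)

lemma form_pointwise: "X p = Y p \<Longrightarrow> \<Lambda> X p = \<Lambda> Y p"
  by (simp add: form_app_def)

lemma ext_deriv_eq: "\<omega> X Y = vderiv X (\<Lambda> Y) - vderiv Y (\<Lambda> X) - \<Lambda> (lie_bracket X Y)"
  by (simp add: ext_deriv_def fun_eq_iff)

lemma ext_deriv_smooth [simp, intro]: "X \<in> V \<Longrightarrow> Y \<in> V \<Longrightarrow> \<omega> X Y \<in> F"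
  unfolding ext_deriv_eq by (intro smooth_diff vderiv_smooth form_smooth lie_bracket_vfield)

lemma ext_deriv_commute: "X \<in> V \<Longrightarrow> Y \<in> V \<Longrightarrow> \<omega> Y X = - \<omega> X Y"
  unfolding ext_deriv_eq lie_bracket_commute[of Y X] by (simp add: form_uminus)

lemma ext_deriv_add_left:
  "X \<in> V \<Longrightarrow> Y \<in> V \<Longrightarrow> Z \<in> V \<Longrightarrow> \<omega> (X + Y) Z = \<omega> X Z + \<omega> Y Z"
  unfolding ext_deriv_eq by (simp add: lie_bracket_add_left form_add vderiv_add vderiv_add_field)

lemma ext_deriv_fscale_left:
  assumes "X \<in> V" "Z \<in> V" "h \<in> F" shows "\<omega> (fscale h X) Z = h * \<omega> X Z"
proof -
  have "\<Lambda> (lie_bracket (fscale h X) Z) = h * \<Lambda> (lie_bracket X Z) - vderiv Z h * \<Lambda> X"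
    using assms by (simp add: lie_bracket_fscale_left form_diff form_fscale)
  then show ?thesis
    unfolding ext_deriv_eq using assms
    by (simp add: form_fscale vderiv_mult vderiv_fscale algebra_simps)
qed

lemma ext_deriv_flinear_left: "Z \<in> V \<Longrightarrow> flinear V (\<lambda>X. \<omega> X Z)"
  by (rule flinearI) (auto simp: ext_deriv_add_left ext_deriv_fscale_left)

lemma ext_deriv_add_right:
  "X \<in> V \<Longrightarrow> Y \<in> V \<Longrightarrow> Z \<in> V \<Longrightarrow> \<omega> Z (X + Y) = \<omega> Z X + \<omega> Z Y"
  by (simp add: ext_deriv_commute[of _ Z] ext_deriv_add_left)

lemma ext_deriv_fscale_right:
  "X \<in> V \<Longrightarrow> Z \<in> V \<Longrightarrow> h \<in> F \<Longrightarrow> \<omega> Z (fscale h X) = h * \<omega> Z X"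
  by (simp add: ext_deriv_commute[of _ Z] ext_deriv_fscale_left)

lemma ext_deriv_0_left: "Z \<in> V \<Longrightarrow> \<omega> 0 Z = 0"
  using flinear_0[OF ext_deriv_flinear_left] by simp

lemma ext_deriv_uminus_left: "X \<in> V \<Longrightarrow> Z \<in> V \<Longrightarrow> \<omega> (- X) Z = - \<omega> X Z"
  using ext_deriv_add_left[of X "- X" Z] ext_deriv_0_left[of Z] by (simp add: eq_neg_iff_add_eq_0 add.commute)

lemma ext_deriv_uminus_right: "X \<in> V \<Longrightarrow> Z \<in> V \<Longrightarrow> \<omega> Z (- X) = - \<omega> Z X"
  by (simp add: ext_deriv_commute[of _ Z] ext_deriv_uminus_left)

lemma ext_deriv_diff_left:
  "X \<in> V \<Longrightarrow> Y \<in> V \<Longrightarrow> Z \<in> V \<Longrightarrow> \<omega> (X - Y) Z = \<omega> X Z - \<omega> Y Z"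
  using ext_deriv_add_left[of X "- Y" Z] by (simp add: ext_deriv_uminus_left)

lemma ext_deriv_self: assumes "X \<in> V" shows "\<omega> X X = 0"
  unfolding ext_deriv_eq by simp

text \<open>The identity \<open>d(d\<lambda>) = 0\<close>. The terms that differentiate values of \<open>\<lambda>\<close> cancel, and what remains is the Jacobi
  identity.\<close>

lemma ext_deriv_closed:
  assumes "X \<in> V" "Y \<in> V" "Z \<in> V"
  shows "vderiv X (\<omega> Y Z) + vderiv Y (\<omega> Z X) + vderiv Z (\<omega> X Y)
    - \<omega> (lie_bracket X Y) Z - \<omega> (lie_bracket Y Z) X - \<omega> (lie_bracket Z X) Y = 0"
proof -
  have "\<Lambda> (lie_bracket (lie_bracket X Y) Z) + \<Lambda> (lie_bracket (lie_bracket Y Z) X)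
    + \<Lambda> (lie_bracket (lie_bracket Z X) Y) = 0"
    using arg_cong[OF lie_bracket_jacobi[OF assms], of \<Lambda>] assms by (simp add: form_add)
  then show ?thesis
    unfolding ext_deriv_eq using assms
    by (simp add: vderiv_diff vderiv_add lie_bracket_vderiv algebra_simps)
qed

lemma contact_sections_iff: "Y \<in> \<Xi> \<longleftrightarrow> Y \<in> V \<and> \<Lambda> Y = 0"
  by (auto simp: contact_sections_def contact_space_def form_app_def fun_eq_iff vfield_tangent)

lemma contact_vfield: "Y \<in> \<Xi> \<Longrightarrow> Y \<in> V" and contact_form_0: "Y \<in> \<Xi> \<Longrightarrow> \<Lambda> Y = 0"
  by (simp_all add: contact_sections_iff)

lemma contact_add: "X \<in> \<Xi> \<Longrightarrow> Y \<in> \<Xi> \<Longrightarrow> X + Y \<in> \<Xi>"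
  and contact_fscale: "h \<in> F \<Longrightarrow> X \<in> \<Xi> \<Longrightarrow> fscale h X \<in> \<Xi>"
  and contact_uminus: "X \<in> \<Xi> \<Longrightarrow> - X \<in> \<Xi>"
  and contact_diff: "X \<in> \<Xi> \<Longrightarrow> Y \<in> \<Xi> \<Longrightarrow> X - Y \<in> \<Xi>"
  and contact_zero: "0 \<in> \<Xi>"
  by (simp_all add: contact_sections_iff form_add form_fscale form_uminus form_diff)

lemmas contact_intros = contact_add contact_fscale contact_uminus contact_diff contact_zero

lemma submodule_contact: "submodule \<Xi>"
  by (simp add: submodule_def contact_intros)

end

section \<open>Contact triads, duality and the Reeb field\<close>

locale contact_triad_manifold = smooth_manifold A
  for A :: "('q::{t2_space,second_countable_topology}, 'e::euclidean_space) chart set" +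
  fixes n :: nat and lam :: "'q \<Rightarrow> 'q tvec \<Rightarrow> real" and J :: "'q \<Rightarrow> 'q tvec \<Rightarrow> 'q tvec"
  assumes triad: "contact_triad n A lam J"
begin

sublocale one_form_manifold A lam
  by unfold_locales (use triad in \<open>simp add: contact_triad_def contact_form_def\<close>)

abbreviation \<J> :: "'q vfield \<Rightarrow> 'q vfield" where "\<J> \<equiv> endo_app J"

lemma acs: "contact_almost_complex A lam J"
  using triad by (simp add: contact_triad_def)

lemma contact_space_section: "Y \<in> \<Xi> \<Longrightarrow> Y p \<in> contact_space A lam p"
  by (simp add: contact_sections_def)

lemma J_contact: assumes "Y \<in> \<Xi>" shows "\<J> Y \<in> \<Xi>"
  using acs assms by (auto simp: contact_almost_complex_def contact_sections_def endo_app_def)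

lemma J_add: "X \<in> \<Xi> \<Longrightarrow> Y \<in> \<Xi> \<Longrightarrow> \<J> (X + Y) = \<J> X + \<J> Y"
  using acs contact_space_section unfolding contact_almost_complex_def endo_app_def
  by (simp add: fun_eq_iff)

lemma J_fscale: "X \<in> \<Xi> \<Longrightarrow> \<J> (fscale h X) = fscale h (\<J> X)"
  using acs contact_space_section unfolding contact_almost_complex_def endo_app_def fscale_def
  by (simp add: fun_eq_iff)

lemma J_J: "X \<in> \<Xi> \<Longrightarrow> \<J> (\<J> X) = - X"
  using acs contact_space_section unfolding contact_almost_complex_def endo_app_def
  by (simp add: fun_eq_iff)

lemma J_uminus: "X \<in> \<Xi> \<Longrightarrow> \<J> (- X) = - \<J> X"
  using J_fscale[of X "\<lambda>_. -1"] by (simp add: fscale_minus1)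

lemma J_diff: "X \<in> \<Xi> \<Longrightarrow> Y \<in> \<Xi> \<Longrightarrow> \<J> (X - Y) = \<J> X - \<J> Y"
  using J_add[of X "- Y"] by (simp add: J_uminus contact_intros)

lemma ext_deriv_J_J: "Y \<in> \<Xi> \<Longrightarrow> Z \<in> \<Xi> \<Longrightarrow> \<omega> (\<J> Y) (\<J> Z) = \<omega> Y Z"
  using triad by (simp add: contact_triad_def)

text \<open>On contact sections this is the triad metric. The first argument may be any vector field and only its
  contact part matters, which spares the projections of Lie brackets.\<close>

definition g :: "'q vfield \<Rightarrow> 'q vfield \<Rightarrow> 'q \<Rightarrow> real" where "g X Z = \<omega> X (\<J> Z)"

lemma g_smooth: "X \<in> V \<Longrightarrow> Z \<in> \<Xi> \<Longrightarrow> g X Z \<in> F"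
  by (simp add: g_def contact_vfield J_contact)

lemma g_add_left: "X \<in> V \<Longrightarrow> Y \<in> V \<Longrightarrow> Z \<in> \<Xi> \<Longrightarrow> g (X + Y) Z = g X Z + g Y Z"
  and g_fscale_left: "h \<in> F \<Longrightarrow> X \<in> V \<Longrightarrow> Z \<in> \<Xi> \<Longrightarrow> g (fscale h X) Z = h * g X Z"
  and g_uminus_left: "X \<in> V \<Longrightarrow> Z \<in> \<Xi> \<Longrightarrow> g (- X) Z = - g X Z"
  and g_diff_left: "X \<in> V \<Longrightarrow> Y \<in> V \<Longrightarrow> Z \<in> \<Xi> \<Longrightarrow> g (X - Y) Z = g X Z - g Y Z"
  by (simp_all add: g_def contact_vfield J_contact ext_deriv_add_left ext_deriv_fscale_left
      ext_deriv_uminus_left ext_deriv_diff_left)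

lemma g_sym:
  assumes "Y \<in> \<Xi>" "Z \<in> \<Xi>" shows "g Y Z = g Z Y"
proof -
  have "\<omega> Z (\<J> Y) = \<omega> (\<J> Z) (- Y)"
    using ext_deriv_J_J[of Z "\<J> Y"] assms by (simp add: J_contact J_J)
  also have "\<dots> = \<omega> Y (\<J> Z)"
    using assms by (simp add: ext_deriv_uminus_right ext_deriv_commute[of Y "\<J> Z"] contact_vfield J_contact)
  finally show ?thesis by (simp add: g_def)
qed

lemma g_add_right: "X \<in> V \<Longrightarrow> Y \<in> \<Xi> \<Longrightarrow> Z \<in> \<Xi> \<Longrightarrow> g X (Y + Z) = g X Y + g X Z"
  and g_fscale_right: "h \<in> F \<Longrightarrow> X \<in> V \<Longrightarrow> Z \<in> \<Xi> \<Longrightarrow> g X (fscale h Z) = h * g X Z"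
  and g_uminus_right: "X \<in> V \<Longrightarrow> Z \<in> \<Xi> \<Longrightarrow> g X (- Z) = - g X Z"
  by (simp_all add: g_def contact_vfield J_contact J_add J_fscale J_uminus ext_deriv_add_right
      ext_deriv_fscale_right ext_deriv_uminus_right)

lemma g_J_J: "Y \<in> \<Xi> \<Longrightarrow> Z \<in> \<Xi> \<Longrightarrow> g (\<J> Y) (\<J> Z) = g Y Z"
  by (simp add: g_def ext_deriv_J_J J_contact)

lemma g_J_left: "Y \<in> \<Xi> \<Longrightarrow> Z \<in> \<Xi> \<Longrightarrow> g (\<J> Y) Z = - g Y (\<J> Z)"
  using g_J_J[of Y "\<J> Z"] by (simp add: J_J J_contact g_uminus_right contact_vfield eq_neg_iff_add_eq_0 minus_equation_iff)

lemma ext_deriv_via_g: "X \<in> V \<Longrightarrow> Z \<in> \<Xi> \<Longrightarrow> \<omega> X Z = - g X (\<J> Z)"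
  by (simp add: g_def J_J ext_deriv_uminus_right contact_vfield)

lemma g_pos: "Y \<in> \<Xi> \<Longrightarrow> Y p \<noteq> 0 \<Longrightarrow> g Y Y p > 0"
  using triad by (auto simp: contact_triad_def g_def)

lemma g_nondegenerate:
  assumes "Y \<in> \<Xi>" "g Y Y p = 0" shows "Y p = 0"
  using g_pos[of Y p] assms by fastforce

lemma g_eqI:
  assumes "X \<in> \<Xi>" "Y \<in> \<Xi>" "\<And>Z. Z \<in> \<Xi> \<Longrightarrow> g X Z = g Y Z" shows "X = Y"
proof -
  let ?D = "X - Y"
  have "?D \<in> \<Xi>" using assms contact_diff by blast
  moreover have "g ?D ?D = 0" using assms by (simp add: g_diff_left contact_vfield contact_intros)
  ultimately have "?D p = 0" for p using g_nondegenerate[of ?D p] by simp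
  then have "?D = 0" by (simp add: fun_eq_iff)
  then show ?thesis by simp
qed

lemma g_flinear_left: "Z \<in> \<Xi> \<Longrightarrow> flinear V (\<lambda>X. g X Z)"
  by (rule flinearI) (simp_all add: g_add_left g_fscale_left g_smooth)

lemma g_flinear_right: "X \<in> V \<Longrightarrow> flinear \<Xi> (\<lambda>Z. g X Z)"
  by (rule flinearI) (simp_all add: g_add_right g_fscale_right g_smooth)

text \<open>Every summand of \<open>\<lambda> \<and> (d\<lambda>)\<^sup>n\<close> contains a value of \<open>\<lambda>\<close>.\<close>

lemma ex_form_nonzero: obtains X where "X \<in> V" "\<Lambda> X p \<noteq> 0"
proof -
  have "contact_form n A lam" using triad by (simp add: contact_triad_def)
  then have "\<exists>X. (\<forall>i. X i \<in> V) \<and> wedge 1 (2 * n) (\<lambda>X. \<Lambda> (X 0))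
      (wedge_power2 (\<lambda>X. \<omega> (X 0) (X 1)) n) X p \<noteq> 0"
    unfolding contact_form_def by (elim conjE) (erule spec)
  then obtain X where X: "\<forall>i. X i \<in> V" "wedge 1 (2 * n) (\<lambda>X. \<Lambda> (X 0))
      (wedge_power2 (\<lambda>X. \<omega> (X 0) (X 1)) n) X p \<noteq> 0"
    by (elim exE conjE) (rule that)
  have "\<exists>i. \<Lambda> (X i) p \<noteq> 0"
  proof (rule ccontr)
    assume "\<not> ?thesis"
    then show False using X(2) by (simp add: wedge_def)
  qed
  then show ?thesis using X(1) that by blast
qed

text \<open>Choose \<open>k\<close> such that \<open>\<lambda>(E\<^sub>k)\<close> does not vanish at \<open>p\<close>. The fields \<open>e\<^sub>i = \<lambda>(E\<^sub>k) E\<^sub>i - \<lambda>(E\<^sub>i) E\<^sub>k\<close> with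
  \<open>i \<noteq> k\<close> are global contact sections that form a frame of the contact distribution near \<open>p\<close>, and the problem
  becomes a linear system with their Gram matrix.\<close>

lemma riesz_local:
  assumes \<alpha>: "flinear \<Xi> \<alpha>"
  shows "\<exists>Y\<in>\<Xi>. \<exists>W. open W \<and> p \<in> W \<and> (\<forall>Z\<in>\<Xi>. \<forall>q\<in>W. g Y Z q = \<alpha> Z q)"
proof -
  obtain W0 :: "'q set" and E :: "'e \<Rightarrow> 'q vfield" and x :: "'e \<Rightarrow> 'q \<Rightarrow> real"
    where W0: "open W0" "p \<in> W0" and E: "\<And>b. E b \<in> V" and x: "\<And>b. x b \<in> F"
    and dual: "\<And>q b c. q \<in> W0 \<Longrightarrow> b \<in> Basis \<Longrightarrow> c \<in> Basis \<Longrightarrow> E b q (x c) = (if b = c then 1 else 0)"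
    and span: "\<And>q v f. q \<in> W0 \<Longrightarrow> v \<in> T q \<Longrightarrow> v f = (\<Sum>b\<in>Basis. v (x b) * E b q f)"
    by (rule ex_local_frame[of p]) (rule that)
  have expand: "X q = (\<Sum>b\<in>Basis. fscale (vderiv X (x b)) (E b)) q" if "X \<in> V" "q \<in> W0" for X q
  proof
    fix f
    have "X q f = (\<Sum>b\<in>Basis. X q (x b) * E b q f)"
      by (rule span[OF that(2) vfield_tangent[OF that(1)]])
    then show "X q f = (\<Sum>b\<in>Basis. fscale (vderiv X (x b)) (E b)) q f"
      by (simp add: sum_pointwise fscale_pointwise vderiv_def)
  qed
  have form_expand: "\<Lambda> X q = (\<Sum>b\<in>Basis. vderiv X (x b) q * \<Lambda> (E b) q)" if "X \<in> V" "q \<in> W0" for X q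
  proof -
    have "\<Lambda> (\<Sum>b\<in>Basis. fscale (vderiv X (x b)) (E b)) = (\<Sum>b\<in>Basis. vderiv X (x b) * \<Lambda> (E b))"
      using E that by (intro flinear_combination(2)[OF submodule_vfields _ _ form_flinear]) auto
    then show ?thesis
      using form_pointwise[of X q "\<Sum>b\<in>Basis. fscale (vderiv X (x b)) (E b)", OF expand[OF that]]
      by (simp add: sum_pointwise)
  qed
  obtain k where k: "k \<in> Basis" "\<Lambda> (E k) p \<noteq> 0"
  proof -
    obtain X where "X \<in> V" "\<Lambda> X p \<noteq> 0" by (rule ex_form_nonzero)
    then have "(\<Sum>b\<in>Basis. vderiv X (x b) p * \<Lambda> (E b) p) \<noteq> 0" using form_expand W0 by simp
    then obtain b where "b \<in> Basis" "vderiv X (x b) p * \<Lambda> (E b) p \<noteq> 0" by (rule sum.not_neutral_contains_not_neutral)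
    then show ?thesis by (intro that[of b]) auto
  qed
  define e where "e i = fscale (\<Lambda> (E k)) (E i) - fscale (\<Lambda> (E i)) (E k)" for i
  have e: "e i \<in> \<Xi>" for i
    using E by (simp add: e_def contact_sections_iff form_diff form_fscale)
  let ?S = "Basis - {k}"
  define G where "G i j = g (e i) (e j)" for i j
  have "\<exists>W. open W \<and> p \<in> W \<and> (\<forall>\<beta>. (\<forall>i\<in>?S. \<beta> i \<in> F) \<longrightarrow>
    (\<exists>a. (\<forall>i\<in>?S. a i \<in> F) \<and> (\<forall>q\<in>W. \<forall>i\<in>?S. (\<Sum>j\<in>?S. a j q * G j i q) = \<beta> i q)))"
  proof (rule gram_system_local)
    show "G i j \<in> F" for i j unfolding G_def using e contact_vfield g_smooth by blast
    show "G i j = G j i" for i j unfolding G_def using e g_sym by blast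
    fix a :: "'e \<Rightarrow> real" assume "\<exists>i\<in>?S. a i \<noteq> 0"
    then obtain l where l: "l \<in> Basis" "l \<noteq> k" "a l \<noteq> 0" by auto
    define u where "u = (\<Sum>i\<in>?S. fscale (\<lambda>_. a i) (e i))"
    have u: "u \<in> \<Xi>" unfolding u_def using e by (intro flinear_combination(1)[OF submodule_contact]) auto
    have guZ: "g u Z = (\<Sum>i\<in>?S. (\<lambda>_. a i) * g (e i) Z)" if "Z \<in> \<Xi>" for Z
      unfolding u_def using e contact_vfield
      by (intro flinear_combination(2)[OF submodule_vfields _ _ g_flinear_left[OF that]]) auto
    have geu: "g X u = (\<Sum>i\<in>?S. (\<lambda>_. a i) * g X (e i))" if "X \<in> V" for X
      unfolding u_def using e
      by (intro flinear_combination(2)[OF submodule_contact _ _ g_flinear_right[OF that]]) auto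
    have "u p (x l) = (\<Sum>i\<in>?S. a i * (if i = l then \<Lambda> (E k) p else 0))"
      unfolding u_def sum_pointwise
      using l k W0 dual[OF W0(2)] by (intro sum.cong) (auto simp: fscale_pointwise e_def)
    also have "\<dots> = a l * \<Lambda> (E k) p" using l by (simp add: if_distrib sum.delta cong: if_cong)
    finally have "u p (x l) \<noteq> 0" using l k by simp
    then have "u p \<noteq> 0" by auto
    then have "0 < g u u p" using g_pos u by blast
    also have "g u u p = (\<Sum>i\<in>?S. \<Sum>j\<in>?S. a i * a j * G i j p)"
      unfolding guZ[OF u] geu[OF contact_vfield[OF e]]
      by (simp add: sum_pointwise G_def sum_distrib_left mult_ac)
    finally show "0 < (\<Sum>i\<in>?S. \<Sum>j\<in>?S. a i * a j * G i j p)" .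
  qed simp
  then obtain W where W: "open W" "p \<in> W" and solve: "\<And>\<beta>. (\<forall>i\<in>?S. \<beta> i \<in> F) \<Longrightarrow>
    (\<exists>a. (\<forall>i\<in>?S. a i \<in> F) \<and> (\<forall>q\<in>W. \<forall>i\<in>?S. (\<Sum>j\<in>?S. a j q * G j i q) = \<beta> i q))"
    by (elim exE conjE) (rule that, assumption, assumption, blast)
  have "\<forall>i\<in>?S. \<alpha> (e i) \<in> F" using flinear_smooth[OF \<alpha>] e by blast
  from solve[OF this] obtain a where a: "\<forall>i\<in>?S. a i \<in> F"
    "\<forall>q\<in>W. \<forall>i\<in>?S. (\<Sum>j\<in>?S. a j q * G j i q) = \<alpha> (e i) q"
    by (elim exE conjE) (rule that)
  define Y where "Y = (\<Sum>j\<in>?S. fscale (a j) (e j))"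
  have Y: "Y \<in> \<Xi>" unfolding Y_def using e a(1) by (intro flinear_combination(1)[OF submodule_contact]) auto
  have gYe: "g Y (e i) q = \<alpha> (e i) q" if "i \<in> ?S" "q \<in> W" for i q
  proof -
    have "g Y (e i) = (\<Sum>j\<in>?S. a j * g (e j) (e i))"
      unfolding Y_def using e contact_vfield a(1)
      by (intro flinear_combination(2)[OF submodule_vfields _ _ g_flinear_left]) auto
    then show ?thesis using a(2) that by (simp add: sum_pointwise G_def)
  qed
  let ?W = "(W \<inter> W0) \<inter> {q. \<Lambda> (E k) q \<noteq> 0}"
  have W': "open ?W" "p \<in> ?W" using W W0 k smooth_nonzero_open[OF form_smooth[OF E]] by auto
  have "g Y Z q = \<alpha> Z q" if Z: "Z \<in> \<Xi>" and q: "q \<in> ?W" for Z q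
  proof -
    define Z' where "Z' = (\<Sum>i\<in>?S. fscale (vderiv Z (x i)) (e i))"
    have ZV: "Z \<in> V" using Z contact_vfield by blast
    have Z': "Z' \<in> \<Xi>" unfolding Z'_def using e ZV by (intro flinear_combination(1)[OF submodule_contact]) auto
    have kZ: "fscale (\<Lambda> (E k)) Z \<in> \<Xi>" using Z E contact_fscale by blast
    have agree: "fscale (\<Lambda> (E k)) Z r = Z' r" if r: "r \<in> W0" for r
    proof
      fix f
      have ek: "e k = 0" by (simp add: e_def)
      have "Z' r f = (\<Sum>i\<in>?S. vderiv Z (x i) r * e i r f)"
        by (simp add: Z'_def sum_pointwise fscale_pointwise)
      also have "\<dots> = (\<Sum>i\<in>Basis. vderiv Z (x i) r * e i r f)"
        using k ek by (intro sum.mono_neutral_left) auto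
      also have "\<dots> = \<Lambda> (E k) r * (\<Sum>i\<in>Basis. vderiv Z (x i) r * E i r f)
          - (\<Sum>i\<in>Basis. vderiv Z (x i) r * \<Lambda> (E i) r) * E k r f"
        by (simp add: e_def fscale_pointwise sum_subtractf sum_distrib_left sum_distrib_right algebra_simps)
      also have "(\<Sum>i\<in>Basis. vderiv Z (x i) r * \<Lambda> (E i) r) = 0"
        using form_expand[OF ZV r] contact_form_0[OF Z] by simp
      also have "(\<Sum>i\<in>Basis. vderiv Z (x i) r * E i r f) = Z r f"
        unfolding vderiv_def by (rule span[OF r vfield_tangent[OF ZV], symmetric])
      finally show "fscale (\<Lambda> (E k)) Z r f = Z' r f" by (simp add: fscale_pointwise)
    qed
    have comb: "\<beta> Z' = (\<Sum>i\<in>?S. vderiv Z (x i) * \<beta> (e i))" if "flinear \<Xi> \<beta>" for \<beta>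
      unfolding Z'_def using e ZV by (intro flinear_combination(2)[OF submodule_contact _ _ that]) auto
    have loc: "\<Lambda> (E k) q * \<beta> Z q = \<beta> Z' q" if "flinear \<Xi> \<beta>" for \<beta>
      using flinear_local[OF that kZ Z' W0(1) _ agree, of q] q flinear_scale[OF that _ Z, of "\<Lambda> (E k)"] E by auto
    have "\<Lambda> (E k) q * g Y Z q = g Y Z' q"
      using loc[OF g_flinear_right[OF contact_vfield[OF Y]]] by simp
    also have "\<dots> = \<alpha> Z' q"
      unfolding comb[OF g_flinear_right[OF contact_vfield[OF Y]]] comb[OF \<alpha>]
      using gYe q by (simp add: sum_pointwise)
    also have "\<dots> = \<Lambda> (E k) q * \<alpha> Z q" using loc[OF \<alpha>] by simp
    finally show ?thesis using q by simp
  qed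
  then show ?thesis using Y W' by blast
qed

text \<open>Local solutions agree on overlaps, since \<open>g\<close> is positive definite.\<close>

lemma riesz:
  assumes \<alpha>: "flinear \<Xi> \<alpha>"
  obtains Y where "Y \<in> \<Xi>" "\<And>Z. Z \<in> \<Xi> \<Longrightarrow> g Y Z = \<alpha> Z"
proof -
  let ?P = "\<lambda>Y W. Y \<in> \<Xi> \<and> (\<forall>Z\<in>\<Xi>. \<forall>q\<in>W. g Y Z q = \<alpha> Z q)"
  obtain R where R: "R \<in> V" "\<And>p. \<exists>X\<in>V. \<exists>W. open W \<and> p \<in> W \<and> ?P X W \<and> (\<forall>q\<in>W. R q = X q)"
  proof (rule vfield_glue[of ?P])
    show "\<exists>X\<in>V. \<exists>W. open W \<and> p \<in> W \<and> ?P X W" for p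
      using riesz_local[OF \<alpha>, of p] contact_vfield by blast
    fix X X' W W' q assume *: "?P X W" "?P X' W'" "q \<in> W" "q \<in> W'"
    have D: "X - X' \<in> \<Xi>" using * contact_diff by blast
    then have "g (X - X') (X - X') q = 0" using * by (simp add: g_diff_left contact_vfield)
    then show "X q = X' q" using g_nondegenerate[OF D] by simp
  qed (rule that)
  have "\<Lambda> R q = 0" for q
    using R(2)[of q] contact_form_0 form_pointwise[of R q] by (metis zero_fun_apply)
  then have "R \<in> \<Xi>" using R(1) by (simp add: contact_sections_iff fun_eq_iff)
  moreover have "g R Z = \<alpha> Z" if Z: "Z \<in> \<Xi>" for Z
  proof
    fix p
    obtain X W where X: "X \<in> V" "open W" "p \<in> W" "?P X W" "\<And>q. q \<in> W \<Longrightarrow> R q = X q" using R(2)[of p] by blast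
    have "g R Z p = g X Z p"
      using flinear_local[OF g_flinear_left[OF Z] R(1) X(1,2,3,5)] by blast
    then show "g R Z p = \<alpha> Z p" using X(3,4) Z by simp
  qed
  ultimately show ?thesis by (rule that)
qed

lemma contact_null_zero:
  assumes "D \<in> \<Xi>" "\<And>Z. Z \<in> \<Xi> \<Longrightarrow> \<omega> D Z = 0" shows "D = 0"
proof (rule g_eqI[OF assms(1) contact_zero])
  show "g D Z = g 0 Z" if "Z \<in> \<Xi>" for Z
    using assms that by (simp add: g_def J_contact ext_deriv_0_left contact_vfield)
qed

text \<open>Starting from a field \<open>U\<close> with \<open>\<lambda>(U) = 1\<close> near \<open>p\<close>, a contact section \<open>Y\<close> is added that cancels
  \<open>d\<lambda>(U, _)\<close> on the contact distribution. Only the normalization is local.\<close>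

lemma ex_reeb_local:
  "\<exists>X\<in>V. \<exists>W. open W \<and> p \<in> W \<and> (\<forall>q\<in>W. \<Lambda> X q = 1) \<and> (\<forall>Z\<in>\<Xi>. \<omega> X Z = 0)"
proof -
  obtain U where U: "U \<in> V" "\<Lambda> U p \<noteq> 0" by (rule ex_form_nonzero)
  obtain h W where h: "h \<in> F" "open W" "p \<in> W" "\<And>q. q \<in> W \<Longrightarrow> h q * \<Lambda> U q = 1"
    by (rule ex_local_reciprocal[OF form_smooth[OF U(1)] U(2)]) (rule that)
  let ?U = "fscale h U"
  have U': "?U \<in> V" using U h by blast
  have "flinear \<Xi> (\<lambda>Z. - g ?U Z)"
    by (rule flinearI) (simp_all add: g_add_right g_fscale_right U' g_smooth)
  then obtain Y where Y: "Y \<in> \<Xi>" "\<And>Z. Z \<in> \<Xi> \<Longrightarrow> g Y Z = - g ?U Z" by (rule riesz) blast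
  have "\<Lambda> (?U + Y) q = 1" if "q \<in> W" for q
    using h(4)[OF that] Y(1) U U' by (simp add: form_add contact_vfield contact_form_0 form_fscale)
  moreover have "\<omega> (?U + Y) Z = 0" if "Z \<in> \<Xi>" for Z
  proof -
    have "g (?U + Y) (\<J> Z) = 0"
      using Y U' that by (simp add: g_add_left contact_vfield J_contact)
    then show ?thesis using U' Y that by (simp add: ext_deriv_via_g contact_vfield)
  qed
  ultimately show ?thesis
    using U' Y h by (intro bexI[of _ "?U + Y"] exI[of _ W]) (simp_all add: contact_vfield)
qed

abbreviation R :: "'q vfield" where "R \<equiv> reeb A lam"

lemma reeb_unique:
  assumes "X \<in> V" "\<Lambda> X = 1" "\<And>Z. Z \<in> \<Xi> \<Longrightarrow> \<omega> X Z = 0"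
    and "X' \<in> V" "\<Lambda> X' = 1" "\<And>Z. Z \<in> \<Xi> \<Longrightarrow> \<omega> X' Z = 0"
  shows "X = X'"
proof -
  have D: "X - X' \<in> \<Xi>" using assms by (simp add: contact_sections_iff form_diff)
  have "X - X' = 0"
    by (rule contact_null_zero[OF D]) (use assms in \<open>simp add: ext_deriv_diff_left contact_vfield\<close>)
  then show ?thesis by simp
qed

text \<open>The glued field annihilates \<open>d\<lambda>\<close> on contact sections, hence on all fields, because it also does so
  on itself.\<close>

lemma ex_reeb: obtains X where "X \<in> V" "\<Lambda> X = 1" "\<And>Z. Z \<in> V \<Longrightarrow> \<omega> X Z = 0"
proof -
  let ?P = "\<lambda>X W. (\<forall>q\<in>W. \<Lambda> X q = 1) \<and> (\<forall>Z\<in>\<Xi>. \<omega> X Z = 0)"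
  obtain X where X: "X \<in> V" "\<And>p. \<exists>Y\<in>V. \<exists>W. open W \<and> p \<in> W \<and> ?P Y W \<and> (\<forall>q\<in>W. X q = Y q)"
  proof (rule vfield_glue[of ?P])
    show "\<exists>X\<in>V. \<exists>W. open W \<and> p \<in> W \<and> ?P X W" for p by (rule ex_reeb_local)
    fix X X' W W' q
    assume *: "X \<in> V" "X' \<in> V" "open W" "open W'" "?P X W" "?P X' W'" "q \<in> W" "q \<in> W'"
    have o: "open (W \<inter> W')" "q \<in> W \<inter> W'" using * by auto
    obtain \<rho> W'' where \<rho>: "\<rho> \<in> F" "open W''" "q \<in> W''" "W'' \<subseteq> W \<inter> W'" "\<And>r. r \<in> W'' \<Longrightarrow> \<rho> r = 1"
      "\<And>r. r \<notin> W \<inter> W' \<Longrightarrow> \<rho> r = 0"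
      by (rule ex_bump[OF o]) (rule that)
    \<comment> \<open>\<open>X - X'\<close> is tangent to the contact distribution only on the overlap\<close>
    let ?D = "fscale \<rho> (X - X')"
    have "\<rho> r * (\<Lambda> X r - \<Lambda> X' r) = 0" for r using * \<rho>(6)[of r] by (cases "r \<in> W \<inter> W'") auto
    then have "\<Lambda> ?D = 0" using * by (simp add: form_fscale form_diff fun_eq_iff)
    then have "?D \<in> \<Xi>" using * \<rho> by (simp add: contact_sections_iff)
    then have "?D = 0"
      by (rule contact_null_zero)
        (use * \<rho> in \<open>simp add: ext_deriv_fscale_left ext_deriv_diff_left contact_vfield\<close>)
    then have "?D q f = 0" for f by simp
    then show "X q = X' q" using \<rho> by (simp add: fun_eq_iff fscale_pointwise)
  qed (rule that)
  have L: "\<Lambda> X = 1"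
  proof
    show "\<Lambda> X q = 1 q" for q
      using X(2)[of q] form_pointwise[of X q] by (metis one_fun_apply)
  qed
  have O: "\<omega> X Z = 0" if Z: "Z \<in> \<Xi>" for Z
  proof
    fix p
    obtain Y W where Y: "Y \<in> V" "open W" "p \<in> W" "?P Y W" "\<And>q. q \<in> W \<Longrightarrow> X q = Y q" using X(2)[of p] by blast
    have "\<omega> X Z p = \<omega> Y Z p"
      using flinear_local[OF ext_deriv_flinear_left[OF contact_vfield[OF Z]] X(1) Y(1,2,3,5)] by blast
    then show "\<omega> X Z p = 0 p" using Y Z by simp
  qed
  have "\<omega> X Z = 0" if Z: "Z \<in> V" for Z
  proof -
    have Z': "Z - fscale (\<Lambda> Z) X \<in> \<Xi>"
      using Z X L by (simp add: contact_sections_iff form_diff form_fscale)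
    have "\<omega> X ((Z - fscale (\<Lambda> Z) X) + fscale (\<Lambda> Z) X) = 0"
      using Z X O[OF Z'] contact_vfield[OF Z']
      by (subst ext_deriv_add_right) (simp_all add: ext_deriv_fscale_right ext_deriv_self)
    then show ?thesis by simp
  qed
  with X(1) L show ?thesis by (rule that)
qed

lemma
  shows reeb_vfield [simp, intro]: "R \<in> V" and form_reeb [simp]: "\<Lambda> R = 1"
    and ext_deriv_reeb: "Z \<in> V \<Longrightarrow> \<omega> R Z = 0"
proof -
  obtain X where X: "X \<in> V" "\<Lambda> X = 1" "\<And>Z. Z \<in> V \<Longrightarrow> \<omega> X Z = 0" by (rule ex_reeb) (rule that)
  have "R = X"
    unfolding reeb_def
  proof (rule the_equality)
    show "X \<in> V \<and> (\<forall>p. \<Lambda> X p = 1) \<and> (\<forall>Y\<in>V. \<forall>p. \<omega> X Y p = 0)" using X by simp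
    fix X' assume X': "X' \<in> V \<and> (\<forall>p. \<Lambda> X' p = 1) \<and> (\<forall>Y\<in>V. \<forall>p. \<omega> X' Y p = 0)"
    show "X' = X"
      by (rule reeb_unique) (use X X' contact_vfield in \<open>auto simp: fun_eq_iff\<close>)
  qed
  then show "R \<in> V" "\<Lambda> R = 1" "Z \<in> V \<Longrightarrow> \<omega> R Z = 0" using X by auto
qed

section \<open>The contact triad connection\<close>

subsection \<open>Splitting off the Reeb direction\<close>

abbreviation proj :: "'q vfield \<Rightarrow> 'q vfield" where "proj \<equiv> contact_proj A lam"

lemma proj_eq: "proj X = X - fscale (\<Lambda> X) R"
  by (simp add: contact_proj_def)

lemma proj_contact [simp, intro]: "X \<in> V \<Longrightarrow> proj X \<in> \<Xi>"
  by (simp add: proj_eq contact_sections_iff form_diff form_fscale)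

lemma proj_of_contact [simp]: "Y \<in> \<Xi> \<Longrightarrow> proj Y = Y"
  by (simp add: proj_eq contact_form_0)

lemma proj_reeb [simp]: "proj R = 0"
  by (simp add: proj_eq)

lemma proj_add: "X \<in> V \<Longrightarrow> Y \<in> V \<Longrightarrow> proj (X + Y) = proj X + proj Y"
  by (simp add: proj_eq form_add fscale_add_left)

lemma proj_fscale: "X \<in> V \<Longrightarrow> proj (fscale h X) = fscale h (proj X)"
  by (simp add: proj_eq form_fscale fscale_diff_right fscale_fscale)

lemma proj_diff: "X \<in> V \<Longrightarrow> Y \<in> V \<Longrightarrow> proj (X - Y) = proj X - proj Y"
  by (simp add: proj_eq form_diff fscale_diff_left)

lemma proj_decomp: "proj X + fscale (\<Lambda> X) R = X"
  by (simp add: proj_eq)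

lemma g_reeb [simp]: "Z \<in> \<Xi> \<Longrightarrow> g R Z = 0"
  by (simp add: g_def ext_deriv_reeb contact_vfield J_contact)

lemma g_fscale_reeb [simp]: "h \<in> F \<Longrightarrow> Z \<in> \<Xi> \<Longrightarrow> g (fscale h R) Z = 0"
  by (simp add: g_fscale_left)

lemma g_0_left [simp]: "Z \<in> \<Xi> \<Longrightarrow> g 0 Z = 0"
  by (simp add: g_def ext_deriv_0_left contact_vfield J_contact)

lemma g_proj: "X \<in> V \<Longrightarrow> Z \<in> \<Xi> \<Longrightarrow> g (proj X) Z = g X Z"
  by (simp add: proj_eq g_diff_left)

lemma vfield_eqI:
  assumes "X \<in> V" "Y \<in> V" "\<Lambda> X = \<Lambda> Y" "\<And>Z. Z \<in> \<Xi> \<Longrightarrow> g X Z = g Y Z"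
  shows "X = Y"
proof -
  have "proj X = proj Y" by (rule g_eqI) (use assms in \<open>simp_all add: g_proj\<close>)
  then show ?thesis using proj_decomp assms(3) by metis
qed

lemma vderiv_decomp: "vderiv X f = vderiv (proj X) f + \<Lambda> X * vderiv R f"
  by (metis proj_decomp vderiv_add_field vderiv_fscale)

lemma J_ext_contact: "Y \<in> \<Xi> \<Longrightarrow> J_ext A lam J Y = \<J> Y"
  by (simp add: J_ext_def)

lemma triad_metric_contact: "X \<in> V \<Longrightarrow> Z \<in> \<Xi> \<Longrightarrow> triad_metric A lam J X Z = g X Z"
  using g_proj[of X Z] by (simp add: triad_metric_def J_ext_def contact_form_0 g_def fun_eq_iff)

lemma triad_metric_reeb: "Y \<in> V \<Longrightarrow> triad_metric A lam J R Y = \<Lambda> Y"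
  by (simp add: triad_metric_def J_ext_def ext_deriv_0_left contact_vfield J_contact)

lemma reeb_bracket_contact: assumes "Y \<in> \<Xi>" shows "lie_bracket R Y \<in> \<Xi>"
proof -
  have Y: "Y \<in> V" using assms contact_vfield by blast
  have "\<Lambda> (lie_bracket R Y) = 0"
    using ext_deriv_reeb[OF Y] assms Y unfolding ext_deriv_eq
    by (simp add: contact_form_0 vderiv_0 vderiv_1)
  then show ?thesis using Y by (simp add: contact_sections_iff)
qed

subsection \<open>Derivative of the Reeb field\<close>

text \<open>The only possible value of \<open>\<nabla>\<^sub>Y R\<close>. In terms of the Lie derivative of \<open>J\<close> along the Reeb field it is
  \<open>- (c/2) J Y + (1/2) (L\<^sub>R J) J Y\<close>.\<close>

definition reeb_deriv :: "real \<Rightarrow> 'q vfield \<Rightarrow> 'q vfield" where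
  "reeb_deriv c Y = fscale (\<lambda>_. -1/2) (fscale (\<lambda>_. c) (\<J> Y) + lie_bracket R Y + \<J> (lie_bracket R (\<J> Y)))"

lemma reeb_deriv_contact: "Y \<in> \<Xi> \<Longrightarrow> reeb_deriv c Y \<in> \<Xi>"
  unfolding reeb_deriv_def by (intro contact_intros J_contact reeb_bracket_contact smooth_const)

lemma reeb_deriv_add: assumes "X \<in> \<Xi>" "Y \<in> \<Xi>" shows "reeb_deriv c (X + Y) = reeb_deriv c X + reeb_deriv c Y"
  unfolding reeb_deriv_def using assms
  by (simp add: J_add J_contact lie_bracket_add_right contact_vfield reeb_bracket_contact
      fscale_add_right)

lemma reeb_deriv_fscale: assumes "h \<in> F" "Y \<in> \<Xi>" shows "reeb_deriv c (fscale h Y) = fscale h (reeb_deriv c Y)"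
proof -
  have b: "lie_bracket R (fscale h Z) = fscale h (lie_bracket R Z) + fscale (vderiv R h) Z" if "Z \<in> \<Xi>" for Z
    using assms that by (simp add: lie_bracket_fscale_right contact_vfield)
  have "\<J> (lie_bracket R (\<J> (fscale h Y))) = fscale h (\<J> (lie_bracket R (\<J> Y))) - fscale (vderiv R h) Y"
    using assms by (simp add: b J_fscale J_contact J_add reeb_bracket_contact contact_fscale J_J fscale_uminus_right)
  then show ?thesis
    unfolding reeb_deriv_def using assms
    by (simp add: b J_fscale fscale_add_right fscale_fscale mult_ac)
qed

lemma reeb_deriv_J:
  assumes Y: "Y \<in> \<Xi>"
  shows "reeb_deriv c (\<J> Y) + \<J> (reeb_deriv c Y) = fscale (\<lambda>_. c) Y"
    and "reeb_deriv c (\<J> Y) + lie_bracket R (\<J> Y) = \<J> (reeb_deriv c Y + lie_bracket R Y)"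
proof -
  have neg: "lie_bracket R (- Y) = - lie_bracket R Y"
    using lie_bracket_fscale_right[of R Y "\<lambda>_. -1"] Y by (simp add: contact_vfield fscale_minus1 vderiv_const)
  have 1: "reeb_deriv c (\<J> Y) = fscale (\<lambda>_. -1/2) (- fscale (\<lambda>_. c) Y + lie_bracket R (\<J> Y) - \<J> (lie_bracket R Y))"
    unfolding reeb_deriv_def using Y by (simp add: J_J neg J_uminus reeb_bracket_contact fscale_uminus_right)
  have 2: "\<J> (reeb_deriv c Y) = fscale (\<lambda>_. -1/2) (- fscale (\<lambda>_. c) Y + \<J> (lie_bracket R Y) - lie_bracket R (\<J> Y))"
    unfolding reeb_deriv_def using Y
    by (simp add: J_J J_add J_fscale J_contact reeb_bracket_contact contact_intros fscale_uminus_right)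
  show "reeb_deriv c (\<J> Y) + \<J> (reeb_deriv c Y) = fscale (\<lambda>_. c) Y"
    unfolding 1 2 by (auto simp: fun_eq_iff fscale_pointwise algebra_simps)
  have 3: "\<J> (reeb_deriv c Y + lie_bracket R Y) = \<J> (reeb_deriv c Y) + \<J> (lie_bracket R Y)"
    using Y by (simp add: J_add reeb_deriv_contact reeb_bracket_contact)
  show "reeb_deriv c (\<J> Y) + lie_bracket R (\<J> Y) = \<J> (reeb_deriv c Y + lie_bracket R Y)"
    unfolding 3 unfolding 1 2 by (auto simp: fun_eq_iff fscale_pointwise algebra_simps)
qed

text \<open>Closedness of \<open>d\<lambda>\<close> with \<open>R\<close> in one slot, that is, invariance of \<open>d\<lambda>\<close> under the Reeb flow. Because
  of the way \<open>J\<close> enters \<open>g\<close>, the right-hand side is not visibly symmetric in \<open>Y\<close> and \<open>Z\<close>.\<close>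

lemma lie_reeb_metric:
  assumes Y: "Y \<in> \<Xi>" and Z: "Z \<in> \<Xi>"
  shows "vderiv R (g Y Z) = g (lie_bracket R Y) Z + g (lie_bracket R (\<J> Z)) (\<J> Y)"
proof -
  note in_V = contact_vfield[OF Y] contact_vfield[OF J_contact[OF Z]]
  note in_X = reeb_bracket_contact[OF J_contact[OF Z]]
  have "vderiv R (\<omega> Y (\<J> Z)) - \<omega> (lie_bracket R Y) (\<J> Z) - \<omega> (lie_bracket (\<J> Z) R) Y = 0"
    using ext_deriv_closed[OF reeb_vfield in_V] in_V
    by (simp add: ext_deriv_reeb vderiv_0 ext_deriv_commute[of R])
  moreover have "\<omega> (lie_bracket (\<J> Z) R) Y = g (lie_bracket R (\<J> Z)) (\<J> Y)"
    using in_V in_X Y J_contact[OF Y]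
    by (simp add: lie_bracket_commute[of "\<J> Z" R] ext_deriv_via_g g_uminus_left contact_vfield)
  ultimately show ?thesis by (simp add: g_def algebra_simps)
qed

text \<open>This is the average of \<open>lie_reeb_metric\<close> and its version with \<open>Y\<close> and \<open>Z\<close> exchanged; the terms
  with \<open>c\<close> cancel as \<open>J\<close> is skew.\<close>

lemma reeb_deriv_metric:
  assumes Y: "Y \<in> \<Xi>" and Z: "Z \<in> \<Xi>"
  shows "vderiv R (g Y Z) = g (reeb_deriv c Y + lie_bracket R Y) Z + g Y (reeb_deriv c Z + lie_bracket R Z)"
proof -
  have e: "g (reeb_deriv c Y + lie_bracket R Y) Z q = (g (lie_bracket R Y) Z q + g (lie_bracket R (\<J> Y)) (\<J> Z) q
      - c * g (\<J> Y) Z q) / 2" if Y: "Y \<in> \<Xi>" and Z: "Z \<in> \<Xi>" for Y Z q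
  proof -
    have "g (\<J> (lie_bracket R (\<J> Y))) Z = - g (lie_bracket R (\<J> Y)) (\<J> Z)"
      using Y Z by (intro g_J_left reeb_bracket_contact J_contact)
    then show ?thesis
      unfolding reeb_deriv_def using Y Z
      by (simp add: g_add_left g_fscale_left contact_vfield J_contact reeb_bracket_contact algebra_simps)
  qed
  have s: "g Y (reeb_deriv c Z + lie_bracket R Z) = g (reeb_deriv c Z + lie_bracket R Z) Y"
    using Y Z by (intro g_sym contact_intros reeb_deriv_contact reeb_bracket_contact)
  have j: "g (\<J> Y) Z q + g (\<J> Z) Y q = 0" for q
    using Y Z by (simp add: g_J_left[of Y Z] g_sym[of "\<J> Z" Y] J_contact)
  show ?thesis
  proof
    fix q
    have "vderiv R (g Y Z) q = g (lie_bracket R Y) Z q + g (lie_bracket R (\<J> Z)) (\<J> Y) q"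
      using lie_reeb_metric[OF Y Z] by simp
    moreover have "vderiv R (g Y Z) q = g (lie_bracket R Z) Y q + g (lie_bracket R (\<J> Y)) (\<J> Z) q"
      using lie_reeb_metric[OF Z Y] g_sym[OF Y Z] by simp
    moreover have "c * g (\<J> Y) Z q + c * g (\<J> Z) Y q = 0" using j[of q] by (simp flip: distrib_left)
    ultimately show "vderiv R (g Y Z) q = (g (reeb_deriv c Y + lie_bracket R Y) Z + g Y (reeb_deriv c Z + lie_bracket R Z)) q"
      unfolding s plus_fun_apply e[OF Y Z] e[OF Z Y] by (simp add: field_simps)
  qed
qed

subsection \<open>Differentiating contact sections along contact sections\<close>

text \<open>Twice the value \<open>g(\<nabla>\<^sub>X Y, Z)\<close> for the Levi-Civita connection, with Lie brackets projected to the
  contact distribution.\<close>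

definition koszul_form :: "'q vfield \<Rightarrow> 'q vfield \<Rightarrow> 'q vfield \<Rightarrow> 'q \<Rightarrow> real" where
  "koszul_form X Y Z = vderiv X (g Y Z) + vderiv Y (g Z X) - vderiv Z (g X Y)
     + g (lie_bracket X Y) Z - g (lie_bracket Y Z) X + g (lie_bracket Z X) Y"

lemma koszul_form_smooth: "X \<in> \<Xi> \<Longrightarrow> Y \<in> \<Xi> \<Longrightarrow> Z \<in> \<Xi> \<Longrightarrow> koszul_form X Y Z \<in> F"
  unfolding koszul_form_def by (intro smooth_add smooth_diff vderiv_smooth g_smooth) (auto simp: contact_vfield)

lemmas koszul_form_simps = g_add_left g_add_right g_fscale_left g_fscale_right g_diff_left contact_vfield contact_intros
  vderiv_add vderiv_mult vderiv_add_field vderiv_fscale g_smooth lie_bracket_add_left lie_bracket_add_right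
  lie_bracket_fscale_left lie_bracket_fscale_right

lemma
  assumes "X \<in> \<Xi>" "Y \<in> \<Xi>" "Z \<in> \<Xi>" "W \<in> \<Xi>"
  shows koszul_form_add_1: "koszul_form (X + W) Y Z = koszul_form X Y Z + koszul_form W Y Z"
    and koszul_form_add_2: "koszul_form X (Y + W) Z = koszul_form X Y Z + koszul_form X W Z"
    and koszul_form_add_3: "koszul_form X Y (Z + W) = koszul_form X Y Z + koszul_form X Y W"
  unfolding koszul_form_def using assms by (simp_all add: koszul_form_simps algebra_simps)

lemma
  assumes "X \<in> \<Xi>" "Y \<in> \<Xi>" "Z \<in> \<Xi>" "h \<in> F"
  shows koszul_form_fscale_1: "koszul_form (fscale h X) Y Z = h * koszul_form X Y Z"
    and koszul_form_fscale_2: "koszul_form X (fscale h Y) Z = h * koszul_form X Y Z + (\<lambda>_. 2) * (vderiv X h * g Y Z)"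
    and koszul_form_fscale_3: "koszul_form X Y (fscale h Z) = h * koszul_form X Y Z"
proof -
  note s = g_sym[OF assms(2,1)] g_sym[OF assms(3,1)] g_sym[OF assms(3,2)]
  show "koszul_form (fscale h X) Y Z = h * koszul_form X Y Z"
    unfolding koszul_form_def using assms by (simp add: koszul_form_simps s algebra_simps)
  show "koszul_form X (fscale h Y) Z = h * koszul_form X Y Z + (\<lambda>_. 2) * (vderiv X h * g Y Z)"
    unfolding koszul_form_def using assms by (simp add: koszul_form_simps s fun_eq_iff algebra_simps)
  show "koszul_form X Y (fscale h Z) = h * koszul_form X Y Z"
    unfolding koszul_form_def using assms by (simp add: koszul_form_simps s algebra_simps)
qed

lemma
  assumes "X \<in> \<Xi>" "Y \<in> \<Xi>" "Z \<in> \<Xi>"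
  shows koszul_form_uminus_2: "koszul_form X (- Y) Z = - koszul_form X Y Z" and koszul_form_uminus_3: "koszul_form X Y (- Z) = - koszul_form X Y Z"
  using koszul_form_fscale_2[OF assms, of "\<lambda>_. -1"] koszul_form_fscale_3[OF assms, of "\<lambda>_. -1"] assms
  by (simp_all add: fscale_minus1 vderiv_const contact_vfield fun_eq_iff)

lemma koszul_form_torsion: "X \<in> \<Xi> \<Longrightarrow> Y \<in> \<Xi> \<Longrightarrow> Z \<in> \<Xi> \<Longrightarrow> koszul_form X Y Z q - koszul_form Y X Z q = 2 * g (lie_bracket X Y) Z q"
  by (simp add: koszul_form_def lie_bracket_commute[of Y X] lie_bracket_commute[of Z X] lie_bracket_commute[of Z Y]
      g_uminus_left contact_vfield g_sym[of Z X] g_sym[of Z Y] g_sym[of Y X])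

lemma koszul_form_metric: "X \<in> \<Xi> \<Longrightarrow> Y \<in> \<Xi> \<Longrightarrow> Z \<in> \<Xi> \<Longrightarrow> koszul_form X Y Z q + koszul_form X Z Y q = 2 * vderiv X (g Y Z) q"
  by (simp add: koszul_form_def lie_bracket_commute[of Y X] lie_bracket_commute[of Z X] lie_bracket_commute[of Z Y]
      g_uminus_left contact_vfield g_sym[of Z X] g_sym[of Z Y] g_sym[of Y X])

text \<open>The place where \<open>d(d\<lambda>) = 0\<close> enters the torsion condition: it is applied to \<open>Y\<close>, \<open>JY\<close> and \<open>W\<close>, and
  every term is rewritten in terms of \<open>g\<close>. In the language of the Levi-Civita-like operation \<open>N\<close> it says
  \<open>N(Y,Y) + N(JY,JY) = J [JY,Y]\<close>.\<close>

lemma koszul_form_closed: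
  assumes Y: "Y \<in> \<Xi>" and W: "W \<in> \<Xi>"
  shows "koszul_form Y Y W q + koszul_form (\<J> Y) (\<J> Y) W q = - 2 * g (lie_bracket (\<J> Y) Y) (\<J> W) q"
proof -
  note JY = J_contact[OF Y] and JW = J_contact[OF W]
  note V = contact_vfield[OF Y] contact_vfield[OF W] contact_vfield[OF JY]
  have 1: "\<omega> (\<J> Y) W = - g Y W"
    using JY Y W V by (simp add: ext_deriv_via_g g_J_J)
  have 2: "\<omega> W Y = - g (\<J> Y) W"
    using JY Y W V by (simp add: ext_deriv_via_g g_sym)
  have 3: "\<omega> Y (\<J> Y) = g Y Y" by (simp add: g_def)
  have 4: "\<omega> (lie_bracket Y (\<J> Y)) W = g (lie_bracket (\<J> Y) Y) (\<J> W)"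
    using JW W V by (simp add: ext_deriv_via_g lie_bracket_commute[of Y "\<J> Y"] g_uminus_left)
  have 5: "\<omega> (lie_bracket (\<J> Y) W) Y = g (lie_bracket W (\<J> Y)) (\<J> Y)"
    using JY Y V by (simp add: ext_deriv_via_g lie_bracket_commute[of "\<J> Y" W] g_uminus_left)
  have 6: "\<omega> (lie_bracket W Y) (\<J> Y) = g (lie_bracket W Y) Y" by (simp add: g_def)
  have "vderiv Y (- g Y W) + vderiv (\<J> Y) (- g (\<J> Y) W) + vderiv W (g Y Y)
     - g (lie_bracket (\<J> Y) Y) (\<J> W) - g (lie_bracket W (\<J> Y)) (\<J> Y) - g (lie_bracket W Y) Y = 0"
    using ext_deriv_closed[OF V(1) V(3) V(2)] unfolding 1 2 3 4 5 6 .
  then have "(- vderiv Y (g Y W) - vderiv (\<J> Y) (g (\<J> Y) W) + vderiv W (g Y Y)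
     - g (lie_bracket (\<J> Y) Y) (\<J> W) - g (lie_bracket W (\<J> Y)) (\<J> Y) - g (lie_bracket W Y) Y) q = 0"
    using V W JY by (simp add: vderiv_uminus g_smooth)
  moreover have "koszul_form Y Y W q = 2 * vderiv Y (g Y W) q - vderiv W (g Y Y) q + 2 * g (lie_bracket W Y) Y q"
    using V Y W by (simp add: koszul_form_def lie_bracket_commute[of Y W] g_uminus_left g_sym[OF W Y])
  moreover have "koszul_form (\<J> Y) (\<J> Y) W q
      = 2 * vderiv (\<J> Y) (g (\<J> Y) W) q - vderiv W (g Y Y) q + 2 * g (lie_bracket W (\<J> Y)) (\<J> Y) q"
    using V Y W JY by (simp add: koszul_form_def lie_bracket_commute[of "\<J> Y" W] g_uminus_left g_sym[OF W JY] g_J_J)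
  ultimately show ?thesis by simp
qed

text \<open>The complex-linear part \<open>(N(X,Y) - J N(X,JY)) / 2\<close> of the operation \<open>N\<close> with
  \<open>g(N(X,Y), Z) = koszul_form X Y Z / 2\<close>, described by its products with contact sections.\<close>

definition contact_conn :: "'q vfield \<Rightarrow> 'q vfield \<Rightarrow> 'q vfield" where
  "contact_conn X Y = (SOME U. U \<in> \<Xi> \<and> (\<forall>Z\<in>\<Xi>. g U Z = (\<lambda>_. 1/4) * (koszul_form X Y Z + koszul_form X (\<J> Y) (\<J> Z))))"

lemma
  assumes "X \<in> \<Xi>" "Y \<in> \<Xi>"
  shows contact_conn_contact: "contact_conn X Y \<in> \<Xi>"
    and g_H: "Z \<in> \<Xi> \<Longrightarrow> g (contact_conn X Y) Z = (\<lambda>_. 1/4) * (koszul_form X Y Z + koszul_form X (\<J> Y) (\<J> Z))"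
proof -
  have "flinear \<Xi> (\<lambda>Z. (\<lambda>_. 1/4) * (koszul_form X Y Z + koszul_form X (\<J> Y) (\<J> Z)))"
    using assms
    by (intro flinearI) (simp_all add: J_add J_fscale J_contact koszul_form_add_3 koszul_form_fscale_3 koszul_form_smooth algebra_simps)
  then obtain U where "U \<in> \<Xi>" "\<And>Z. Z \<in> \<Xi> \<Longrightarrow> g U Z = (\<lambda>_. 1/4) * (koszul_form X Y Z + koszul_form X (\<J> Y) (\<J> Z))"
    by (rule riesz) (rule that)
  then have "\<exists>U. U \<in> \<Xi> \<and> (\<forall>Z\<in>\<Xi>. g U Z = (\<lambda>_. 1/4) * (koszul_form X Y Z + koszul_form X (\<J> Y) (\<J> Z)))" by blast
  from someI_ex[OF this]
  show "contact_conn X Y \<in> \<Xi>" "Z \<in> \<Xi> \<Longrightarrow> g (contact_conn X Y) Z = (\<lambda>_. 1/4) * (koszul_form X Y Z + koszul_form X (\<J> Y) (\<J> Z))"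
    unfolding contact_conn_def by blast+
qed

lemma contact_conn_add_left: "X \<in> \<Xi> \<Longrightarrow> X' \<in> \<Xi> \<Longrightarrow> Y \<in> \<Xi> \<Longrightarrow> contact_conn (X + X') Y = contact_conn X Y + contact_conn X' Y"
  by (rule g_eqI) (simp_all add: contact_conn_contact contact_intros g_H g_add_left contact_vfield koszul_form_add_1 J_contact algebra_simps)

lemma contact_conn_add_right: "X \<in> \<Xi> \<Longrightarrow> Y \<in> \<Xi> \<Longrightarrow> Y' \<in> \<Xi> \<Longrightarrow> contact_conn X (Y + Y') = contact_conn X Y + contact_conn X Y'"
  by (rule g_eqI) (simp_all add: contact_conn_contact contact_intros g_H g_add_left contact_vfield koszul_form_add_2 J_contact J_add algebra_simps)

lemma contact_conn_fscale_left: "h \<in> F \<Longrightarrow> X \<in> \<Xi> \<Longrightarrow> Y \<in> \<Xi> \<Longrightarrow> contact_conn (fscale h X) Y = fscale h (contact_conn X Y)"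
  by (rule g_eqI) (simp_all add: contact_conn_contact contact_intros g_H g_fscale_left contact_vfield koszul_form_fscale_1 J_contact algebra_simps)

lemma contact_conn_fscale_right:
  assumes "h \<in> F" "X \<in> \<Xi>" "Y \<in> \<Xi>"
  shows "contact_conn X (fscale h Y) = fscale h (contact_conn X Y) + fscale (vderiv X h) Y"
proof (rule g_eqI)
  show "g (contact_conn X (fscale h Y)) Z = g (fscale h (contact_conn X Y) + fscale (vderiv X h) Y) Z" if "Z \<in> \<Xi>" for Z
    using assms that
    by (simp add: contact_conn_contact contact_intros g_H g_add_left g_fscale_left contact_vfield koszul_form_fscale_2 J_contact J_fscale g_J_J
        fun_eq_iff algebra_simps)
qed (use assms in \<open>simp_all add: contact_conn_contact contact_intros contact_vfield\<close>)

lemma contact_conn_J: assumes X: "X \<in> \<Xi>" and Y: "Y \<in> \<Xi>" shows "contact_conn X (\<J> Y) = \<J> (contact_conn X Y)"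
proof (rule g_eqI)
  show "g (contact_conn X (\<J> Y)) Z = g (\<J> (contact_conn X Y)) Z" if Z: "Z \<in> \<Xi>" for Z
    using assms that
    by (simp add: contact_conn_contact g_H g_J_left J_contact J_J koszul_form_uminus_2 koszul_form_uminus_3 fun_eq_iff) (simp add: field_simps)
qed (use assms in \<open>simp_all add: contact_conn_contact J_contact\<close>)

lemma contact_conn_metric:
  assumes X: "X \<in> \<Xi>" and Y: "Y \<in> \<Xi>" and Z: "Z \<in> \<Xi>"
  shows "vderiv X (g Y Z) = g (contact_conn X Y) Z + g Y (contact_conn X Z)"
proof
  fix q
  have "g Y (contact_conn X Z) = g (contact_conn X Z) Y" using assms by (intro g_sym contact_conn_contact)
  then show "vderiv X (g Y Z) q = (g (contact_conn X Y) Z + g Y (contact_conn X Z)) q"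
    using koszul_form_metric[OF X Y Z, of q] koszul_form_metric[OF X J_contact[OF Y] J_contact[OF Z], of q] assms
    by (simp add: g_H g_J_J field_simps)
qed

text \<open>Of the four Koszul expressions involved, two differ by an exchange of \<open>JY\<close> and \<open>Y\<close> in the first two
  entries and are subtracted, the other two have equal first entries and are added, to which
  \<open>koszul_form_closed\<close> applies; each pair contributes half of the bracket.\<close>

lemma contact_conn_torsion:
  assumes Y: "Y \<in> \<Xi>" and Z: "Z \<in> \<Xi>"
  shows "g (contact_conn (\<J> Y) Y) Z - g (contact_conn Y (\<J> Y)) Z = g (lie_bracket (\<J> Y) Y) Z"
proof
  fix q
  note J = J_contact[OF Y] J_contact[OF Z]
  have "g (lie_bracket (\<J> Y) Y) (\<J> (\<J> Z)) = - g (lie_bracket (\<J> Y) Y) Z"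
    using Y Z J by (simp add: J_J g_uminus_right contact_vfield)
  then have "koszul_form Y Y (\<J> Z) q + koszul_form (\<J> Y) (\<J> Y) (\<J> Z) q = 2 * g (lie_bracket (\<J> Y) Y) Z q"
    using koszul_form_closed[OF Y J(2), of q] by simp
  moreover have "koszul_form (\<J> Y) Y Z q - koszul_form Y (\<J> Y) Z q = 2 * g (lie_bracket (\<J> Y) Y) Z q"
    using Y Z J by (intro koszul_form_torsion)
  ultimately show "(g (contact_conn (\<J> Y) Y) Z - g (contact_conn Y (\<J> Y)) Z) q = g (lie_bracket (\<J> Y) Y) Z q"
    using Y Z J by (simp add: g_H J_J koszul_form_uminus_2 field_simps)
qed

subsection \<open>Existence\<close>

text \<open>Expanding both entries along the Reeb field and using the Leibniz rule; the value on \<open>(R,R)\<close> is zero.\<close>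

definition triad_conn :: "real \<Rightarrow> 'q vfield \<Rightarrow> 'q vfield \<Rightarrow> 'q vfield" where
  "triad_conn c X Y = contact_conn (proj X) (proj Y) + fscale (\<Lambda> X) (reeb_deriv c (proj Y) + lie_bracket R (proj Y))
     + fscale (\<Lambda> Y) (reeb_deriv c (proj X)) + fscale (vderiv X (\<Lambda> Y) - g (reeb_deriv c (proj X)) (proj Y)) R"

lemma
  assumes "X \<in> V" "Y \<in> V"
  shows triad_conn_vfield: "triad_conn c X Y \<in> V"
    and triad_conn_form: "\<Lambda> (triad_conn c X Y) = vderiv X (\<Lambda> Y) - g (reeb_deriv c (proj X)) (proj Y)"
    and triad_conn_g: "Z \<in> \<Xi> \<Longrightarrow> g (triad_conn c X Y) Z = g (contact_conn (proj X) (proj Y)) Z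
      + \<Lambda> X * g (reeb_deriv c (proj Y) + lie_bracket R (proj Y)) Z + \<Lambda> Y * g (reeb_deriv c (proj X)) Z"
proof -
  note p = proj_contact[OF assms(1)] proj_contact[OF assms(2)]
  let ?h = "vderiv X (\<Lambda> Y) - g (reeb_deriv c (proj X)) (proj Y)"
  let ?U = "contact_conn (proj X) (proj Y) + fscale (\<Lambda> X) (reeb_deriv c (proj Y) + lie_bracket R (proj Y)) + fscale (\<Lambda> Y) (reeb_deriv c (proj X))"
  have h: "?h \<in> F" using assms p by (intro smooth_diff vderiv_smooth g_smooth) (simp_all add: reeb_deriv_contact contact_vfield)
  have U: "?U \<in> \<Xi>"
    using p assms by (intro contact_intros contact_conn_contact reeb_deriv_contact reeb_bracket_contact form_smooth)
  show "triad_conn c X Y \<in> V" unfolding triad_conn_def using U h by (simp add: contact_vfield)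
  show "\<Lambda> (triad_conn c X Y) = ?h"
    unfolding triad_conn_def using U h by (simp add: form_add form_fscale contact_form_0 contact_vfield)
  show "g (triad_conn c X Y) Z = g (contact_conn (proj X) (proj Y)) Z
      + \<Lambda> X * g (reeb_deriv c (proj Y) + lie_bracket R (proj Y)) Z + \<Lambda> Y * g (reeb_deriv c (proj X)) Z" if Z: "Z \<in> \<Xi>"
  proof -
    have "g (triad_conn c X Y) Z = g ?U Z"
      unfolding triad_conn_def using U h Z by (simp add: g_add_left contact_vfield)
    also have "\<dots> = g (contact_conn (proj X) (proj Y)) Z
      + \<Lambda> X * g (reeb_deriv c (proj Y) + lie_bracket R (proj Y)) Z + \<Lambda> Y * g (reeb_deriv c (proj X)) Z"
      using p assms Z
      by (simp add: g_add_left[of _ _ Z] g_fscale_left contact_vfield contact_intros contact_conn_contact reeb_deriv_contact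
          reeb_bracket_contact form_smooth del: g_add_left)
    finally show ?thesis .
  qed
qed

definition triad_connection :: "real \<Rightarrow> 'q conn \<Rightarrow> bool" where
  "triad_connection c D \<longleftrightarrow> affine_connection A D \<and>
    hermitian_conn A lam J (proj_conn A lam D) \<and>
    (\<forall>Y\<in>\<Xi>. proj (torsion D (J_ext A lam J Y) Y) = 0) \<and>
    (\<forall>Y\<in>V. torsion D R Y = 0) \<and>
    (D R R = 0 \<and> (\<forall>Y\<in>\<Xi>. D Y R \<in> \<Xi>)) \<and>
    (\<forall>Y\<in>\<Xi>. D (J_ext A lam J Y) R + J_ext A lam J (D Y R) = fscale (\<lambda>_. c) Y) \<and>
    (\<forall>Y\<in>\<Xi>. \<forall>Z\<in>\<Xi>. triad_metric A lam J (D Y R) Z + triad_metric A lam J R (D Y Z) = 0)"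

text \<open>Two fields agree if \<open>\<lambda>\<close> and all products with contact sections agree, so that each axiom splits into
  identities between functions.\<close>

lemma triad_conn_affine: "affine_connection A (\<lambda>X\<in>V. \<lambda>Y\<in>V. triad_conn c X Y)"
proof -
  note [simp] = triad_conn_vfield triad_conn_form triad_conn_g g_add_left g_fscale_left reeb_deriv_contact contact_conn_contact
    reeb_bracket_contact contact_vfield g_smooth form_add form_fscale proj_add proj_fscale
  have "triad_conn c (X + X') Y = triad_conn c X Y + triad_conn c X' Y" if "X \<in> V" "X' \<in> V" "Y \<in> V" for X X' Y
    by (rule vfield_eqI)
      (use that in \<open>simp_all add: vderiv_add_field reeb_deriv_add contact_conn_add_left contact_intros algebra_simps\<close>)
  moreover have "triad_conn c (fscale f X) Y = fscale f (triad_conn c X Y)" if "f \<in> F" "X \<in> V" "Y \<in> V" for f X Y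
    by (rule vfield_eqI)
      (use that in \<open>simp_all add: vderiv_fscale reeb_deriv_fscale contact_conn_fscale_left contact_intros algebra_simps\<close>)
  moreover have "triad_conn c X (Y + Y') = triad_conn c X Y + triad_conn c X Y'" if "X \<in> V" "Y \<in> V" "Y' \<in> V" for X Y Y'
    by (rule vfield_eqI)
      (use that in \<open>simp_all add: vderiv_add reeb_deriv_add contact_conn_add_right g_add_right lie_bracket_add_right contact_intros algebra_simps\<close>)
  moreover have "triad_conn c X (fscale f Y) = fscale f (triad_conn c X Y) + fscale (vderiv X f) Y"
    if that: "f \<in> F" "X \<in> V" "Y \<in> V" for f X Y
  proof (rule vfield_eqI)
    fix Z assume Z: "Z \<in> \<Xi>"
    have "g (triad_conn c X (fscale f Y)) Z = f * g (triad_conn c X Y) Z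
        + (vderiv (proj X) f + \<Lambda> X * vderiv R f) * g (proj Y) Z"
      using that Z by (simp add: reeb_deriv_fscale contact_conn_fscale_right lie_bracket_fscale_right contact_intros algebra_simps)
    then show "g (triad_conn c X (fscale f Y)) Z = g (fscale f (triad_conn c X Y) + fscale (vderiv X f) Y) Z"
      using that Z by (simp add: g_proj flip: vderiv_decomp)
  qed (use that in \<open>simp_all add: vderiv_mult reeb_deriv_fscale g_fscale_right contact_intros algebra_simps\<close>)
  ultimately show ?thesis
    unfolding affine_connection_def by auto
qed

lemma reeb_deriv_0: "reeb_deriv c 0 = 0"
  using reeb_deriv_fscale[of 0 0 c] by (simp add: contact_zero)

lemma contact_conn_0_left: "Y \<in> \<Xi> \<Longrightarrow> contact_conn 0 Y = 0"
  using contact_conn_fscale_left[of 0 0 Y] by (simp add: contact_zero)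

lemma contact_conn_0_right: "X \<in> \<Xi> \<Longrightarrow> contact_conn X 0 = 0"
  using contact_conn_fscale_right[of 0 X 0] by (simp add: contact_zero vderiv_0 contact_vfield)

lemma lie_bracket_0_right: "X \<in> V \<Longrightarrow> lie_bracket X 0 = 0"
  using lie_bracket_fscale_right[of X 0 0] by (simp add: vderiv_0)

lemma g_0_right: "X \<in> V \<Longrightarrow> g X 0 = 0"
  using g_fscale_right[of 0 X 0] by (simp add: contact_zero)

lemma triad_conn_contact_reeb: "Y \<in> \<Xi> \<Longrightarrow> triad_conn c Y R = reeb_deriv c Y"
  by (simp add: triad_conn_def contact_conn_0_right reeb_deriv_0 lie_bracket_0_right contact_vfield contact_form_0 vderiv_1
      g_0_right reeb_deriv_contact)

lemma triad_conn_reeb_reeb: "triad_conn c R R = 0"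
  by (simp add: triad_conn_def contact_conn_0_right reeb_deriv_0 lie_bracket_0_right vderiv_1 g_0_right contact_zero)

lemma proj_conn_contact:
  assumes "X \<in> V" "Y \<in> \<Xi>"
  shows "proj (triad_conn c X Y) = contact_conn (proj X) Y + fscale (\<Lambda> X) (reeb_deriv c Y + lie_bracket R Y)"
  using assms
  by (intro g_eqI) (simp_all add: triad_conn_vfield triad_conn_g g_proj g_add_left g_fscale_left contact_form_0
      contact_vfield contact_intros contact_conn_contact reeb_deriv_contact reeb_bracket_contact)

lemma triad_conn_triad_connection: "triad_connection c (\<lambda>X\<in>V. \<lambda>Y\<in>V. triad_conn c X Y)"
proof -
  let ?D = "\<lambda>X\<in>V. \<lambda>Y\<in>V. triad_conn c X Y"
  have D: "?D X Y = triad_conn c X Y" if "X \<in> V" "Y \<in> V" for X Y using that by simp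
  have pD: "proj_conn A lam ?D X Y = contact_conn (proj X) Y + fscale (\<Lambda> X) (reeb_deriv c Y + lie_bracket R Y)"
    if "X \<in> V" "Y \<in> \<Xi>" for X Y
    using that by (simp add: proj_conn_def D contact_vfield proj_conn_contact)
  have pDX: "contact_conn (proj X) Y + fscale (\<Lambda> X) (reeb_deriv c Y + lie_bracket R Y) \<in> \<Xi>"
    if "X \<in> V" "Y \<in> \<Xi>" for X Y
    using that by (simp add: contact_conn_contact reeb_deriv_contact reeb_bracket_contact contact_intros)
  have herm: "hermitian_conn A lam J (proj_conn A lam ?D)"
    unfolding hermitian_conn_def
  proof (intro conjI ballI)
    fix X Y assume X: "X \<in> V" and Y: "Y \<in> \<Xi>"
    show "proj_conn A lam ?D X (J_ext A lam J Y) = J_ext A lam J (proj_conn A lam ?D X Y)"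
      using X Y pDX[OF X Y]
      by (simp add: pD J_ext_contact J_contact contact_conn_J reeb_deriv_J(2) J_add J_fscale contact_conn_contact reeb_deriv_contact
          reeb_bracket_contact contact_intros)
    fix Z assume Z: "Z \<in> \<Xi>"
    have "vderiv X (g Y Z) = vderiv (proj X) (g Y Z) + \<Lambda> X * vderiv R (g Y Z)"
      by (rule vderiv_decomp)
    also have "\<dots> = g (contact_conn (proj X) Y + fscale (\<Lambda> X) (reeb_deriv c Y + lie_bracket R Y)) Z
        + g Y (contact_conn (proj X) Z + fscale (\<Lambda> X) (reeb_deriv c Z + lie_bracket R Z))"
      unfolding contact_conn_metric[OF proj_contact[OF X] Y Z] reeb_deriv_metric[OF Y Z, of c]
      using X Y Z
      by (simp add: g_add_left g_add_right g_fscale_left g_fscale_right contact_vfield contact_intros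
          contact_conn_contact reeb_deriv_contact reeb_bracket_contact algebra_simps)
    finally show "vderiv X (triad_metric A lam J Y Z)
        = triad_metric A lam J (proj_conn A lam ?D X Y) Z + triad_metric A lam J Y (proj_conn A lam ?D X Z)"
      using X Y Z pDX[OF X Y] pDX[OF X Z] by (simp add: pD triad_metric_contact contact_vfield)
  qed
  have tor: "proj (torsion ?D (J_ext A lam J Y) Y) = 0" if Y: "Y \<in> \<Xi>" for Y
  proof -
    note JY = J_contact[OF Y]
    have t: "torsion ?D (\<J> Y) Y = triad_conn c (\<J> Y) Y - triad_conn c Y (\<J> Y) - lie_bracket (\<J> Y) Y"
      using Y JY by (simp add: torsion_def contact_vfield)
    have tV: "torsion ?D (\<J> Y) Y \<in> V"
      unfolding t using Y JY by (simp add: triad_conn_vfield contact_vfield)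
    have "proj (torsion ?D (\<J> Y) Y) = 0"
    proof (rule g_eqI)
      fix Z assume Z: "Z \<in> \<Xi>"
      have c: "g (triad_conn c U W) Z = g (contact_conn U W) Z" if "U \<in> \<Xi>" "W \<in> \<Xi>" for U W
        using that Z by (simp add: triad_conn_g contact_vfield contact_form_0)
      have "g (proj (torsion ?D (\<J> Y) Y)) Z = g (torsion ?D (\<J> Y) Y) Z"
        using tV Z by (rule g_proj)
      also have "\<dots> = g (contact_conn (\<J> Y) Y) Z - g (contact_conn Y (\<J> Y)) Z - g (lie_bracket (\<J> Y) Y) Z"
        unfolding t using Y JY Z by (simp add: g_diff_left triad_conn_vfield contact_vfield c)
      also have "\<dots> = g 0 Z" unfolding contact_conn_torsion[OF Y Z] using Z by simp
      finally show "g (proj (torsion ?D (\<J> Y) Y)) Z = g 0 Z" .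
    qed (rule proj_contact[OF tV], rule contact_zero)
    then show ?thesis using Y by (simp add: J_ext_contact)
  qed
  have torR: "torsion ?D R Y = 0" if Y: "Y \<in> V" for Y
  proof -
    note pY = proj_contact[OF Y]
    have b: "lie_bracket R Y = lie_bracket R (proj Y) + fscale (vderiv R (\<Lambda> Y)) R"
    proof -
      have "lie_bracket R (proj Y + fscale (\<Lambda> Y) R) = lie_bracket R (proj Y) + fscale (vderiv R (\<Lambda> Y)) R"
        using Y pY by (simp add: lie_bracket_add_right lie_bracket_fscale_right contact_vfield)
      then show ?thesis by (simp add: proj_decomp)
    qed
    have "triad_conn c R Y = reeb_deriv c (proj Y) + lie_bracket R (proj Y) + fscale (vderiv R (\<Lambda> Y)) R"
      using pY by (simp add: triad_conn_def contact_conn_0_left reeb_deriv_0)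
    moreover have "triad_conn c Y R = reeb_deriv c (proj Y)"
      using pY Y by (simp add: triad_conn_def contact_conn_0_right reeb_deriv_0 lie_bracket_0_right vderiv_1 g_0_right contact_vfield reeb_deriv_contact)
    ultimately show ?thesis using Y by (simp add: torsion_def b)
  qed
  have five: "?D (J_ext A lam J Y) R + J_ext A lam J (?D Y R) = fscale (\<lambda>_. c) Y" if "Y \<in> \<Xi>" for Y
    using that by (simp add: J_ext_contact contact_vfield J_contact triad_conn_contact_reeb reeb_deriv_contact reeb_deriv_J(1))
  have six: "triad_metric A lam J (?D Y R) Z + triad_metric A lam J R (?D Y Z) = 0"
    if "Y \<in> \<Xi>" "Z \<in> \<Xi>" for Y Z
    using that by (simp add: contact_vfield triad_conn_contact_reeb triad_metric_contact triad_metric_reeb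
        reeb_deriv_contact triad_conn_vfield triad_conn_form contact_form_0 vderiv_0)
  have four: "?D R R = 0" "\<forall>Y\<in>\<Xi>. ?D Y R \<in> \<Xi>"
    by (simp_all add: triad_conn_reeb_reeb contact_vfield triad_conn_contact_reeb reeb_deriv_contact)
  show ?thesis
    unfolding triad_connection_def
    by (intro conjI ballI triad_conn_affine herm tor torR four[rule_format] five six)
qed

subsection \<open>Uniqueness\<close>

text \<open>The auxiliary \<open>C\<close> measures
  the failure of complex linearity in the first entry. Being antisymmetric, it must have the same type in both
  entries, but it is antilinear in the first and linear in the second. Once \<open>C = 0\<close>, the operator \<open>B (J Y)\<close> is
  \<open>J\<close> times a skew operator commuting with \<open>J\<close>, which is symmetric, and it is also skew itself.\<close>

lemma hermitian_difference_zero: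
  assumes B: "\<And>X Y. X \<in> \<Xi> \<Longrightarrow> Y \<in> \<Xi> \<Longrightarrow> B X Y \<in> \<Xi>"
    and add_left: "\<And>X X' Y. X \<in> \<Xi> \<Longrightarrow> X' \<in> \<Xi> \<Longrightarrow> Y \<in> \<Xi> \<Longrightarrow> B (X + X') Y = B X Y + B X' Y"
    and add_right: "\<And>X Y Y'. X \<in> \<Xi> \<Longrightarrow> Y \<in> \<Xi> \<Longrightarrow> Y' \<in> \<Xi> \<Longrightarrow> B X (Y + Y') = B X Y + B X Y'"
    and J_lin: "\<And>X Y. X \<in> \<Xi> \<Longrightarrow> Y \<in> \<Xi> \<Longrightarrow> B X (\<J> Y) = \<J> (B X Y)"
    and skew: "\<And>X Y Z. X \<in> \<Xi> \<Longrightarrow> Y \<in> \<Xi> \<Longrightarrow> Z \<in> \<Xi> \<Longrightarrow> g (B X Y) Z = - g Y (B X Z)"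
    and sym: "\<And>Y. Y \<in> \<Xi> \<Longrightarrow> B (\<J> Y) Y = B Y (\<J> Y)"
    and X: "X \<in> \<Xi>" and Y: "Y \<in> \<Xi>"
  shows "B X Y = 0"
proof -
  have B_uminus: "B (- Y) Z = - B Y Z" if "Y \<in> \<Xi>" "Z \<in> \<Xi>" for Y Z
  proof -
    have "B 0 Z + B 0 Z = B 0 Z" using add_left[OF contact_zero contact_zero that(2)] by simp
    then have "B 0 Z = 0" by simp
    then show ?thesis using add_left[OF that(1) contact_uminus[OF that(1)] that(2)]
      by (simp add: eq_neg_iff_add_eq_0 add.commute)
  qed
  define C where "C Y Z = B (\<J> Y) Z - B Y (\<J> Z)" for Y Z
  have C: "C Y Z \<in> \<Xi>" if "Y \<in> \<Xi>" "Z \<in> \<Xi>" for Y Z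
    unfolding C_def using that by (intro contact_intros B J_contact)
  have C_anti: "C Y Z = - C Z Y" if Y: "Y \<in> \<Xi>" and Z: "Z \<in> \<Xi>" for Y Z
  proof -
    have "B (\<J> (Y + Z)) (Y + Z) = B (Y + Z) (\<J> (Y + Z))" using Y Z by (intro sym contact_intros)
    then have "B (\<J> Y) Z + B (\<J> Z) Y = B Y (\<J> Z) + B Z (\<J> Y)"
      using sym[OF Y] sym[OF Z] Y Z
      by (simp add: J_add add_left add_right J_contact contact_intros add.commute)
    then show ?thesis by (simp add: C_def algebra_simps)
  qed
  have C_J_right: "C Y (\<J> Z) = \<J> (C Y Z)" if "Y \<in> \<Xi>" "Z \<in> \<Xi>" for Y Z
    unfolding C_def using that by (simp add: J_lin J_diff B J_contact)
  have C_J_left: "C (\<J> Y) Z = - \<J> (C Y Z)" if "Y \<in> \<Xi>" "Z \<in> \<Xi>" for Y Z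
    unfolding C_def using that by (simp add: J_J J_diff B J_contact B_uminus J_lin)
  have C0: "C Y Z = 0" if Y: "Y \<in> \<Xi>" and Z: "Z \<in> \<Xi>" for Y Z
  proof -
    have "\<J> (C Y Z) = - C (\<J> Z) Y" using C_J_right[OF Y Z] C_anti[OF Y J_contact[OF Z]] by simp
    also have "\<dots> = \<J> (C Z Y)" using C_J_left[OF Z Y] by simp
    also have "\<dots> = - \<J> (C Y Z)" using C_anti[OF Z Y] C[OF Y Z] by (simp add: J_uminus)
    finally have "\<J> (C Y Z) = 0" by (simp add: fun_eq_iff)
    then have "\<J> (\<J> (C Y Z)) = 0" using J_fscale[of 0 0] by (simp add: contact_zero)
    then show ?thesis using J_J[OF C[OF Y Z]] by simp
  qed
  \<comment> \<open>using skewness twice and \<open>B (J Y) = J B Y\<close> in between returns the product with the opposite sign\<close>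
  have BJ: "B (\<J> Y) Z = 0" if Y: "Y \<in> \<Xi>" and Z: "Z \<in> \<Xi>" for Y Z
  proof (rule g_eqI[OF B[OF J_contact[OF Y] Z] contact_zero])
    fix W assume W: "W \<in> \<Xi>"
    have e: "B (\<J> Y) U = \<J> (B Y U)" if "U \<in> \<Xi>" for U
      using C0[OF Y that] J_lin[OF Y that] by (simp add: C_def)
    have "g (B (\<J> Y) Z) W = - g Z (\<J> (B Y W))"
      using skew[OF J_contact[OF Y] Z W] e[OF W] by simp
    also have "\<dots> = g (\<J> Z) (B Y W)" using g_J_left[OF Z B[OF Y W]] by simp
    also have "\<dots> = - g (B (\<J> Y) Z) W"
      using skew[OF Y J_contact[OF Z] W] J_lin[OF Y Z] e[OF Z] by simp
    finally have "g (B (\<J> Y) Z) W = 0" by (simp add: fun_eq_iff)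
    then show "g (B (\<J> Y) Z) W = g 0 W" using W by (simp add: fun_eq_iff)
  qed
  have "- B X Y = 0" using BJ[OF J_contact[OF X] Y] X Y by (simp add: J_J B_uminus)
  then show ?thesis by simp
qed

lemma
  assumes "affine_connection A D"
  shows affine_vfield: "X \<in> V \<Longrightarrow> Y \<in> V \<Longrightarrow> D X Y \<in> V"
    and affine_add_left: "X \<in> V \<Longrightarrow> X' \<in> V \<Longrightarrow> Y \<in> V \<Longrightarrow> D (X + X') Y = D X Y + D X' Y"
    and affine_fscale_left: "f \<in> F \<Longrightarrow> X \<in> V \<Longrightarrow> Y \<in> V \<Longrightarrow> D (fscale f X) Y = fscale f (D X Y)"
    and affine_add_right: "X \<in> V \<Longrightarrow> Y \<in> V \<Longrightarrow> Y' \<in> V \<Longrightarrow> D X (Y + Y') = D X Y + D X Y'"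
    and affine_fscale_right: "f \<in> F \<Longrightarrow> X \<in> V \<Longrightarrow> Y \<in> V \<Longrightarrow>
      D X (fscale f Y) = fscale f (D X Y) + fscale (vderiv X f) Y"
  using assms unfolding affine_connection_def by blast+

lemma affine_connection_eqI:
  assumes D: "affine_connection A D" and D': "affine_connection A D'"
    and cc: "\<And>X Y. X \<in> \<Xi> \<Longrightarrow> Y \<in> \<Xi> \<Longrightarrow> D X Y = D' X Y"
    and cr: "\<And>X. X \<in> \<Xi> \<Longrightarrow> D X R = D' X R"
    and rc: "\<And>Y. Y \<in> \<Xi> \<Longrightarrow> D R Y = D' R Y" and rr: "D R R = D' R R"
  shows "D = D'"
proof -
  have right: "D X Y = D (proj X) (proj Y) + fscale (\<Lambda> X) (D R (proj Y))
      + fscale (\<Lambda> Y) (D (proj X) R + fscale (\<Lambda> X) (D R R)) + fscale (vderiv X (\<Lambda> Y)) R"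
    if D: "affine_connection A D" and X: "X \<in> V" and Y: "Y \<in> V" for D X Y
  proof -
    have l: "D X U = D (proj X) U + fscale (\<Lambda> X) (D R U)" if "U \<in> V" for U
    proof -
      have "D (proj X + fscale (\<Lambda> X) R) U = D (proj X) U + fscale (\<Lambda> X) (D R U)"
        using X that contact_vfield[OF proj_contact[OF X]]
        by (simp add: affine_add_left[OF D] affine_fscale_left[OF D])
      then show ?thesis by (simp add: proj_decomp)
    qed
    have "D X (proj Y + fscale (\<Lambda> Y) R) = D X (proj Y) + (fscale (\<Lambda> Y) (D X R) + fscale (vderiv X (\<Lambda> Y)) R)"
      using X Y contact_vfield[OF proj_contact[OF Y]]
      by (simp add: affine_add_right[OF D] affine_fscale_right[OF D])
    then show ?thesis
      using l[OF reeb_vfield] l[OF contact_vfield[OF proj_contact[OF Y]]] by (simp add: proj_decomp add.assoc)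
  qed
  have E: "D X Y = D' X Y" if X: "X \<in> V" and Y: "Y \<in> V" for X Y
    unfolding right[OF D X Y] right[OF D' X Y] using X Y by (simp add: cc cr rc rr)
  have ext: "D \<in> V \<rightarrow>\<^sub>E (V \<rightarrow>\<^sub>E V)" "D' \<in> V \<rightarrow>\<^sub>E (V \<rightarrow>\<^sub>E V)"
    using D D' by (simp_all add: affine_connection_def)
  show ?thesis
  proof (rule PiE_ext[OF ext])
    fix X assume X: "X \<in> V"
    show "D X = D' X"
      by (rule PiE_ext[OF PiE_mem[OF ext(1) X] PiE_mem[OF ext(2) X]]) (rule E[OF X])
  qed
qed

text \<open>In the proof, the two relations \<open>1\<close> (Hermitian in the Reeb direction) and \<open>2\<close> (the condition with \<open>c\<close>)
  are subtracted to eliminate \<open>D (J Y) R\<close>, which leaves \<open>J\<close> applied to the wanted value.\<close>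

lemma
  assumes D: "triad_connection c D" and Y: "Y \<in> \<Xi>"
  shows triad_connection_contact_reeb: "D Y R = reeb_deriv c Y"
    and triad_connection_reeb_contact: "D R Y = reeb_deriv c Y + lie_bracket R Y"
proof -
  have aff: "affine_connection A D" using D by (simp add: triad_connection_def)
  have DR: "D Y R \<in> \<Xi>" if "Y \<in> \<Xi>" for Y using D that by (simp add: triad_connection_def)
  have RD: "D R Y = D Y R + lie_bracket R Y" if "Y \<in> \<Xi>" for Y
  proof -
    have "torsion D R Y = 0" using D that contact_vfield by (simp add: triad_connection_def)
    then show ?thesis by (simp add: torsion_def algebra_simps)
  qed
  have RDc: "D R Y \<in> \<Xi>" if "Y \<in> \<Xi>" for Y
    using that by (simp add: RD DR reeb_bracket_contact contact_intros)
  note JY = J_contact[OF Y]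
  have "hermitian_conn A lam J (proj_conn A lam D)" using D by (simp add: triad_connection_def)
  then have "proj_conn A lam D R (J_ext A lam J Y) = J_ext A lam J (proj_conn A lam D R Y)"
    unfolding hermitian_conn_def using Y by simp
  then have "D R (\<J> Y) = \<J> (D R Y)"
    using Y JY RDc by (simp add: proj_conn_def J_ext_contact)
  then have 1: "D (\<J> Y) R + lie_bracket R (\<J> Y) = \<J> (D Y R) + \<J> (lie_bracket R Y)"
    using Y JY by (simp add: RD J_add DR reeb_bracket_contact)
  have "D (J_ext A lam J Y) R + J_ext A lam J (D Y R) = fscale (\<lambda>_. c) Y"
    using D Y by (simp add: triad_connection_def)
  then have 2: "D (\<J> Y) R + \<J> (D Y R) = fscale (\<lambda>_. c) Y"
    using Y DR[OF Y] by (simp add: J_ext_contact)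
  have "\<J> (D Y R) = fscale (\<lambda>_. 1/2) (fscale (\<lambda>_. c) Y + lie_bracket R (\<J> Y) - \<J> (lie_bracket R Y))"
  proof (intro ext)
    fix p f
    show "\<J> (D Y R) p f = fscale (\<lambda>_. 1/2) (fscale (\<lambda>_. c) Y + lie_bracket R (\<J> Y) - \<J> (lie_bracket R Y)) p f"
      using fun_cong[OF fun_cong[OF 1, of p], of f] fun_cong[OF fun_cong[OF 2, of p], of f]
      by (simp add: fscale_pointwise)
  qed
  then have "\<J> (\<J> (D Y R)) = fscale (\<lambda>_. 1/2) (fscale (\<lambda>_. c) (\<J> Y) + \<J> (lie_bracket R (\<J> Y)) + lie_bracket R Y)"
    using Y JY by (simp add: J_fscale J_add J_diff J_J J_contact reeb_bracket_contact contact_intros)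
  then have "D Y R = - fscale (\<lambda>_. 1/2) (fscale (\<lambda>_. c) (\<J> Y) + \<J> (lie_bracket R (\<J> Y)) + lie_bracket R Y)"
    using DR[OF Y] by (simp add: J_J) (metis minus_minus)
  then show "D Y R = reeb_deriv c Y" by (simp add: reeb_deriv_def fun_eq_iff fscale_pointwise algebra_simps)
  then show "D R Y = reeb_deriv c Y + lie_bracket R Y" using RD[OF Y] by simp
qed

lemma triad_connection_unique:
  assumes D: "triad_connection c D" and D': "triad_connection c D'"
  shows "D = D'"
proof (rule affine_connection_eqI)
  show "affine_connection A D" "affine_connection A D'"
    using D D' by (simp_all add: triad_connection_def)
  show "D R R = D' R R" using D D' by (simp add: triad_connection_def)
  show "D X R = D' X R" if "X \<in> \<Xi>" for X
    using triad_connection_contact_reeb[OF D that] triad_connection_contact_reeb[OF D' that] by simp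
  show "D R Y = D' R Y" if "Y \<in> \<Xi>" for Y
    using triad_connection_reeb_contact[OF D that] triad_connection_reeb_contact[OF D' that] by simp
  have form: "\<Lambda> (D X Y) = - g (reeb_deriv c X) Y" if D: "triad_connection c D" and X: "X \<in> \<Xi>" and Y: "Y \<in> \<Xi>" for D X Y
  proof -
    have "D X Y \<in> V" using D X Y affine_vfield contact_vfield by (auto simp: triad_connection_def)
    moreover have "triad_metric A lam J (D X R) Y + triad_metric A lam J R (D X Y) = 0"
      using D X Y by (simp add: triad_connection_def)
    ultimately show ?thesis
      using X Y triad_connection_contact_reeb[OF D X]
      by (simp add: triad_metric_contact triad_metric_reeb reeb_deriv_contact contact_vfield eq_neg_iff_add_eq_0 add.commute)
  qed
  define P where "P D X Y = proj (D X Y)" for D :: "'q conn" and X Y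
  have P: "P D X Y \<in> \<Xi>" "P D X (\<J> Y) = \<J> (P D X Y)"
      "P D (X + X') Y = P D X Y + P D X' Y" "P D X (Y + X') = P D X Y + P D X X'"
      "vderiv X (g Y X') = g (P D X Y) X' + g Y (P D X X')"
      "P D (\<J> Y) Y = P D Y (\<J> Y) + proj (lie_bracket (\<J> Y) Y)"
    if D: "triad_connection c D" and X: "X \<in> \<Xi>" "X' \<in> \<Xi>" "Y \<in> \<Xi>" for D X X' Y
  proof -
    have aff: "affine_connection A D" using D by (simp add: triad_connection_def)
    have V: "D X Y \<in> V" if "X \<in> \<Xi>" "Y \<in> \<Xi>" for X Y
      using affine_vfield[OF aff] that contact_vfield by blast
    have PX: "P D X Y \<in> \<Xi>" if "X \<in> \<Xi>" "Y \<in> \<Xi>" for X Y unfolding P_def using V that by blast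
    show "P D X Y \<in> \<Xi>" using PX X by blast
    show "P D (X + X') Y = P D X Y + P D X' Y" "P D X (Y + X') = P D X Y + P D X X'"
      unfolding P_def using X V
      by (simp_all add: affine_add_left[OF aff] affine_add_right[OF aff] contact_vfield proj_add)
    have h: "hermitian_conn A lam J (proj_conn A lam D)" using D by (simp add: triad_connection_def)
    have Ppc: "proj_conn A lam D = P D" by (simp add: proj_conn_def P_def fun_eq_iff)
    show "P D X (\<J> Y) = \<J> (P D X Y)"
      using h[unfolded hermitian_conn_def, THEN conjunct1, rule_format, of X Y] X PX
      by (simp add: Ppc contact_vfield J_ext_contact)
    show "vderiv X (g Y X') = g (P D X Y) X' + g Y (P D X X')"
      using h[unfolded hermitian_conn_def, THEN conjunct2, rule_format, of X Y X'] X PX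
      by (simp add: Ppc contact_vfield triad_metric_contact)
    have "proj (torsion D (J_ext A lam J Y) Y) = 0" using D X by (simp add: triad_connection_def)
    then have "proj (D (\<J> Y) Y - D Y (\<J> Y) - lie_bracket (\<J> Y) Y) = 0"
      using X by (simp add: torsion_def J_ext_contact)
    then have "P D (\<J> Y) Y - P D Y (\<J> Y) - proj (lie_bracket (\<J> Y) Y) = 0"
      using X V J_contact by (simp add: P_def proj_diff contact_vfield)
    then show "P D (\<J> Y) Y = P D Y (\<J> Y) + proj (lie_bracket (\<J> Y) Y)"
      by (simp add: algebra_simps)
  qed
  show "D X Y = D' X Y" if X: "X \<in> \<Xi>" and Y: "Y \<in> \<Xi>" for X Y
  proof -
    define B where "B X Y = P D X Y - P D' X Y" for X Y
    have "B X Y = 0"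
    proof (rule hermitian_difference_zero[of B])
      fix X Y Z assume X: "X \<in> \<Xi>" and Y: "Y \<in> \<Xi>" and Z: "Z \<in> \<Xi>"
      note PD = P[OF D X Z Y] and PD' = P[OF D' X Z Y]
      show "B X Y \<in> \<Xi>" unfolding B_def using PD(1) PD'(1) by (rule contact_diff)
      show "B (X + Z) Y = B X Y + B Z Y" unfolding B_def PD(3) PD'(3) by simp
      show "B X (Y + Z) = B X Y + B X Z" unfolding B_def PD(4) PD'(4) by simp
      show "B X (\<J> Y) = \<J> (B X Y)" unfolding B_def PD(2) PD'(2) using PD(1) PD'(1) by (simp add: J_diff)
      show "B (\<J> Y) Y = B Y (\<J> Y)" unfolding B_def PD(6) PD'(6) by simp
      have PZ: "P D X Z \<in> \<Xi>" "P D' X Z \<in> \<Xi>" using P(1)[OF D X X Z] P(1)[OF D' X X Z] by auto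
      have 1: "g Y (B X Z) = g Y (P D X Z) - g Y (P D' X Z)"
        unfolding B_def using Y PZ by (simp add: g_sym[OF Y] g_diff_left contact_vfield contact_intros)
      have 2: "g (B X Y) Z = g (P D X Y) Z - g (P D' X Y) Z"
        unfolding B_def using Z PD(1) PD'(1) by (simp add: g_diff_left contact_vfield)
      have "g (P D X Y) Z + g Y (P D X Z) = g (P D' X Y) Z + g Y (P D' X Z)"
        using PD(5) PD'(5) by simp
      then show "g (B X Y) Z = - g Y (B X Z)" unfolding 1 2 by (simp add: algebra_simps)
    qed (use X Y in auto)
    then have "proj (D X Y) = proj (D' X Y)" by (simp add: B_def P_def)
    moreover have "\<Lambda> (D X Y) = \<Lambda> (D' X Y)" using form[OF D X Y] form[OF D' X Y] by simp
    ultimately show ?thesis using proj_decomp by metis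
  qed
qed

end

theorem theorem5:
  fixes A :: "('q::{t2_space,second_countable_topology}, 'e::euclidean_space) chart set"
    and n :: nat
    and lam :: "'q \<Rightarrow> 'q tvec \<Rightarrow> real"
    and J :: "'q \<Rightarrow> 'q tvec \<Rightarrow> 'q tvec"
    and c :: real
  assumes "contact_triad n A lam J"
  shows "\<exists>!D. affine_connection A D \<and>
    hermitian_conn A lam J (proj_conn A lam D) \<and>
    (\<forall>Y\<in>contact_sections A lam. contact_proj A lam (torsion D (J_ext A lam J Y) Y) = 0) \<and>
    (\<forall>Y\<in>vfields A. torsion D (reeb A lam) Y = 0) \<and>
    (D (reeb A lam) (reeb A lam) = 0 \<and>
     (\<forall>Y\<in>contact_sections A lam. D Y (reeb A lam) \<in> contact_sections A lam)) \<and>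
    (\<forall>Y\<in>contact_sections A lam.
       D (J_ext A lam J Y) (reeb A lam) + J_ext A lam J (D Y (reeb A lam)) = fscale (\<lambda>_. c) Y) \<and>
    (\<forall>Y\<in>contact_sections A lam. \<forall>Z\<in>contact_sections A lam.
       triad_metric A lam J (D Y (reeb A lam)) Z + triad_metric A lam J (reeb A lam) (D Y Z) = 0)"
proof -
  interpret contact_triad_manifold A n lam J
    using assms by unfold_locales (simp_all add: contact_triad_def)
  have "\<exists>!D. triad_connection c D"
    using triad_conn_triad_connection triad_connection_unique by blast
  then show ?thesis unfolding triad_connection_def .
qed

end
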